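(* Let $e^{\xi}=(e^{\xi_1},\ldots,e^{\xi_d})$ and $e^{\xi^*}=(e^{\xi_1^*},\ldots,e^{\xi_d^*})$ be integrable random vectors such that $\xi$ and $\xi^*$ are infinitely divisible random vectors in $\mathbb{R}^d$ with Lévy triplets $(A,\nu,b)$ and $(A^*,\nu^*,b^* )$, respectively. If $d\ge2$, then $e^{\xi}$ and $e^{\xi^*}$ are zonoid equivalent if and only if the following three conditions hold. (a) $\gamma_{ij}=\gamma^*_{ij}$ for all $i,j\in\{1,\ldots,d\}$, where $\gamma_{ij}=a_{ii}+a_{jj}-2a_{ij}$ and $\gamma^*_{ij}=a^*_{ii}+a^*_{jj}-2a^*_{ij}$. (b) The images $\hat\nu U^{-1}$ and $\hat\nu^*U^{-1}$ under $U$ of the measures $d\hat\nu(x)=e^{x_d}\,d\nu(x)$ and $d\hat\nu^*(x)=e^{x_d}\,d\nu^*(x)$, $x\in\mathbb{R}^d$, restricted to $\mathbb{R}^{d-1}\setminus\{0\}$, coincide. (c) $\mathbf{E}e^{\xi_i}=\mathbf{E}e^{\xi_i^*}$ for all $i=1,\ldots,d$, that is, $$b_i+\tfrac12a_{ii}+\int_{\mathbb{R}^d}\bigl(e^{x_i}-1-x_i\mathbf{1}_{\|x\|\le1}\bigr)\,d\nu(x)=b_i^*+\tfrac12a^*_{ii}+\int_{\mathbb{R}^d}\bigl(e^{x_i}-1-x_i\mathbf{1}_{\|x\|\le1}\bigr)\,d\nu^*(x).$$ If $d=1$, then $e^{\xi}$ and $e^{\xi^*}$ are zonoid equivalent if and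 only if (c) holds.
   Context: Two integrable random vectors $\eta,\eta^*$ in $\mathbb{R}^d$ are zonoid equivalent if $\mathbf{E}|\langle u,\eta\rangle|=\mathbf{E}|\langle u,\eta^*\rangle|$ for all $u\in\mathbb{R}^d$. An infinitely divisible random vector $\xi$ in $\mathbb{R}^d$ has Lévy triplet $(A,\nu,b)$ if $$\mathbf{E}e^{i\langle u,\xi\rangle}=\exp\Bigl\{i\langle b,u\rangle-\tfrac12\langle u,Au\rangle+\int_{\mathbb{R}^d}\bigl(e^{i\langle u,x\rangle}-1-i\langle u,x\rangle\mathbf{1}_{\|x\|\le1}\bigr)\,d\nu(x)\Bigr\},\quad u\in\mathbb{R}^d,$$ where $A=(a_{ij})$ is a symmetric non-negative definite $d\times d$ matrix, $b\in\mathbb{R}^d$, and $\nu$ is a measure on $\mathbb{R}^d$ with $\nu(\{0\})=0$ and $\int\min(\|x\|^2,1)\,d\nu(x)<\infty$; $A^*=(a^*_{ij})$. For $d\ge2$, $U$ is the $(d-1)\times d$ matrix with $Ux=(x_1-x_d,\ldots,x_{d-1}-x_d)$, and $\hat\nu U^{-1}$ denotes the push-forward measure $B\mapsto\hat\nu(\{x:Ux\in B\})$. *)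

theory Defs
  imports "HOL-Probability.Probability"
begin

definition zonoid_equivalent ::
    "'a measure \<Rightarrow> ('a \<Rightarrow> real ^ 'n) \<Rightarrow> 'b measure \<Rightarrow> ('b \<Rightarrow> real ^ 'n) \<Rightarrow> bool" where
  "zonoid_equivalent M X N Y \<longleftrightarrow>
     integrable M X \<and> integrable N Y \<and>
     (\<forall>u. (\<integral>\<omega>. \<bar>u \<bullet> X \<omega>\<bar> \<partial>M) = (\<integral>\<omega>. \<bar>u \<bullet> Y \<omega>\<bar> \<partial>N))"

definition exp_vec :: "real ^ 'n \<Rightarrow> real ^ 'n" where
  "exp_vec x = (\<chi> i. exp (x $ i))"

(* For every k >= 1, the law of X is that of a sum of k i.i.d. random vectors; rho is their
   common law. *)
definition infinitely_divisible :: "'a measure \<Rightarrow> ('a \<Rightarrow> real ^ 'n) \<Rightarrow> bool" where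
  "infinitely_divisible M X \<longleftrightarrow>
     (\<forall>k::nat. k \<ge> 1 \<longrightarrow>
        (\<exists>\<rho> :: (real ^ 'n) measure. prob_space \<rho> \<and> sets \<rho> = sets borel \<and>
           distr M borel X = distr (\<Pi>\<^sub>M j\<in>{..<k}. \<rho>) borel (\<lambda>y. \<Sum>j<k. y j)))"

definition levy_measure :: "(real ^ 'n) measure \<Rightarrow> bool" where
  "levy_measure \<nu> \<longleftrightarrow>
     sets \<nu> = sets borel \<and> emeasure \<nu> {0} = 0 \<and>
     (\<integral>\<^sup>+ x. ennreal (min ((norm x)\<^sup>2) 1) \<partial>\<nu>) < \<infinity>"

definition has_levy_triplet ::
    "'a measure \<Rightarrow> ('a \<Rightarrow> real ^ 'n) \<Rightarrow> real ^ 'n ^ 'n \<Rightarrow> (real ^ 'n) measure \<Rightarrow> real ^ 'n \<Rightarrow> bool" where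
  "has_levy_triplet M X A \<nu> b \<longleftrightarrow>
     transpose A = A \<and> (\<forall>u. 0 \<le> u \<bullet> (A *v u)) \<and> levy_measure \<nu> \<and>
     (\<forall>u. (CLINT \<omega>|M. iexp (u \<bullet> X \<omega>)) =
        exp (\<i> * complex_of_real (b \<bullet> u) - complex_of_real (u \<bullet> (A *v u)) / 2
             + (CLINT x|\<nu>. iexp (u \<bullet> x) - 1
                   - \<i> * complex_of_real ((u \<bullet> x) * indicat_real {x. norm x \<le> 1} x))))"

definition levy_gamma :: "real ^ 'n ^ 'n \<Rightarrow> 'n \<Rightarrow> 'n \<Rightarrow> real" where
  "levy_gamma A i j = A $ i $ i + A $ j $ j - 2 * A $ i $ j"

(* The linearly ordered finite type 'n plays the role of {1,...,d}; this is the index d. *)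
definition last_index :: "'n::{finite,linorder}" where
  "last_index = Max UNIV"

(* The space of dimension d - 1 is the finite product of copies of the real line indexed by all
   coordinates except the last one. *)
definition reduced_borel :: "('n::{finite,linorder} \<Rightarrow> real) measure" where
  "reduced_borel = (\<Pi>\<^sub>M i\<in>UNIV - {last_index}. borel)"

definition reduced_zero :: "'n::{finite,linorder} \<Rightarrow> real" where
  "reduced_zero = (\<lambda>i\<in>UNIV - {last_index}. 0)"

definition diff_last :: "real ^ 'n::{finite,linorder} \<Rightarrow> 'n \<Rightarrow> real" where
  "diff_last x = (\<lambda>i\<in>UNIV - {last_index}. x $ i - x $ last_index)"

lemma measurable_diff_last: "diff_last \<in> borel \<rightarrow>\<^sub>M reduced_borel"
  unfolding diff_last_def reduced_borel_def by (intro measurable_restrict) measurable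

lemma sets_reduced_zero:
  "{reduced_zero :: 'n::{finite,linorder} \<Rightarrow> real} \<in> sets reduced_borel"
proof -
  have *: "{reduced_zero :: 'n \<Rightarrow> real} = (\<Pi>\<^sub>E i\<in>UNIV - {last_index :: 'n}. {0::real})"
    by (simp add: reduced_zero_def PiE_singleton)
  show ?thesis
    unfolding reduced_borel_def * by (rule sets_PiM_I_finite) auto
qed

definition tilted ::
    "(real ^ 'n::{finite,linorder}) measure \<Rightarrow>
      (real ^ 'n::{finite,linorder}) measure" where
  "tilted \<nu> = density \<nu> (\<lambda>x. ennreal (exp (x $ last_index)))"

definition reduced_levy_measure ::
    "(real ^ 'n::{finite,linorder}) measure \<Rightarrow> ('n \<Rightarrow> real) measure" where
  "reduced_levy_measure \<nu> =
     restrict_space (distr (tilted \<nu>) reduced_borel diff_last) (space reduced_borel - {reduced_zero})"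

(* The logarithm of the expectation of exp (X $ i) if X has Levy triplet (A, nu, b) and this
   expectation is finite. *)
definition levy_exponent ::
    "real ^ 'n ^ 'n \<Rightarrow> (real ^ 'n) measure \<Rightarrow> real ^ 'n \<Rightarrow> 'n \<Rightarrow> real" where
  "levy_exponent A \<nu> b i =
     b $ i + A $ i $ i / 2
       + (\<integral>x. exp (x $ i) - 1 - x $ i * indicat_real {x. norm x \<le> 1} x \<partial>\<nu>)"

end

theory Submission
  imports Defs "HOL-Complex_Analysis.Complex_Analysis"
begin

text \<open>Let \<open>d\<close> be the last index and let \<open>Q\<close> be the law of the differences \<open>\<xi>\<^sub>i - \<xi>\<^sub>d\<close>, \<open>i \<noteq> d\<close>, under the
  finite measure with density \<open>exp \<xi>\<^sub>d\<close>. Differentiating \<open>t \<mapsto> E \<bar>Z - t\<bar>\<close> recovers the law of \<open>Z\<close>, so by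
  uniqueness of characteristic functions zonoid equivalence means that \<open>Q\<close> is the same for both vectors.

  The characteristic function of \<open>Q\<close> is the Levy-Khintchine formula at complex arguments. It first needs
  \<open>exp x\<^sub>d\<close> to be integrable over \<open>\<nu>\<close> away from the origin: if \<open>\<rho>\<^sub>n\<close> is the law of the \<open>n\<close>-th convolution root
  of \<open>\<xi>\<^sub>d\<close>, then \<open>n (1 - cos (s x))\<^sup>2 \<rho>\<^sub>n\<close> converges weakly to \<open>(1 - cos (s x))\<^sup>2 \<nu>\<close>, while the integrals of
  \<open>n (1 - cos (s x)) exp x\<close> with respect to \<open>\<rho>\<^sub>n\<close> stay bounded for small \<open>s\<close> because the tilted laws are infinitely
  divisible too; averaging over \<open>s\<close> gives the claim. The formula then extends from the imaginary axis to the
  strip \<open>0 \<le> Re z \<le> 1\<close> by analytic continuation.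

  Second differences of the logarithm remove the drift, and repeated second differences also remove the
  Gaussian part, so that \<open>Q\<close> determines first the image of the tilted Levy measure and then the numbers
  \<open>\<gamma>\<^sub>i\<^sub>j\<close>. Conversely these data determine \<open>Q\<close> up to a shift, which is fixed by the expectations.\<close>

section \<open>Uniqueness of finite measures\<close>

text \<open>Zonoid equivalence depends only on \<open>Q\<close> because the inner product of u with
  exp \<xi> is exp \<xi>_d times an affine function of the exponentials of the differences; the
  positive factor becomes a density. The main obstacle is that the formula is given for real u only,
  and integrability of exp \<xi> has to be transferred to \<nu> before complex arguments make sense.
  The weight 1 - cos (s x) is squared because a single factor leaves an atom at 0 in the limit,
  produced by the Gaussian part; the bound for the tilted roots needs only the single factor. Small
  s is all that is available there: before the formula is established, the transform of the tilted
  law is known to be nonzero only near 0. No fixed s bounds the weight from below for all large x,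
  since it vanishes at the multiples of 2 pi / s, but its average over s does. The continuation must
  reach the boundary point z = 1, so continuity up to the edges of the strip matters. When Levy
  measures are compared, the zeros of the cosine weights return; two incommensurable frequencies
  remove them.\<close>

lemma integrable_bounded_mult:
  fixes f g :: "'a \<Rightarrow> real"
  assumes "integrable M f" and [measurable]: "g \<in> borel_measurable M" and "\<And>x. x \<in> space M \<Longrightarrow> \<bar>g x\<bar> \<le> B"
  shows "integrable M (\<lambda>x. f x * g x)"
proof (rule Bochner_Integration.integrable_bound)
  show "integrable M (\<lambda>x. B * f x)" using assms by simp
  show "(\<lambda>x. f x * g x) \<in> borel_measurable M" using assms(1) by simp
  show "AE x in M. norm (f x * g x) \<le> norm (B * f x)"
  proof (rule AE_I2)
    fix x assume "x \<in> space M"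
    then have "\<bar>g x\<bar> \<le> \<bar>B\<bar>" using assms(3)[of x] by linarith
    then show "norm (f x * g x) \<le> norm (B * f x)"
      using mult_right_mono[of "\<bar>g x\<bar>" "\<bar>B\<bar>" "\<bar>f x\<bar>"] by (simp add: abs_mult mult.commute)
  qed
qed

section \<open>Weighted laws on the real line and their transforms\<close>

text \<open>Normalised because the classical theorems on characteristic functions concern
  probability laws. If the integral of \<open>h\<close> is 0, the quotient is 0 and this is the null
  measure, so that case is always treated separately.\<close>

definition weighted_law :: "'a measure \<Rightarrow> ('a \<Rightarrow> real) \<Rightarrow> ('a \<Rightarrow> real) \<Rightarrow> real measure" where
  "weighted_law \<mu> h Y = distr (density \<mu> (\<lambda>x. ennreal (h x / (\<integral>x. h x \<partial>\<mu>)))) borel Y"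

lemma real_distribution_weighted_law:
  assumes h: "integrable \<mu> h" "\<And>x. 0 \<le> h x" and pos: "0 < (\<integral>x. h x \<partial>\<mu>)"
    and [measurable]: "Y \<in> borel_measurable \<mu>"
  shows "real_distribution (weighted_law \<mu> h Y)"
proof -
  have [measurable]: "h \<in> borel_measurable \<mu>" using h(1) by simp
  have "emeasure (density \<mu> (\<lambda>x. ennreal (h x / (\<integral>x. h x \<partial>\<mu>)))) (space \<mu>)
      = (\<integral>\<^sup>+x. ennreal (h x / (\<integral>x. h x \<partial>\<mu>)) \<partial>\<mu>)"
    by (simp add: emeasure_density nn_set_integral_space)
  also have "\<dots> = 1"
    using h pos by (subst nn_integral_eq_integral) auto
  finally interpret prob_space "density \<mu> (\<lambda>x. ennreal (h x / (\<integral>x. h x \<partial>\<mu>)))"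
    by (intro prob_spaceI) simp
  show ?thesis
    unfolding weighted_law_def real_distribution_def real_distribution_axioms_def
    by (auto intro!: prob_space_distr)
qed

lemma integral_weighted_law:
  fixes f :: "real \<Rightarrow> 'b::{banach, second_countable_topology}"
  assumes h: "integrable \<mu> h" "\<And>x. 0 \<le> h x" and pos: "0 < (\<integral>x. h x \<partial>\<mu>)"
    and [measurable]: "Y \<in> borel_measurable \<mu>" "f \<in> borel_measurable borel"
  shows "integral\<^sup>L (weighted_law \<mu> h Y) f = (\<integral>x. h x *\<^sub>R f (Y x) \<partial>\<mu>) /\<^sub>R (\<integral>x. h x \<partial>\<mu>)"
proof -
  have [measurable]: "h \<in> borel_measurable \<mu>" using h(1) by simp
  have "integral\<^sup>L (weighted_law \<mu> h Y) f
     = (\<integral>x. (h x / (\<integral>x. h x \<partial>\<mu>)) *\<^sub>R f (Y x) \<partial>\<mu>)"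
    unfolding weighted_law_def using h(2) pos
    by (simp add: integral_distr integral_density)
  also have "\<dots> = (\<integral>x. (1 / (\<integral>x. h x \<partial>\<mu>)) *\<^sub>R (h x *\<^sub>R f (Y x)) \<partial>\<mu>)"
    by (intro Bochner_Integration.integral_cong) auto
  also have "\<dots> = (1 / (\<integral>x. h x \<partial>\<mu>)) *\<^sub>R (\<integral>x. h x *\<^sub>R f (Y x) \<partial>\<mu>)"
    by (rule integral_scaleR_right)
  finally show ?thesis by (simp add: divide_inverse)
qed

lemma weight_null_integral:
  fixes f :: "'a \<Rightarrow> 'b::{banach, second_countable_topology}"
  assumes h: "integrable \<mu> h" "\<And>x. 0 \<le> h x" and null: "(\<integral>x. h x \<partial>\<mu>) = (0::real)"
  shows "(\<integral>x. h x *\<^sub>R f x \<partial>\<mu>) = 0"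
proof -
  have "AE x in \<mu>. h x = 0"
    using integral_nonneg_eq_0_iff_AE[OF h(1)] h(2) null by auto
  then have "AE x in \<mu>. h x *\<^sub>R f x = 0" by auto
  then show ?thesis by (rule integral_eq_zero_AE)
qed

text \<open>The case t = 0 of \<open>eq\<close> equates the total masses; the rest is Levy's
  uniqueness theorem for the normalised laws. If \<open>f\<close> is not integrable against the
  weighted law, both sides have the default value 0.\<close>

lemma weighted_char_unique:
  fixes \<mu> :: "'a measure" and \<mu>' :: "'b measure" and f :: "real \<Rightarrow> real"
  assumes h: "integrable \<mu> h" "\<And>x. 0 \<le> h x" and Y: "Y \<in> borel_measurable \<mu>"
    and h': "integrable \<mu>' h'" "\<And>x. 0 \<le> h' x" and Y': "Y' \<in> borel_measurable \<mu>'"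
    and eq: "\<And>t. (CLINT x|\<mu>. h x *\<^sub>R iexp (t * Y x)) = (CLINT x|\<mu>'. h' x *\<^sub>R iexp (t * Y' x))"
    and f: "f \<in> borel_measurable borel"
  shows "(\<integral>x. h x * f (Y x) \<partial>\<mu>) = (\<integral>x. h' x * f (Y' x) \<partial>\<mu>')"
proof -
  have "complex_of_real (\<integral>x. h x \<partial>\<mu>) = complex_of_real (\<integral>x. h' x \<partial>\<mu>')"
    using eq[of 0] by (simp add: scaleR_conv_of_real flip: integral_complex_of_real)
  then have total: "(\<integral>x. h x \<partial>\<mu>) = (\<integral>x. h' x \<partial>\<mu>')" by simp
  show ?thesis
  proof (cases "(\<integral>x. h x \<partial>\<mu>) = 0")
    case True
    then show ?thesis
      using weight_null_integral[OF h, of "\<lambda>x. f (Y x)"] weight_null_integral[OF h', of "\<lambda>x. f (Y' x)"] total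
      by simp
  next
    case False
    then have pos: "0 < (\<integral>x. h x \<partial>\<mu>)"
      using h(2) by (simp add: order_less_le integral_nonneg_AE)
    then have pos': "0 < (\<integral>x. h' x \<partial>\<mu>')" using total by simp
    have "weighted_law \<mu> h Y = weighted_law \<mu>' h' Y'"
    proof (rule Levy_uniqueness)
      show "char (weighted_law \<mu> h Y) = char (weighted_law \<mu>' h' Y')"
        unfolding char_def
        by (rule ext, subst (1 2) integral_weighted_law) (use assms pos pos' total in auto)
    qed (intro real_distribution_weighted_law assms pos pos')+
    then show ?thesis
      using integral_weighted_law[OF h pos Y f] integral_weighted_law[OF h' pos' Y' f] total pos
      by auto
  qed
qed

text \<open>The masses converge by the case t = 0. A zero limit mass is handled by the bound
  \<open>B * m n\<close>, a positive one by normalisation and Levy's continuity theorem.\<close>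

lemma weighted_levy_continuity:
  fixes \<mu> :: "nat \<Rightarrow> 'a measure" and \<mu>' :: "'b measure" and f :: "real \<Rightarrow> real"
  assumes h: "\<And>n. integrable (\<mu> n) (h n)" "\<And>n x. 0 \<le> h n x" and Y: "\<And>n. Y n \<in> borel_measurable (\<mu> n)"
    and h': "integrable \<mu>' h'" "\<And>x. 0 \<le> h' x" and Y': "Y' \<in> borel_measurable \<mu>'"
    and conv: "\<And>t. (\<lambda>n. CLINT x|\<mu> n. h n x *\<^sub>R iexp (t * Y n x)) \<longlonglongrightarrow> (CLINT x|\<mu>'. h' x *\<^sub>R iexp (t * Y' x))"
    and f: "\<And>x. isCont f x" "\<And>x. \<bar>f x\<bar> \<le> B"
  shows "(\<lambda>n. \<integral>x. h n x * f (Y n x) \<partial>\<mu> n) \<longlonglongrightarrow> (\<integral>x. h' x * f (Y' x) \<partial>\<mu>')"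
proof -
  have f_borel [measurable]: "f \<in> borel_measurable borel"
    by (intro borel_measurable_continuous_onI continuous_at_imp_continuous_on ballI f)
  note Y[measurable]
  have [measurable]: "h n \<in> borel_measurable (\<mu> n)" for n using h(1)[of n] by simp
  define m where "m n = (\<integral>x. h n x \<partial>\<mu> n)" for n
  define m' where "m' = (\<integral>x. h' x \<partial>\<mu>')"
  have "(\<lambda>n. complex_of_real (m n)) \<longlonglongrightarrow> complex_of_real m'"
    using conv[of 0] unfolding m_def m'_def
    by (simp add: scaleR_conv_of_real flip: integral_complex_of_real)
  then have m_conv: "m \<longlonglongrightarrow> m'" by (simp only: tendsto_of_real_iff)
  have m'_nonneg: "0 \<le> m'" unfolding m'_def using h'(2) by simp
  show ?thesis
  proof (cases "m' = 0")
    case True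
    have bound: "norm (\<integral>x. h n x * f (Y n x) \<partial>\<mu> n) \<le> B * m n" for n
    proof -
      have "norm (\<integral>x. h n x * f (Y n x) \<partial>\<mu> n) \<le> (\<integral>x. B * h n x \<partial>\<mu> n)"
      proof (rule order_trans[OF integral_norm_bound integral_mono])
        show int: "integrable (\<mu> n) (\<lambda>x. B * h n x)" using h by simp
        show bound: "norm (h n x * f (Y n x)) \<le> B * h n x" for x
          using h(2)[of n x] mult_right_mono[OF f(2), of "h n x" "Y n x"]
          by (simp add: abs_mult mult.commute)
        show "integrable (\<mu> n) (\<lambda>x. norm (h n x * f (Y n x)))"
          by (rule Bochner_Integration.integrable_bound[OF int])
             (use order_trans[OF bound abs_ge_self] in auto)
      qed
      then show ?thesis unfolding m_def by simp
    qed
    have "(\<lambda>n. B * m n) \<longlonglongrightarrow> 0"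
      using tendsto_mult_left[OF m_conv, of B] True by simp
    then have "(\<lambda>n. \<integral>x. h n x * f (Y n x) \<partial>\<mu> n) \<longlonglongrightarrow> 0"
      by (rule Lim_null_comparison[rotated]) (use bound in auto)
    then show ?thesis
      using weight_null_integral[OF h', of "\<lambda>x. f (Y' x)"] True by (simp add: m'_def)
  next
    case False
    then have pos': "0 < m'" using m'_nonneg by simp
    have ev: "\<forall>\<^sub>F n in sequentially. 0 < m n"
      using m_conv pos' by (rule order_tendstoD)
    define P where "P = weighted_law \<mu>' h' Y'"
    \<comment> \<open>The replacement by \<open>P\<close> affects only finitely many n and makes
      every term of the sequence a probability law.\<close>
    define Q where "Q n = (if 0 < m n then weighted_law (\<mu> n) (h n) (Y n) else P)" for n
    have rdP: "real_distribution P"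
      unfolding P_def using pos' by (intro real_distribution_weighted_law assms) (simp add: m'_def)
    have rdQ: "real_distribution (Q n)" for n
      using rdP by (auto simp: Q_def m_def intro!: real_distribution_weighted_law assms)
    have intP: "integral\<^sup>L P g = (\<integral>x. h' x *\<^sub>R g (Y' x) \<partial>\<mu>') /\<^sub>R m'"
      if "g \<in> borel_measurable borel" for g :: "real \<Rightarrow> 'c::{banach, second_countable_topology}"
      unfolding P_def m'_def using pos' that by (intro integral_weighted_law assms) (simp_all add: m'_def)
    have intQ: "\<forall>\<^sub>F n in sequentially. integral\<^sup>L (Q n) g = (\<integral>x. h n x *\<^sub>R g (Y n x) \<partial>\<mu> n) /\<^sub>R m n"
      if "g \<in> borel_measurable borel" for g :: "real \<Rightarrow> 'c::{banach, second_countable_topology}"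
      using ev
    proof eventually_elim
      case (elim n)
      then show ?case
        unfolding Q_def m_def using that by (simp, intro integral_weighted_law assms) simp_all
    qed
    have "weak_conv_m Q P"
    proof (rule levy_continuity[OF rdQ rdP])
      fix t
      have "(\<lambda>n. (CLINT x|\<mu> n. h n x *\<^sub>R iexp (t * Y n x)) /\<^sub>R m n) \<longlonglongrightarrow> char P t"
        unfolding char_def
        by (subst intP) (use tendsto_scaleR[OF tendsto_inverse[OF m_conv False] conv[of t]] in simp_all)
      then show "(\<lambda>n. char (Q n) t) \<longlonglongrightarrow> char P t"
        by (rule Lim_transform_eventually)
           (use intQ[of "\<lambda>x. iexp (t * x)"] in \<open>auto simp: char_def eq_commute\<close>)
    qed
    then have "(\<lambda>n. integral\<^sup>L (Q n) f) \<longlonglongrightarrow> integral\<^sup>L P f"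
      using weak_conv_imp_integral_bdd_continuous_conv[of Q P f B] rdQ rdP f by auto
    then have lim: "(\<lambda>n. m n * integral\<^sup>L (Q n) f) \<longlonglongrightarrow> m' * integral\<^sup>L P f"
      by (intro tendsto_mult m_conv)
    have transform: "\<forall>\<^sub>F n in sequentially. m n * integral\<^sup>L (Q n) f = (\<integral>x. h n x * f (Y n x) \<partial>\<mu> n)"
      using intQ[OF f_borel] ev by eventually_elim auto
    have "m' * integral\<^sup>L P f = (\<integral>x. h' x * f (Y' x) \<partial>\<mu>')"
      using intP[OF f_borel] pos' by simp
    then show ?thesis
      using Lim_transform_eventually[OF lim transform] by simp
  qed
qed

section \<open>Absolute moments and distribution functions\<close>

text \<open>The right difference quotients of t \<mapsto> E|Z - t| are bounded by 1 and tend to -1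
  where Z > t and to 1 where Z \<le> t. As the derivative is one-sided, atoms are no exception and
  the distribution function is recovered at every t.\<close>

lemma finite_measure_eq_if_abs_moments_eq:
  fixes Q :: "'a measure" and Q' :: "'b measure"
  assumes fin: "finite_measure Q" "finite_measure Q'"
    and Z: "integrable Q Z" and Z': "integrable Q' Z'"
    and total: "measure Q (space Q) = measure Q' (space Q')"
    and eq: "\<And>t::real. (\<integral>x. \<bar>Z x - t\<bar> \<partial>Q) = (\<integral>x. \<bar>Z' x - t\<bar> \<partial>Q')"
  shows "distr Q borel Z = distr Q' borel Z'"
proof -
  have lim: "(\<lambda>n. real (Suc n) * ((\<integral>x. \<bar>Z x - (t + 1 / real (Suc n))\<bar> \<partial>Q) - (\<integral>x. \<bar>Z x - t\<bar> \<partial>Q)))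
     \<longlonglongrightarrow> 2 * measure (distr Q borel Z) {..t} - measure Q (space Q)"
    if fin: "finite_measure Q" and Z: "integrable Q Z" for t and Z :: "'c \<Rightarrow> real" and Q
  proof -
    interpret finite_measure Q by fact
    have [measurable]: "Z \<in> borel_measurable Q" using Z by simp
    have int: "integrable Q (\<lambda>x. \<bar>Z x - s\<bar>)" for s
      using Z by (intro integrable_abs Bochner_Integration.integrable_diff) auto
    have "(\<lambda>n. \<integral>x. real (Suc n) * (\<bar>Z x - (t + 1 / real (Suc n))\<bar> - \<bar>Z x - t\<bar>) \<partial>Q)
        \<longlonglongrightarrow> (\<integral>x. 2 * indicator {..t} (Z x) - 1 \<partial>Q)"
    proof (rule integral_dominated_convergence[where w="\<lambda>_. 1"])
      show "AE x in Q. (\<lambda>n. real (Suc n) * (\<bar>Z x - (t + 1 / real (Suc n))\<bar> - \<bar>Z x - t\<bar>))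
          \<longlonglongrightarrow> 2 * indicator {..t} (Z x) - 1"
      proof (rule AE_I2, rule tendsto_eventually)
        fix x
        show "\<forall>\<^sub>F n in sequentially. real (Suc n) * (\<bar>Z x - (t + 1 / real (Suc n))\<bar> - \<bar>Z x - t\<bar>)
            = 2 * indicator {..t} (Z x) - 1"
        proof (cases "Z x \<le> t")
          case True
          have "real (Suc n) * (\<bar>Z x - (t + 1 / real (Suc n))\<bar> - \<bar>Z x - t\<bar>)
            = 2 * indicator {..t} (Z x) - 1" for n
          proof -
            have "1 / real (Suc n) > 0" by simp
            then have "\<bar>Z x - (t + 1 / real (Suc n))\<bar> - \<bar>Z x - t\<bar> = 1 / real (Suc n)" using True by linarith
            then show ?thesis using True by (simp del: of_nat_Suc)
          qed
          then show ?thesis by simp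
        next
          case False
          then have "0 < Z x - t" by simp
          moreover have "(\<lambda>n. 1 / real (Suc n)) \<longlonglongrightarrow> 0" by (rule LIMSEQ_Suc[OF lim_1_over_n])
          ultimately have "\<forall>\<^sub>F n in sequentially. 1 / real (Suc n) < Z x - t"
            by (metis order_tendstoD(2))
          then show ?thesis
          proof eventually_elim
            case (elim n)
            then have "\<bar>Z x - (t + 1 / real (Suc n))\<bar> - \<bar>Z x - t\<bar> = - (1 / real (Suc n))"
              using False by linarith
            then show ?case using False by (simp del: of_nat_Suc)
          qed
        qed
      qed
      fix n
      show "AE x in Q. norm (real (Suc n) * (\<bar>Z x - (t + 1 / real (Suc n))\<bar> - \<bar>Z x - t\<bar>)) \<le> 1"
      proof (rule AE_I2)
        fix x
        have "0 < 1 / real (Suc n)" by simp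
        then have "\<bar>\<bar>Z x - (t + 1 / real (Suc n))\<bar> - \<bar>Z x - t\<bar>\<bar> \<le> 1 / real (Suc n)" by linarith
        then have "real (Suc n) * \<bar>\<bar>Z x - (t + 1 / real (Suc n))\<bar> - \<bar>Z x - t\<bar>\<bar> \<le> real (Suc n) * (1 / real (Suc n))"
          by (intro mult_left_mono) auto
        then show "norm (real (Suc n) * (\<bar>Z x - (t + 1 / real (Suc n))\<bar> - \<bar>Z x - t\<bar>)) \<le> 1"
          by (simp add: abs_mult del: of_nat_Suc)
      qed
    qed auto
    moreover have "(\<integral>x. real (Suc n) * (\<bar>Z x - (t + 1 / real (Suc n))\<bar> - \<bar>Z x - t\<bar>) \<partial>Q)
        = real (Suc n) * ((\<integral>x. \<bar>Z x - (t + 1 / real (Suc n))\<bar> \<partial>Q) - (\<integral>x. \<bar>Z x - t\<bar> \<partial>Q))" for n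
      using int by (simp del: of_nat_Suc)
    moreover have "(\<integral>x. 2 * indicator {..t} (Z x) - 1 \<partial>Q) = 2 * measure (distr Q borel Z) {..t} - measure Q (space Q)"
    proof -
      have "(\<integral>x. indicator {..t} (Z x) \<partial>Q) = measure (distr Q borel Z) {..t}"
        by (subst integral_distr[symmetric, where N=borel]) auto
      moreover have "integrable Q (\<lambda>x. indicator {..t} (Z x) :: real)"
        by (rule integrable_const_bound[where B=1]) auto
      ultimately show ?thesis by simp
    qed
    ultimately show ?thesis by simp
  qed
  have "measure (distr Q borel Z) {..t} = measure (distr Q' borel Z') {..t}" for t
    using LIMSEQ_unique[OF lim[OF fin(1) Z, of t, unfolded eq] lim[OF fin(2) Z', of t]] total by simp
  then have "cdf (distr Q borel Z) = cdf (distr Q' borel Z')"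
    by (simp add: cdf_def fun_eq_iff)
  moreover have "finite_borel_measure (distr Q borel Z)"
    using finite_measure.finite_measure_distr[OF fin(1) borel_measurable_integrable[OF Z]]
    by (simp add: finite_borel_measure_def finite_borel_measure_axioms_def)
  moreover have "finite_borel_measure (distr Q' borel Z')"
    using finite_measure.finite_measure_distr[OF fin(2) borel_measurable_integrable[OF Z']]
    by (simp add: finite_borel_measure_def finite_borel_measure_axioms_def)
  ultimately show ?thesis by (intro cdf_unique')
qed

section \<open>Uniqueness in finite products of the line\<close>

text \<open>The phases 0 and -pi/2 yield the real and the imaginary part of the transform. The real
  form lets a cosine in other variables be part of the weight.\<close>

lemma weighted_cos_unique:
  fixes \<mu> :: "'a measure" and \<mu>' :: "'b measure" and f :: "real \<Rightarrow> real"
  assumes h: "integrable \<mu> h" "\<And>x. 0 \<le> h x" and Y: "Y \<in> borel_measurable \<mu>"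
    and h': "integrable \<mu>' h'" "\<And>x. 0 \<le> h' x" and Y': "Y' \<in> borel_measurable \<mu>'"
    and eq: "\<And>t c. (\<integral>x. h x * cos (c + t * Y x) \<partial>\<mu>) = (\<integral>x. h' x * cos (c + t * Y' x) \<partial>\<mu>')"
    and f: "f \<in> borel_measurable borel"
  shows "(\<integral>x. h x * f (Y x) \<partial>\<mu>) = (\<integral>x. h' x * f (Y' x) \<partial>\<mu>')"
proof (rule weighted_char_unique[OF h Y h' Y' _ f])
  fix t
  have split: "(CLINT x|N. g x *\<^sub>R iexp (t * Z x))
      = Complex (\<integral>x. g x * cos (t * Z x) \<partial>N) (\<integral>x. g x * cos (- pi / 2 + t * Z x) \<partial>N)"
    if "integrable N g" and [measurable]: "Z \<in> borel_measurable N" for N :: "'c measure" and g Z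
  proof -
    have [measurable]: "g \<in> borel_measurable N" using that(1) by simp
    have "integrable N (\<lambda>x. g x *\<^sub>R iexp (t * Z x))"
      by (rule Bochner_Integration.integrable_bound[OF that(1)]) auto
    moreover have "cos (- pi / 2 + y) = sin y" for y :: real
      by (simp add: cos_diff)
    ultimately show ?thesis
      by (intro complex_eqI) (simp_all add: integral_Re[symmetric] integral_Im[symmetric] Re_exp Im_exp del: integral_Re integral_Im)
  qed
  show "(CLINT x|\<mu>. h x *\<^sub>R iexp (t * Y x)) = (CLINT x|\<mu>'. h' x *\<^sub>R iexp (t * Y' x))"
    unfolding split[OF h(1) Y] split[OF h'(1) Y'] using eq[of 0 t] eq[of "- pi / 2" t] by simp
qed

text \<open>The coordinates are treated one at a time by the one-dimensional uniqueness theorem, applied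
  to the nonnegative weights \<open>W (1 + cos (\<dots>))\<close> with \<open>W\<close> an indicator in the coordinates done so far.\<close>
lemma measure_PiM_eq_if_char_eq:
  fixes \<mu> \<mu>' :: "('i \<Rightarrow> real) measure"
  assumes I: "finite I" and fin: "finite_measure \<mu>" "finite_measure \<mu>'"
    and sets: "sets \<mu> = sets (\<Pi>\<^sub>M i\<in>I. borel)" "sets \<mu>' = sets (\<Pi>\<^sub>M i\<in>I. borel)"
    and eq: "\<And>v. (CLINT y|\<mu>. iexp (\<Sum>i\<in>I. v i * y i)) = (CLINT y|\<mu>'. iexp (\<Sum>i\<in>I. v i * y i))"
  shows "\<mu> = \<mu>'"
proof -
  interpret \<mu>: finite_measure \<mu> by fact
  interpret \<mu>': finite_measure \<mu>' by fact
  note sets[measurable_cong]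
  have coord [measurable]: "(\<lambda>y. y i) \<in> borel_measurable N"
    if "i \<in> I" "sets N = sets (\<Pi>\<^sub>M i\<in>I. (borel :: real measure))" for i and N :: "('i \<Rightarrow> real) measure"
    using that by (simp cong: measurable_cong_sets)
  define W :: "'i set \<Rightarrow> ('i \<Rightarrow> real set) \<Rightarrow> ('i \<Rightarrow> real) \<Rightarrow> real"
    where "W S A y = (\<Prod>i\<in>S. indicator (A i) (y i))" for S A y
  have W01: "0 \<le> W S A y" "W S A y \<le> 1" for S A y
    unfolding W_def by (auto intro!: prod_nonneg prod_le_1 simp: indicator_def)
  have Wmeas: "W S A \<in> borel_measurable N"
    if "S \<subseteq> I" "\<And>i. i \<in> S \<Longrightarrow> A i \<in> sets borel" "sets N = sets (\<Pi>\<^sub>M i\<in>I. (borel :: real measure))" for S A N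
  proof -
    have "(\<lambda>y. indicator (A i) (y i) :: real) \<in> borel_measurable N" if "i \<in> S" for i
      by (rule measurable_compose[OF coord borel_measurable_indicator]) (use that \<open>S \<subseteq> I\<close> \<open>\<And>i. i \<in> S \<Longrightarrow> A i \<in> sets borel\<close> \<open>sets N = _\<close> in auto)
    then show ?thesis unfolding W_def by (intro borel_measurable_prod) auto
  qed
  have Wint: "integrable N (W S A)"
    if "S \<subseteq> I" "\<And>i. i \<in> S \<Longrightarrow> A i \<in> sets borel" "sets N = sets (\<Pi>\<^sub>M i\<in>I. (borel :: real measure))" "finite_measure N" for S A N
    using W01[of S A] by (intro finite_measure.integrable_const_bound[where B=1] that Wmeas) auto
  define \<theta> where "\<theta> S v y = (\<Sum>i\<in>I - S. v i * y i)" for S and v y :: "'i \<Rightarrow> real"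
  have \<theta>meas: "(\<lambda>y. \<theta> S v y) \<in> borel_measurable N"
    if "sets N = sets (\<Pi>\<^sub>M i\<in>I. (borel :: real measure))" for S v N
    unfolding \<theta>_def using that by (intro borel_measurable_sum borel_measurable_times coord) auto
  \<comment> \<open>This interpolates between hypothesis and goal: for empty \<open>S\<close> it
    follows from equality of the characteristic functions, and for \<open>S = I\<close>,
    \<open>c = 0\<close> it is equality on rectangles.\<close>
  have claim: "(\<integral>y. W S A y * cos (c + \<theta> S v y) \<partial>\<mu>) = (\<integral>y. W S A y * cos (c + \<theta> S v y) \<partial>\<mu>')"
    if "S \<subseteq> I" "\<And>i. i \<in> S \<Longrightarrow> A i \<in> sets borel" for S A v c
  proof -
    have "finite S" using that I finite_subset by blast
    then show ?thesis using that
    proof (induction S arbitrary: A v c rule: finite_induct)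
      case empty
      have "(\<integral>y. cos (c + \<theta> {} v y) \<partial>N) = Re (iexp c * (CLINT y|N. iexp (\<Sum>i\<in>I. v i * y i)))"
        if "sets N = sets (\<Pi>\<^sub>M i\<in>I. (borel :: real measure))" "finite_measure N" for N
      proof -
        have meas: "(\<lambda>y. \<Sum>i\<in>I. v i * y i) \<in> borel_measurable N"
          using \<theta>meas[OF that(1), of "{}" v] by (simp add: \<theta>_def)
        have "integrable N (\<lambda>y. iexp (\<Sum>i\<in>I. v i * y i))"
          by (intro finite_measure.integrable_const_bound[where B=1] that AE_I2) (use measurable_compose[OF meas, of "\<lambda>s. iexp s" borel] in simp_all)
        then have int: "integrable N (\<lambda>y. iexp c * iexp (\<Sum>i\<in>I. v i * y i))" by simp
        have "cos (c + \<theta> {} v y) = Re (iexp c * iexp (\<Sum>i\<in>I. v i * y i))" for y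
          unfolding exp_add[symmetric] distrib_left[symmetric] of_real_add[symmetric] cis_conv_exp[symmetric]
          by (simp add: \<theta>_def cos_add)
        then have "(\<integral>y. cos (c + \<theta> {} v y) \<partial>N) = (\<integral>y. Re (iexp c * iexp (\<Sum>i\<in>I. v i * y i)) \<partial>N)"
          by (simp only:)
        also have "\<dots> = Re (iexp c * (CLINT y|N. iexp (\<Sum>i\<in>I. v i * y i)))"
          unfolding integral_Re[OF int] by (subst integral_mult_right_zero) (rule refl)
        finally show ?thesis .
      qed
      then show ?case using eq fin sets by (simp add: W_def)
    next
      case (insert j S)
      have S: "S \<subseteq> I" "j \<in> I" "j \<notin> S" and A: "\<And>i. i \<in> S \<Longrightarrow> A i \<in> sets borel" "A j \<in> sets borel"
        using insert by auto
      have ind: "(\<lambda>z. indicator (A j) z :: real) \<in> borel_measurable borel" using A by simp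
      have split: "\<theta> S w y = w j * y j + \<theta> (insert j S) w y" for w y
      proof -
        have "I - S - {j} = I - insert j S" by auto
        then show ?thesis unfolding \<theta>_def using I S sum.remove[of "I - S" j "\<lambda>i. w i * y i"] by simp
      qed
      have upd: "\<theta> (insert j S) (v(j := t)) y = \<theta> (insert j S) v y" for t y
        unfolding \<theta>_def by (intro sum.cong) auto
      have zero: "\<theta> S (\<lambda>i. if i = j then t else 0) y = t * y j" for t y
        unfolding \<theta>_def using I S by (simp add: sum.delta if_distrib[of "\<lambda>x. x * _"] cong: if_cong)
      let ?W = "W S A"
      have int1: "integrable N (\<lambda>y. ?W y * cos (\<phi> y))"
        if "sets N = sets (\<Pi>\<^sub>M i\<in>I. (borel :: real measure))" "finite_measure N" "\<phi> \<in> borel_measurable N" for N \<phi>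
        using that S A by (intro integrable_bounded_mult[where B=1] Wint) auto
      define h where "h y = ?W y * (1 + cos (c + \<theta> (insert j S) v y))" for y
      have h_nonneg: "0 \<le> h y" for y
        unfolding h_def using cos_ge_minus_one[of "c + \<theta> (insert j S) v y"] by (intro mult_nonneg_nonneg W01) linarith
      have \<theta>1: "(\<lambda>y. c + \<theta> T w y) \<in> borel_measurable N" if "sets N = sets (\<Pi>\<^sub>M i\<in>I. (borel :: real measure))" for N T w c
        by (intro borel_measurable_add borel_measurable_const \<theta>meas that)
      have h_eq: "h y = ?W y + ?W y * cos (c + \<theta> (insert j S) v y)" for y
        by (simp add: h_def algebra_simps)
      have hint: "integrable N h" if "sets N = sets (\<Pi>\<^sub>M i\<in>I. (borel :: real measure))" "finite_measure N" for N
      proof -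
        have "integrable N (\<lambda>y. ?W y + ?W y * cos (c + \<theta> (insert j S) v y))"
          by (intro Bochner_Integration.integrable_add Wint int1 \<theta>1 that S A)
        then show ?thesis by (simp only: h_eq[symmetric])
      qed
      \<comment> \<open>The product formula for cosines moves the frequency of coordinate
        \<open>j\<close> into \<open>\<theta> S\<close>, so each term on the right falls under the
        induction hypothesis for \<open>S\<close>.\<close>
      have hcos: "(\<integral>y. h y * cos (c' + t * y j) \<partial>N)
         = (\<integral>y. ?W y * cos (c' + \<theta> S (\<lambda>i. if i = j then t else 0) y) \<partial>N)
          + ((\<integral>y. ?W y * cos ((c + c') + \<theta> S (v(j := t)) y) \<partial>N) + (\<integral>y. ?W y * cos ((c - c') + \<theta> S (v(j := - t)) y) \<partial>N)) / 2"
        if N: "sets N = sets (\<Pi>\<^sub>M i\<in>I. (borel :: real measure))" "finite_measure N" for N c' t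
      proof -
        have "h y * cos (c' + t * y j) = ?W y * cos (c' + \<theta> S (\<lambda>i. if i = j then t else 0) y)
          + (?W y * cos ((c + c') + \<theta> S (v(j := t)) y) + ?W y * cos ((c - c') + \<theta> S (v(j := - t)) y)) / 2" for y
        proof -
          have "cos ((c + c') + \<theta> S (v(j := t)) y) + cos ((c - c') + \<theta> S (v(j := - t)) y)
            = 2 * (cos (c + \<theta> (insert j S) v y) * cos (c' + t * y j))"
          proof -
            have "(c + c') + \<theta> S (v(j := t)) y = (c + \<theta> (insert j S) v y) + (c' + t * y j)"
              "(c - c') + \<theta> S (v(j := - t)) y = (c + \<theta> (insert j S) v y) - (c' + t * y j)"
              by (simp_all add: split upd)
            then show ?thesis by (simp only: cos_add cos_diff)
          qed
          then have "?W y * cos ((c + c') + \<theta> S (v(j := t)) y) + ?W y * cos ((c - c') + \<theta> S (v(j := - t)) y)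
             = 2 * (?W y * cos (c + \<theta> (insert j S) v y) * cos (c' + t * y j))"
            using distrib_left[of "?W y" "cos ((c + c') + \<theta> S (v(j := t)) y)" "cos ((c - c') + \<theta> S (v(j := - t)) y)"]
            by (simp only: mult.assoc mult.left_commute)
          moreover have "h y * cos (c' + t * y j)
              = ?W y * cos (c' + t * y j) + ?W y * cos (c + \<theta> (insert j S) v y) * cos (c' + t * y j)"
            by (simp only: h_eq distrib_right)
          ultimately show ?thesis by (simp only: zero)
        qed
        then show ?thesis using N
          by (simp add: int1 \<theta>1)
      qed
      have IH: "(\<integral>y. ?W y * cos (c + \<theta> S v y) \<partial>\<mu>) = (\<integral>y. ?W y * cos (c + \<theta> S v y) \<partial>\<mu>')" for c v
        using insert.IH[of A] insert.prems by auto
      have "(\<integral>y. h y * indicator (A j) (y j) \<partial>\<mu>) = (\<integral>y. h y * indicator (A j) (y j) \<partial>\<mu>')"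
        by (rule weighted_cos_unique[OF hint[OF sets(1) fin(1)] h_nonneg coord hint[OF sets(2) fin(2)] h_nonneg coord _ ind])
           (use S sets fin in \<open>simp_all add: hcos IH\<close>)
      \<comment> \<open>Subtracting the integral with weight \<open>W S A\<close> alone undoes the 1
        that was added to make \<open>h\<close> nonnegative.\<close>
      moreover have "(\<integral>y. ?W y * indicator (A j) (y j) \<partial>\<mu>) = (\<integral>y. ?W y * indicator (A j) (y j) \<partial>\<mu>')"
        by (rule weighted_cos_unique[OF Wint W01(1) coord Wint W01(1) coord _ ind])
           (use S A sets fin in \<open>auto simp: IH simp flip: zero\<close>)
      moreover have "(\<integral>y. h y * indicator (A j) (y j) \<partial>N) = (\<integral>y. ?W y * indicator (A j) (y j) \<partial>N)
          + (\<integral>y. W (insert j S) A y * cos (c + \<theta> (insert j S) v y) \<partial>N)"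
        if N: "sets N = sets (\<Pi>\<^sub>M i\<in>I. (borel :: real measure))" "finite_measure N" for N
      proof -
        have W: "W (insert j S) A y = ?W y * indicator (A j) (y j)" for y
          using insert by (simp add: W_def)
        have "h y * indicator (A j) (y j) = ?W y * indicator (A j) (y j) + W (insert j S) A y * cos (c + \<theta> (insert j S) v y)" for y
          by (simp add: h_eq W algebra_simps)
        moreover have "integrable N (\<lambda>y. ?W y * indicator (A j) (y j))"
          unfolding W[symmetric] using insert.prems N by (intro Wint) auto
        moreover have "integrable N (\<lambda>y. W (insert j S) A y * cos (c + \<theta> (insert j S) v y))"
          using insert.prems N by (intro integrable_bounded_mult[where B=1] Wint measurable_compose[OF \<theta>1]) auto
        ultimately show ?thesis by simp
      qed
      ultimately show ?case using sets fin by simp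
    qed
  qed
  have W_ind: "W I A y = indicator (Pi\<^sub>E I A) y" if y: "y \<in> space (\<Pi>\<^sub>M i\<in>I. (borel :: real measure))" for A y
  proof (cases "y \<in> Pi\<^sub>E I A")
    case True
    then show ?thesis by (auto simp: W_def PiE_def Pi_iff)
  next
    case False
    then obtain i where "i \<in> I" "y i \<notin> A i" using y unfolding space_PiM PiE_iff by blast
    then show ?thesis using I False by (auto simp: W_def intro!: prod_zero bexI[of _ i])
  qed
  have rect: "emeasure \<mu> (Pi\<^sub>E I A) = emeasure \<mu>' (Pi\<^sub>E I A)" if "\<And>i. i \<in> I \<Longrightarrow> A i \<in> sets borel" for A
  proof -
    have [simp]: "Pi\<^sub>E I A \<in> sets (\<Pi>\<^sub>M i\<in>I. borel)" using that I by (intro sets_PiM_I_finite) auto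
    have "(\<integral>y. W I A y \<partial>N) = measure N (Pi\<^sub>E I A)"
      if N: "sets N = sets (\<Pi>\<^sub>M i\<in>I. (borel :: real measure))" for N
    proof -
      have "(\<integral>y. W I A y \<partial>N) = (\<integral>y. indicator (Pi\<^sub>E I A) y \<partial>N)"
        using sets_eq_imp_space_eq[OF N] by (intro Bochner_Integration.integral_cong refl) (auto simp: W_ind)
      also have "\<dots> = measure N (Pi\<^sub>E I A)"
        using sets.sets_into_space[of "Pi\<^sub>E I A" N] N by (simp add: Int_absorb1)
      finally show ?thesis .
    qed
    then show ?thesis
      using claim[of I A 0 "\<lambda>_. 0"] that sets by (simp add: \<theta>_def \<mu>.emeasure_eq_measure \<mu>'.emeasure_eq_measure)
  qed
  show ?thesis
  proof (rule measure_eqI_PiM_finite[OF I sets rect])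
    show "range (\<lambda>_::nat. \<Pi>\<^sub>E i\<in>I. UNIV :: real set) \<subseteq> prod_algebra I (\<lambda>_. borel)"
      using I by (auto intro!: prod_algebraI_finite)
    show "(\<Union>_::nat. \<Pi>\<^sub>E i\<in>I. UNIV :: real set) = space (\<Pi>\<^sub>M i\<in>I. borel)"
      by (simp add: space_PiM)
  qed auto
qed

section \<open>Integrals depending on a complex parameter\<close>

text \<open>The quotient f / g is continuous with values in the finite set of roots of unity of
  order n + 1, hence constant on a connected set. This identifies the transforms of convolution
  roots.\<close>

lemma continuous_root_unique:
  fixes f g :: "real \<Rightarrow> complex"
  assumes S: "connected S" and f: "continuous_on S f" and g: "continuous_on S g"
    and nz: "\<And>t. t \<in> S \<Longrightarrow> g t \<noteq> 0" and pow: "\<And>t. t \<in> S \<Longrightarrow> f t ^ Suc n = g t ^ Suc n"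
    and t0: "t0 \<in> S" "f t0 = g t0" and t: "t \<in> S"
  shows "f t = g t"
proof -
  have "(\<lambda>t. f t / g t) constant_on S"
  proof (rule continuous_finite_range_constant[OF S])
    show "continuous_on S (\<lambda>t. f t / g t)" using f g nz by (intro continuous_on_divide) auto
    have "(\<lambda>t. f t / g t) ` S \<subseteq> {z. z ^ Suc n = 1}"
      using pow nz by (auto simp: power_divide)
    then show "finite ((\<lambda>t. f t / g t) ` S)"
      by (rule finite_subset) (rule finite_roots_unity, simp)
  qed
  then obtain c where c: "f t / g t = c" if "t \<in> S" for t by (auto simp: constant_on_def)
  then show ?thesis using c[OF t0(1)] c[OF t] nz[OF t] nz[OF t0(1)] t0(2) by simp
qed

text \<open>The difference f - g takes values in the multiples of 2 pi i, which are at least 2 pi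
  apart, so continuity makes it constant.\<close>

lemma continuous_log_unique:
  fixes f g :: "real \<Rightarrow> complex"
  assumes f: "continuous_on UNIV f" and g: "continuous_on UNIV g"
    and exp: "\<And>t. exp (f t) = exp (g t)" and t0: "f t0 = g t0"
  shows "f t = g t"
proof -
  have "(\<lambda>t. f t - g t) constant_on UNIV"
  proof (rule continuous_discrete_range_constant)
    show "continuous_on UNIV (\<lambda>t. f t - g t)" using f g by (intro continuous_on_diff)
    fix x :: real
    have "2 * pi \<le> cmod ((f y - g y) - (f x - g x))" if "f y - g y \<noteq> f x - g x" for y
    proof -
      have "exp (f t - g t) = 1" for t using exp[of t] by (simp add: exp_diff)
      then have "Re (f t - g t) = 0" "\<exists>n::int. Im (f t - g t) = of_int (2 * n) * pi" for t
        using exp_eq_1[of "f t - g t"] by blast+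
      then have "\<exists>n::int. f t - g t = of_real (2 * of_int n * pi) * \<i>" for t
        by (simp add: complex_eq_iff)
      then obtain k where k: "\<And>t. f t - g t = of_real (2 * of_int (k t) * pi) * \<i>" by metis
      have "cmod ((f y - g y) - (f x - g x)) = \<bar>2 * pi * of_int (k y - k x)\<bar>"
      proof -
        have "(f y - g y) - (f x - g x) = of_real (2 * pi * of_int (k y - k x)) * \<i>"
          unfolding k by (simp add: algebra_simps)
        then show ?thesis by (simp only: norm_mult norm_of_real norm_ii mult_1_right)
      qed
      moreover have "\<bar>of_int (k y - k x) :: real\<bar> \<ge> 1"
        using that k by (cases "k y = k x") auto
      ultimately show ?thesis by (simp add: abs_mult)
    qed
    then show "\<exists>e>0. \<forall>y. y \<in> UNIV \<and> f y - g y \<noteq> f x - g x \<longrightarrow> e \<le> cmod ((f y - g y) - (f x - g x))"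
      by (intro exI[of _ "2 * pi"]) auto
  qed auto
  then show ?thesis using t0 by (auto simp: constant_on_def) (metis eq_iff_diff_eq_0)
qed

section \<open>Continuity and holomorphy under the integral\<close>

lemma continuous_on_parametric_integral:
  fixes F :: "'c::metric_space \<Rightarrow> 'a \<Rightarrow> 'b::{banach, second_countable_topology}"
  assumes cont: "\<And>x. x \<in> space M \<Longrightarrow> continuous_on S (\<lambda>z. F z x)"
    and meas: "\<And>z. z \<in> S \<Longrightarrow> F z \<in> borel_measurable M"
    and bound: "\<And>z x. z \<in> S \<Longrightarrow> x \<in> space M \<Longrightarrow> norm (F z x) \<le> B x" and B: "integrable M B"
  shows "continuous_on S (\<lambda>z. \<integral>x. F z x \<partial>M)"
  unfolding continuous_on_sequentially
proof (intro allI ballI impI, elim conjE)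
  fix X z assume z: "z \<in> S" and X: "\<forall>n. X n \<in> S" "X \<longlonglongrightarrow> z"
  show "((\<lambda>z. \<integral>x. F z x \<partial>M) \<circ> X) \<longlonglongrightarrow> (\<integral>x. F z x \<partial>M)"
    unfolding comp_def
  proof (rule integral_dominated_convergence[where w=B])
    show "AE x in M. (\<lambda>n. F (X n) x) \<longlonglongrightarrow> F z x"
    proof (rule AE_I2)
      fix x assume "x \<in> space M"
      then show "(\<lambda>n. F (X n) x) \<longlonglongrightarrow> F z x"
        using cont[of x] z X unfolding continuous_on_sequentially comp_def by blast
    qed
  qed (use X z bound meas B in auto)
qed

text \<open>Cauchy's estimate turns the bound \<open>B\<close> on the integrand into the bound
  \<open>B x / r\<close> on its derivative, which dominates the difference quotients.\<close>

lemma holomorphic_on_parametric_integral: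
  fixes F :: "complex \<Rightarrow> 'a \<Rightarrow> complex"
  assumes S: "open S" and hol: "\<And>x. x \<in> space M \<Longrightarrow> (\<lambda>z. F z x) holomorphic_on S"
    and meas: "\<And>z. z \<in> S \<Longrightarrow> F z \<in> borel_measurable M"
    and bound: "\<And>z x. z \<in> S \<Longrightarrow> x \<in> space M \<Longrightarrow> norm (F z x) \<le> B x" and B: "integrable M B"
  shows "(\<lambda>z. \<integral>x. F z x \<partial>M) holomorphic_on S"
proof (rule holomorphic_onI)
  fix z0 assume z0: "z0 \<in> S"
  then obtain e where e: "e > 0" "cball z0 e \<subseteq> S" using S open_contains_cball by blast
  \<comment> \<open>Half of \<open>e\<close>, so that closed discs of radius \<open>r\<close> around
    points of \<open>ball z0 r\<close> stay inside \<open>S\<close>.\<close>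
  define r where "r = e / 2"
  have r: "r > 0" using e by (simp add: r_def)
  have sub: "cball w r \<subseteq> S" if "w \<in> ball z0 r" for w
  proof
    fix u assume "u \<in> cball w r"
    then have "dist z0 u \<le> e" using that dist_triangle[of z0 u w] by (simp add: r_def)
    then show "u \<in> S" using e by auto
  qed
  have ballS: "w \<in> S" if "w \<in> ball z0 r" for w using sub[OF that] r by (auto simp: subset_iff)
  have int: "integrable M (F z)" if "z \<in> S" for z
    using bound[OF that] order_trans[OF bound[OF that] abs_ge_self]
    by (intro Bochner_Integration.integrable_bound[OF B meas[OF that]]) auto
  have deriv_bound: "norm (deriv (\<lambda>z. F z x) w) \<le> B x / r" if "x \<in> space M" "w \<in> ball z0 r" for x w
  proof -
    have "norm ((deriv ^^ 1) (\<lambda>z. F z x) w) \<le> fact 1 * B x / r ^ 1"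
    proof (rule Cauchy_inequality)
      show "(\<lambda>z. F z x) holomorphic_on ball w r"
        by (rule holomorphic_on_subset[OF hol[OF that(1)]]) (use sub[OF that(2)] in auto)
      show "continuous_on (cball w r) (\<lambda>z. F z x)"
        by (rule holomorphic_on_imp_continuous_on[OF holomorphic_on_subset[OF hol[OF that(1)] sub[OF that(2)]]])
      show "norm (F u x) \<le> B x" if "norm (w - u) = r" for u
        using bound[of u x] \<open>x \<in> space M\<close> sub[OF \<open>w \<in> ball z0 r\<close>] that by (auto simp: dist_norm subset_iff)
    qed (use r in auto)
    then show ?thesis by simp
  qed
  have has_deriv: "((\<lambda>z. F z x) has_field_derivative deriv (\<lambda>z. F z x) w) (at w)"
    if "x \<in> space M" "w \<in> S" for x w
    using hol[OF that(1)] S that(2) by (rule holomorphic_derivI)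
  have lipschitz: "norm (F w x - F z0 x) \<le> B x / r * norm (w - z0)" if "x \<in> space M" "w \<in> ball z0 r" for x w
    by (rule field_differentiable_bound[of "ball z0 r" _ "\<lambda>w. deriv (\<lambda>z. F z x) w"])
       (use that r deriv_bound ballS has_deriv in \<open>auto intro: has_field_derivative_at_within\<close>)
  have "((\<lambda>w. ((\<integral>x. F w x \<partial>M) - (\<integral>x. F z0 x \<partial>M)) / (w - z0)) \<longlongrightarrow> (\<integral>x. deriv (\<lambda>z. F z x) z0 \<partial>M)) (at z0)"
    unfolding tendsto_at_iff_sequentially
  proof (intro allI impI)
    fix X assume X: "\<forall>i. X i \<in> UNIV - {z0}" "X \<longlonglongrightarrow> z0"
    then have "\<forall>\<^sub>F n in sequentially. X n \<in> ball z0 r"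
      using r by (intro topological_tendstoD[OF X(2)]) auto
    then obtain N where N: "\<And>n. n \<ge> N \<Longrightarrow> X n \<in> ball z0 r" by (auto simp: eventually_sequentially)
    \<comment> \<open>The shift by \<open>N\<close> puts all terms into the ball, where the
      dominating function is valid.\<close>
    define Y where "Y n = X (n + N)" for n
    have Y: "Y n \<noteq> z0" "Y n \<in> ball z0 r" "Y n \<in> S" for n
      using X(1) N[of "n + N"] ballS[of "X (n + N)"] by (auto simp: Y_def)
    have Ylim: "Y \<longlonglongrightarrow> z0" unfolding Y_def using X(2) by (rule LIMSEQ_ignore_initial_segment)
    have quot_lim: "(\<lambda>n. (F (Y n) x - F z0 x) / (Y n - z0)) \<longlonglongrightarrow> deriv (\<lambda>z. F z x) z0" if "x \<in> space M" for x
      using has_deriv[OF that z0] Y(1) Ylim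
      unfolding has_field_derivative_iff tendsto_at_iff_sequentially comp_def by auto
    have quot_meas: "(\<lambda>x. (F (Y n) x - F z0 x) / (Y n - z0)) \<in> borel_measurable M" for n
      using meas[OF Y(3)[of n]] meas[OF z0] by simp
    have "(\<lambda>n. \<integral>x. (F (Y n) x - F z0 x) / (Y n - z0) \<partial>M) \<longlonglongrightarrow> (\<integral>x. deriv (\<lambda>z. F z x) z0 \<partial>M)"
    proof (rule integral_dominated_convergence[where w="\<lambda>x. B x / r"])
      show "(\<lambda>x. deriv (\<lambda>z. F z x) z0) \<in> borel_measurable M"
        by (rule borel_measurable_LIMSEQ_metric[OF quot_meas quot_lim])
      show "AE x in M. (\<lambda>n. (F (Y n) x - F z0 x) / (Y n - z0)) \<longlonglongrightarrow> deriv (\<lambda>z. F z x) z0"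
        using quot_lim by auto
      show "AE x in M. norm ((F (Y n) x - F z0 x) / (Y n - z0)) \<le> B x / r" for n
        using lipschitz[OF _ Y(2)[of n]] Y(1)[of n] by (auto simp: norm_divide divide_le_eq)
    qed (use quot_meas B in auto)
    moreover have "(\<integral>x. (F (Y n) x - F z0 x) / (Y n - z0) \<partial>M) = ((\<integral>x. F (Y n) x \<partial>M) - (\<integral>x. F z0 x \<partial>M)) / (Y n - z0)" for n
      using int[OF Y(3)] int[OF z0] by simp
    ultimately have "(\<lambda>n. ((\<integral>x. F (Y n) x \<partial>M) - (\<integral>x. F z0 x \<partial>M)) / (Y n - z0)) \<longlonglongrightarrow> (\<integral>x. deriv (\<lambda>z. F z x) z0 \<partial>M)"
      by (simp only:)
    then show "((\<lambda>w. ((\<integral>x. F w x \<partial>M) - (\<integral>x. F z0 x \<partial>M)) / (w - z0)) \<circ> X) \<longlonglongrightarrow> (\<integral>x. deriv (\<lambda>z. F z x) z0 \<partial>M)"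
      unfolding Y_def comp_def by (rule LIMSEQ_offset)
  qed
  then show "(\<lambda>z. \<integral>x. F z x \<partial>M) field_differentiable at z0 within S"
    by (auto simp: field_differentiable_def has_field_derivative_iff intro!: exI has_field_derivative_at_within
        intro: tendsto_within_subset[OF _ subset_UNIV])
qed

section \<open>Continuation up to the boundary\<close>

text \<open>Closed at Re z = 0, where the formula is given, and at Re z = 1, where it is wanted. The
  height is bounded so that one integrable function dominates the integrands on the whole set; its
  value 1 is arbitrary.\<close>

definition half_box :: "complex set" where
  "half_box = {z. 0 \<le> Re z \<and> Re z \<le> 1 \<and> \<bar>Im z\<bar> < 1}"

text \<open>Extending by zero to the left of the imaginary axis gives a holomorphic function.\<close>
lemma half_box_eq_at_1:
  fixes f g :: "complex \<Rightarrow> complex"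
  assumes cont: "continuous_on half_box f" "continuous_on half_box g"
    and hol: "f holomorphic_on interior half_box" "g holomorphic_on interior half_box"
    and eq: "\<And>y. \<bar>y\<bar> < 1 \<Longrightarrow> f (\<i> * of_real y) = g (\<i> * of_real y)"
  shows "f 1 = g 1"
proof -
  \<comment> \<open>The box is prolonged to the left without bound, so that the imaginary segment
    becomes interior and \<open>h\<close> vanishes on a nonempty open part.\<close>
  define S where "S = {z. Re z < 1 \<and> \<bar>Im z\<bar> < 1}"
  have S: "open S" "convex S"
  proof -
    have eqS: "S = {z. Re z < 1} \<inter> ({z. Im z < 1} \<inter> {z. Im z > -1})" by (auto simp: S_def)
    show "open S" unfolding eqS by (intro open_Int open_halfspace_Re_lt open_halfspace_Im_lt open_halfspace_Im_gt)
    show "convex S" unfolding eqS by (intro convex_Int convex_halfspace_Re_lt convex_halfspace_Im_lt convex_halfspace_Im_gt)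
  qed
  define h where "h z = (if Re z \<le> 0 then 0 else f z - g z)" for z
  have hol_h: "h holomorphic_on S"
  proof (rule holomorphic_on_paste_across_line[of S 1 h 0])
    show "open S" "(1::complex) \<noteq> 0" using S by auto
    show "h holomorphic_on S \<inter> {z. 1 \<bullet> z < 0}"
      by (rule holomorphic_transform[OF holomorphic_on_const[of 0]]) (auto simp: h_def inner_complex_def)
    have "S \<inter> {z. 0 < Re z} \<subseteq> interior half_box"
      by (rule interior_maximal) (use S in \<open>auto simp: S_def half_box_def intro!: open_Int open_halfspace_Re_gt\<close>)
    then show "h holomorphic_on S \<inter> {z. 0 < 1 \<bullet> z}"
      by (intro holomorphic_transform[OF holomorphic_on_subset[OF holomorphic_on_diff[OF hol]]])
         (auto simp: h_def inner_complex_def)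
    have "continuous_on S (\<lambda>z. if Re z \<le> 0 then 0 else f z - g z)"
    proof (rule continuous_on_cases_le)
      show "continuous_on {z \<in> S. 0 \<le> Re z} (\<lambda>z. f z - g z)"
        by (rule continuous_on_subset[OF continuous_on_diff[OF cont]]) (auto simp: S_def half_box_def)
      fix z assume "z \<in> S" "Re z = 0"
      then have "z = \<i> * of_real (Im z)" "\<bar>Im z\<bar> < 1" by (auto simp: S_def complex_eq_iff)
      then show "0 = f z - g z" using eq[of "Im z"] by simp
    qed (auto intro!: continuous_intros)
    then show "continuous_on S h" unfolding h_def[abs_def] .
  qed
  have zero: "h z = 0" if "z \<in> S" for z
  proof (rule analytic_continuation_open[where s="S \<inter> {z. Re z < 0}" and s'=S and f=h and g="\<lambda>_. 0"])
    have "- 1 \<in> S \<inter> {z. Re z < 0}" by (simp add: S_def)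
    then show "S \<inter> {z. Re z < 0} \<noteq> {}" by blast
  qed (use S that hol_h in \<open>auto simp: h_def intro!: open_Int open_halfspace_Re_lt convex_connected\<close>)
  \<comment> \<open>The point 1 is not in \<open>S\<close> and is reached as a limit. The double
    successor keeps the first term 1/2 off the imaginary axis, where \<open>h\<close> is 0 by
    definition.\<close>
  define x where "x n = complex_of_real (1 - 1 / real (Suc (Suc n)))" for n
  have x_in: "x n \<in> half_box" "x n \<in> S" "Re (x n) > 0" for n
    by (auto simp: x_def S_def half_box_def field_simps)
  have "(\<lambda>n. 1 - 1 / real (Suc (Suc n))) \<longlonglongrightarrow> 1 - 0"
    by (intro tendsto_diff tendsto_const LIMSEQ_Suc[OF LIMSEQ_Suc[OF lim_1_over_n]])
  then have "x \<longlonglongrightarrow> 1" unfolding x_def using tendsto_of_real[where 'a=complex] by fastforce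
  moreover have "(1::complex) \<in> half_box" by (simp add: half_box_def)
  ultimately have lim: "(\<lambda>n. f (x n)) \<longlonglongrightarrow> f 1" "(\<lambda>n. g (x n)) \<longlonglongrightarrow> g 1"
    using cont x_in(1) unfolding continuous_on_sequentially comp_def by blast+
  have "f (x n) = g (x n)" for n using zero[OF x_in(2)[of n]] x_in(3)[of n] by (simp add: h_def)
  then show ?thesis using lim LIMSEQ_unique by simp
qed

section \<open>Exponential moments of the Levy measure\<close>

text \<open>Sign and factor are chosen so that exp (i t X) gets multiplied by the nonnegative weight
  1 - cos (s X). Affine functions of t are annihilated.\<close>

definition second_diff :: "real \<Rightarrow> (real \<Rightarrow> complex) \<Rightarrow> real \<Rightarrow> complex" where
  "second_diff s f t = f t - (f (t + s) + f (t - s)) / 2"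

lemma second_diff_mult: "second_diff s (\<lambda>t. c * f t) = (\<lambda>t. c * second_diff s f t)"
  by (simp add: second_diff_def fun_eq_iff field_simps)

lemma second_diff_minus_const: "second_diff s (\<lambda>t. f t - c) = second_diff s f"
  by (simp add: second_diff_def fun_eq_iff field_simps)

lemma integrable_scaleR_iexp:
  assumes h: "integrable M h" and [measurable]: "X \<in> borel_measurable M"
  shows "integrable M (\<lambda>x. h x *\<^sub>R iexp (X x))"
proof (rule Bochner_Integration.integrable_bound[OF h])
  have [measurable]: "h \<in> borel_measurable M" using h by simp
  show "(\<lambda>x. h x *\<^sub>R iexp (X x)) \<in> borel_measurable M" by simp
qed simp

lemma second_diff_iexp_integral:
  assumes h: "integrable M h" and X [measurable]: "X \<in> borel_measurable M"
  shows "second_diff s (\<lambda>t. CLINT x|M. h x *\<^sub>R iexp (t * X x)) t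
      = (CLINT x|M. (h x * (1 - cos (s * X x))) *\<^sub>R iexp (t * X x))"
proof -
  have meas: "(\<lambda>x. r * X x) \<in> borel_measurable M" for r by simp
  have int: "integrable M (\<lambda>x. h x *\<^sub>R iexp (r * X x))" for r
    by (rule integrable_scaleR_iexp[OF h meas])
  have "(h x * (1 - cos (s * X x))) *\<^sub>R iexp (t * X x) = h x *\<^sub>R iexp (t * X x)
      - (h x *\<^sub>R iexp ((t + s) * X x) + h x *\<^sub>R iexp ((t - s) * X x)) / 2" for x
  proof -
    show ?thesis
      unfolding cis_conv_exp[symmetric]
      by (simp add: complex_eq_iff cos_add cos_diff sin_add sin_diff distrib_right left_diff_distrib)
         (simp add: algebra_simps)
  qed
  then have "(CLINT x|M. (h x * (1 - cos (s * X x))) *\<^sub>R iexp (t * X x)) = (CLINT x|M. h x *\<^sub>R iexp (t * X x)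
      - (h x *\<^sub>R iexp ((t + s) * X x) + h x *\<^sub>R iexp ((t - s) * X x)) / 2)"
    by (simp only:)
  also have "\<dots> = second_diff s (\<lambda>t. CLINT x|M. h x *\<^sub>R iexp (t * X x)) t"
    unfolding second_diff_def using int[of t] int[of "t + s"] int[of "t - s"]
    by (simp only: Bochner_Integration.integral_diff Bochner_Integration.integral_add Bochner_Integration.integrable_add
          integral_divide_zero integrable_divide_zero)
  finally show ?thesis by simp
qed

lemma integrable_one_minus_cos:
  fixes h X :: "'a \<Rightarrow> real"
  assumes "integrable M h" and [measurable]: "X \<in> borel_measurable M"
  shows "integrable M (\<lambda>x. h x * (1 - cos (X x)))"
proof (rule integrable_bounded_mult[OF assms(1), where B=2])
  show "\<bar>1 - cos (X x)\<bar> \<le> 2" for x using cos_ge_minus_one[of "X x"] cos_le_one[of "X x"] by linarith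
qed simp

lemma second_diff2_iexp_integral:
  assumes h: "integrable M h" and X [measurable]: "X \<in> borel_measurable M"
  shows "second_diff s (second_diff s (\<lambda>t. CLINT x|M. h x *\<^sub>R iexp (t * X x))) t
      = (CLINT x|M. (h x * (1 - cos (s * X x))\<^sup>2) *\<^sub>R iexp (t * X x))"
proof -
  have "(\<lambda>x. s * X x) \<in> borel_measurable M" by simp
  then have "integrable M (\<lambda>x. h x * (1 - cos (s * X x)))" by (rule integrable_one_minus_cos[OF h])
  moreover have "second_diff s (\<lambda>t. CLINT x|M. h x *\<^sub>R iexp (t * X x))
      = (\<lambda>t. CLINT x|M. (h x * (1 - cos (s * X x))) *\<^sub>R iexp (t * X x))"
    by (rule ext) (rule second_diff_iexp_integral[OF h X])
  ultimately show ?thesis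
    using second_diff_iexp_integral[OF _ X, of "\<lambda>x. h x * (1 - cos (s * X x))" s t]
    by (simp only: power2_eq_square mult.assoc)
qed

section \<open>Scaled roots and frequency averages\<close>

lemma norm_exp_minus_one_le: "cmod (exp z - 1) \<le> exp (cmod z) * cmod z"
  using Taylor_exp_field[of z 0] by simp

lemma norm_exp_minus_one_minus_le: "cmod (exp z - 1 - z) \<le> exp (cmod z) * (cmod z)\<^sup>2"
  using Taylor_exp_field[of z 1] by (simp add: power2_eq_square diff_diff_eq)

text \<open>The error is at most (n + 1) exp |w| |w / (n + 1)|^2. With \<open>w = \<psi> t\<close>
  this says that the transforms of the roots, less 1 and multiplied by n + 1, converge to the
  exponent.\<close>

lemma root_limit:
  fixes w :: complex
  shows "(\<lambda>n. of_nat (Suc n) * (exp (w / of_nat (Suc n)) - 1)) \<longlonglongrightarrow> w"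
proof -
  have "(\<lambda>n. of_nat (Suc n) * (exp (w / of_nat (Suc n)) - 1) - w) \<longlonglongrightarrow> 0"
  proof (rule Lim_null_comparison)
    show "\<forall>\<^sub>F n in sequentially. cmod (of_nat (Suc n) * (exp (w / of_nat (Suc n)) - 1) - w)
       \<le> exp (cmod w) * (cmod w)\<^sup>2 * (1 / real (Suc n))"
    proof (rule always_eventually, rule allI)
      fix n
      define z where "z = w / of_nat (Suc n)"
      have w: "w = of_nat (Suc n) * z" by (simp add: z_def del: of_nat_Suc)
      have z: "cmod z = cmod w / real (Suc n)" unfolding z_def norm_divide norm_of_nat ..
      have "cmod z \<le> cmod w" unfolding z using divide_left_mono[of 1 "real (Suc n)" "cmod w"] by simp
      have "cmod (of_nat (Suc n) * (exp z - 1) - w) = real (Suc n) * cmod (exp z - 1 - z)"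
        unfolding w by (metis norm_mult norm_of_nat right_diff_distrib)
      also have "\<dots> \<le> real (Suc n) * (exp (cmod w) * (cmod z)\<^sup>2)"
        using norm_exp_minus_one_minus_le[of z] \<open>cmod z \<le> cmod w\<close>
        by (intro mult_left_mono) (auto intro!: order_trans[OF norm_exp_minus_one_minus_le] mult_right_mono)
      also have "\<dots> = exp (cmod w) * (cmod w)\<^sup>2 * (1 / real (Suc n))"
        unfolding z by (simp add: power2_eq_square del: of_nat_Suc)
      finally show "cmod (of_nat (Suc n) * (exp (w / of_nat (Suc n)) - 1) - w)
          \<le> exp (cmod w) * (cmod w)\<^sup>2 * (1 / real (Suc n))" unfolding z_def .
    qed
    show "(\<lambda>n. exp (cmod w) * (cmod w)\<^sup>2 * (1 / real (Suc n))) \<longlonglongrightarrow> 0"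
      by (intro tendsto_mult_right_zero LIMSEQ_Suc[OF lim_1_over_n])
  qed
  then show ?thesis by (rule LIM_zero_cancel)
qed

text \<open>For y > 2 / s0 the oscillating terms of the antiderivative are small compared with the
  linear term 3/2 s0, which yields a lower bound uniform in y.\<close>

lemma nn_integral_average_cos:
  fixes y s0 :: real
  assumes s0: "0 < s0" and y: "2 / s0 < y"
  shows "ennreal (s0 / 4) \<le> (\<integral>\<^sup>+s. ennreal ((1 - cos (s * y))\<^sup>2) * indicator {0..s0} s \<partial>lborel)"
proof -
  have "0 < 2 / s0" using s0 by simp
  then have y0: "0 < y" using y by linarith
  \<comment> \<open>The antiderivative of (1 - cos a)^2 = 3/2 - 2 cos a + cos (2 a) / 2 at a = s
    y.\<close>
  define F where "F s = 3 / 2 * s - 2 * sin (s * y) / y + sin (2 * (s * y)) / (4 * y)" for s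
  have "(\<integral>\<^sup>+s. ennreal ((1 - cos (s * y))\<^sup>2) * indicator {0..s0} s \<partial>lborel) = ennreal (F s0 - F 0)"
  proof (rule nn_integral_FTC_Icc)
    show "DERIV F s :> (1 - cos (s * y))\<^sup>2" for s
    proof -
      have "DERIV F s :> 3 / 2 - 2 * cos (s * y) + cos (2 * (s * y)) / 2"
        unfolding F_def using y0 by (auto intro!: derivative_eq_intros)
      moreover have "3 / 2 - 2 * cos (s * y) + cos (2 * (s * y)) / 2 = (1 - cos (s * y))\<^sup>2"
        unfolding cos_double_cos by (simp add: power2_eq_square field_simps)
      ultimately show ?thesis by simp
    qed
  qed (use s0 in auto)
  \<comment> \<open>With 1 / y \<le> s0 / 2 the value is at least (3/2 - 1 - 1/8) s0 = 3/8 s0, which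
    exceeds s0 / 4.\<close>
  moreover have "s0 / 4 \<le> F s0 - F 0"
  proof -
    have "1 / y \<le> s0 / 2" using y y0 s0 by (simp add: field_simps)
    moreover have "sin (s0 * y) / y \<le> 1 / y" "- (1 / y) \<le> sin (2 * (s0 * y)) / y"
      using y0 by (simp_all add: field_simps)
    moreover have "F s0 - F 0 = 3 / 2 * s0 - 2 * (sin (s0 * y) / y) + (sin (2 * (s0 * y)) / y) / 4"
      by (simp add: F_def)
    moreover have "s0 / 4 \<le> 3 / 2 * s0 - 2 * a + b / 4" if "c \<le> s0 / 2" "a \<le> c" "- c \<le> b" for a b c :: real
      using that s0 by linarith
    ultimately show ?thesis by (simp only:)
  qed
  ultimately show ?thesis by (simp add: ennreal_leI)
qed

text \<open>Integrating \<open>bound\<close> over s in [0, s0] and exchanging the integrals replaces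
  the cosine weight by its average, which is at least s0 / 4 on the set in question.\<close>

lemma exp_moment_if_cos_moments_bounded:
  fixes Y :: "'a \<Rightarrow> real"
  assumes [measurable]: "Y \<in> borel_measurable \<nu>" and s0: "0 < s0"
    and fin: "emeasure \<nu> {x \<in> space \<nu>. 2 / s0 < Y x} < \<infinity>"
    and bound: "\<And>s. 0 \<le> s \<Longrightarrow> s \<le> s0 \<Longrightarrow> (\<integral>\<^sup>+x. ennreal (exp (Y x) * (1 - cos (s * Y x))\<^sup>2) \<partial>\<nu>) \<le> ennreal C"
  shows "(\<integral>\<^sup>+x. ennreal (exp (Y x)) * indicator {x \<in> space \<nu>. 2 / s0 < Y x} x \<partial>\<nu>) < \<infinity>"
proof -
  define A where "A = {x \<in> space \<nu>. 2 / s0 < Y x}"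
  have [measurable]: "A \<in> sets \<nu>" by (simp add: A_def)
  \<comment> \<open>Restriction to \<open>A\<close> makes the measure finite and so supplies the
    sigma-finiteness for exchanging the integrals.\<close>
  define N where "N = density \<nu> (indicator A)"
  have [measurable]: "Y \<in> borel_measurable N" by (simp add: N_def)
  have "emeasure N (space N) = (\<integral>\<^sup>+x. indicator A x \<partial>\<nu>)"
    by (auto simp: N_def emeasure_density indicator_def intro!: nn_integral_cong)
  then have "emeasure N (space N) < \<infinity>"
    using fin by (simp add: A_def[symmetric])
  then interpret N: finite_measure N by (intro finite_measureI) auto
  interpret pair_sigma_finite lborel N ..
  have "ennreal (s0 / 4) * (\<integral>\<^sup>+x. ennreal (exp (Y x)) * indicator A x \<partial>\<nu>)
      = (\<integral>\<^sup>+x. indicator A x * (ennreal (exp (Y x)) * ennreal (s0 / 4)) \<partial>\<nu>)"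
    by (subst nn_integral_cmult[symmetric]) (auto intro!: nn_integral_cong simp: mult_ac)
  also have "\<dots> \<le> (\<integral>\<^sup>+x. indicator A x * (ennreal (exp (Y x)) * (\<integral>\<^sup>+s. ennreal ((1 - cos (s * Y x))\<^sup>2) * indicator {0..s0} s \<partial>lborel)) \<partial>\<nu>)"
  proof (rule nn_integral_mono)
    fix x assume "x \<in> space \<nu>"
    show "indicator A x * (ennreal (exp (Y x)) * ennreal (s0 / 4))
      \<le> indicator A x * (ennreal (exp (Y x)) * (\<integral>\<^sup>+s. ennreal ((1 - cos (s * Y x))\<^sup>2) * indicator {0..s0} s \<partial>lborel))"
      using nn_integral_average_cos[OF s0, of "Y x"]
      by (cases "x \<in> A") (auto simp: A_def intro!: mult_left_mono)
  qed
  also have "\<dots> = (\<integral>\<^sup>+x. (\<integral>\<^sup>+s. ennreal (exp (Y x)) * (ennreal ((1 - cos (s * Y x))\<^sup>2) * indicator {0..s0} s) \<partial>lborel) \<partial>N)"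
    unfolding N_def by (subst nn_integral_density) (auto simp: nn_integral_cmult)
  also have "\<dots> = (\<integral>\<^sup>+s. (\<integral>\<^sup>+x. ennreal (exp (Y x)) * (ennreal ((1 - cos (s * Y x))\<^sup>2) * indicator {0..s0} s) \<partial>N) \<partial>lborel)"
    by (rule Fubini') measurable
  also have "\<dots> \<le> (\<integral>\<^sup>+s. ennreal C * indicator {0..s0} s \<partial>lborel)"
  proof (rule nn_integral_mono)
    fix s
    have "(\<integral>\<^sup>+x. ennreal (exp (Y x)) * ennreal ((1 - cos (s * Y x))\<^sup>2) \<partial>N)
        = (\<integral>\<^sup>+x. indicator A x * (ennreal (exp (Y x)) * ennreal ((1 - cos (s * Y x))\<^sup>2)) \<partial>\<nu>)"
      unfolding N_def by (subst nn_integral_density) auto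
    also have "\<dots> \<le> (\<integral>\<^sup>+x. ennreal (exp (Y x) * (1 - cos (s * Y x))\<^sup>2) \<partial>\<nu>)"
      by (intro nn_integral_mono) (auto simp: ennreal_mult indicator_def)
    also have "\<dots> \<le> ennreal C" if "0 \<le> s" "s \<le> s0" using bound that .
    finally show "(\<integral>\<^sup>+x. ennreal (exp (Y x)) * (ennreal ((1 - cos (s * Y x))\<^sup>2) * indicator {0..s0} s) \<partial>N)
        \<le> ennreal C * indicator {0..s0} s"
      by (auto simp: indicator_def)
  qed
  also have "\<dots> < \<infinity>"
    using s0 by (simp add: nn_integral_cmult_indicator ennreal_mult_less_top)
  finally have "ennreal (s0 / 4) * (\<integral>\<^sup>+x. ennreal (exp (Y x)) * indicator A x \<partial>\<nu>) < \<infinity>" .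
  then have "(\<integral>\<^sup>+x. ennreal (exp (Y x)) * indicator A x \<partial>\<nu>) < \<infinity>"
    using s0 by (auto simp: ennreal_mult_less_top)
  then show ?thesis unfolding A_def .
qed

section \<open>Bounds for tilted convolution roots\<close>

lemma continuous_on_iexp_integral:
  assumes h: "integrable M h" and X [measurable]: "X \<in> borel_measurable M"
  shows "continuous_on S (\<lambda>t. CLINT x|M. h x *\<^sub>R iexp (t * X x))"
proof (rule continuous_on_parametric_integral[where B="\<lambda>x. \<bar>h x\<bar>"])
  have [measurable]: "h \<in> borel_measurable M" using h by simp
  show "(\<lambda>x. h x *\<^sub>R iexp (t * X x)) \<in> borel_measurable M" for t by simp
  show "continuous_on S (\<lambda>t. h x *\<^sub>R iexp (t * X x))" for x
    by (intro continuous_intros)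
qed (use h in auto)

text \<open>Near \<open>0\<close> the transform of the exponentially tilted law has a continuous logarithm, whose multiples
  by \<open>1 / (n + 1)\<close> are logarithms of the transforms of the tilted roots.\<close>
lemma tilted_roots_bounded:
  fixes \<sigma> :: "nat \<Rightarrow> 'a measure" and X :: "'a \<Rightarrow> real" and Z :: "'b \<Rightarrow> real"
  assumes \<sigma>: "\<And>n. prob_space (\<sigma> n)" and X: "\<And>n. X \<in> borel_measurable (\<sigma> n)" and intX: "\<And>n. integrable (\<sigma> n) (\<lambda>x. exp (X x))"
    and M: "prob_space M" and Z: "Z \<in> borel_measurable M" and intZ: "integrable M (\<lambda>x. exp (Z x))"
    and root: "\<And>n t. (CLINT x|M. exp (Z x) *\<^sub>R iexp (t * Z x)) = (CLINT x|\<sigma> n. exp (X x) *\<^sub>R iexp (t * X x)) ^ Suc n"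
  obtains s0 C where "0 < s0" and
    "\<And>n s. 0 \<le> s \<Longrightarrow> s \<le> s0 \<Longrightarrow> real (Suc n) * (\<integral>x. exp (X x) * (1 - cos (s * X x)) \<partial>\<sigma> n) \<le> C"
proof -
  define \<phi> where "\<phi> t = (CLINT x|M. exp (Z x) *\<^sub>R iexp (t * Z x))" for t
  define \<phi>n where "\<phi>n n t = (CLINT x|\<sigma> n. exp (X x) *\<^sub>R iexp (t * X x))" for n t
  define m where "m = (\<integral>x. exp (Z x) \<partial>M)"
  define mn where "mn n = (\<integral>x. exp (X x) \<partial>\<sigma> n)" for n
  have exp_pos: "0 < (\<integral>x. exp (Y x) \<partial>N)" if "prob_space N" "integrable N (\<lambda>x. exp (Y x))" for N :: "'c measure" and Y :: "'c \<Rightarrow> real"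
  proof -
    interpret prob_space N by fact
    have "(\<integral>x. exp (Y x) \<partial>N) \<noteq> 0"
      using integral_nonneg_eq_0_iff_AE[OF that(2)] by auto
    moreover have "0 \<le> (\<integral>x. exp (Y x) \<partial>N)" by simp
    ultimately show ?thesis by linarith
  qed
  have m: "0 < m" unfolding m_def by (rule exp_pos[OF M intZ])
  have mn: "0 < mn n" for n unfolding mn_def by (rule exp_pos[OF \<sigma> intX])
  have \<phi>0: "\<phi> 0 = of_real m" "\<phi>n n 0 = of_real (mn n)" for n
    by (simp_all add: \<phi>_def \<phi>n_def m_def mn_def scaleR_conv_of_real)
  have cont: "continuous_on S \<phi>" "continuous_on S (\<phi>n n)" for n S
    unfolding \<phi>_def[abs_def] \<phi>n_def[abs_def] by (intro continuous_on_iexp_integral intZ Z intX X)+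
  \<comment> \<open>Values at distance less than \<open>m\<close> from \<open>\<phi> 0 = m\<close>
    have positive real part, so the principal logarithm is continuous on the interval chosen
    below.\<close>
  have "continuous (at 0) \<phi>" using cont(1)[of UNIV] by (simp add: continuous_on_eq_continuous_at)
  then obtain \<delta> where \<delta>: "\<delta> > 0" "\<And>t. dist t 0 < \<delta> \<Longrightarrow> dist (\<phi> t) (\<phi> 0) < m"
    using m unfolding continuous_at_eps_delta by blast
  define s0 where "s0 = \<delta> / 2"
  have s0: "0 < s0" using \<delta> by (simp add: s0_def)
  have re: "0 < Re (\<phi> t)" if "t \<in> {0..s0}" for t
  proof -
    have "\<bar>Re (\<phi> t - \<phi> 0)\<bar> \<le> cmod (\<phi> t - \<phi> 0)" by (rule abs_Re_le_cmod)
    moreover have "cmod (\<phi> t - \<phi> 0) < m" using \<delta>(2)[of t] \<delta>(1) that by (simp add: s0_def dist_norm)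
    ultimately show ?thesis by (simp add: \<phi>0)
  qed
  have nonpos: "\<phi> t \<notin> \<real>\<^sub>\<le>\<^sub>0" if "t \<in> {0..s0}" for t
    using re[OF that] by (auto simp: complex_nonpos_Reals_iff)
  have cont_ln: "continuous_on {0..s0} (\<lambda>t. Ln (\<phi> t))"
    by (intro continuous_on_Ln' cont) (use nonpos in auto)
  then have "bounded ((\<lambda>t. Ln (\<phi> t)) ` {0..s0})"
    by (intro compact_imp_bounded compact_continuous_image) auto
  then obtain K where K: "\<And>t. t \<in> {0..s0} \<Longrightarrow> cmod (Ln (\<phi> t)) \<le> K"
    unfolding bounded_iff by blast
  have K0: "0 \<le> K" using K[of 0] s0 order_trans[OF norm_ge_zero] by auto
  \<comment> \<open>Both sides are continuous roots of \<open>\<phi>\<close> of order n + 1, and at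
    0 both are the positive real root of \<open>m\<close>.\<close>
  have \<phi>n_eq: "\<phi>n n t = exp (Ln (\<phi> t) / of_nat (Suc n))" if t: "t \<in> {0..s0}" for n t
  proof (rule continuous_root_unique[of "{0..s0}" _ _ n 0])
    show "continuous_on {0..s0} (\<lambda>t. exp (Ln (\<phi> t) / of_nat (Suc n)))"
      by (intro continuous_intros cont_ln) (simp del: of_nat_Suc)
    show "\<phi>n n r ^ Suc n = exp (Ln (\<phi> r) / of_nat (Suc n)) ^ Suc n" if "r \<in> {0..s0}" for r
    proof -
      have "\<phi> r \<noteq> 0" using re[OF that] by auto
      have "exp (Ln (\<phi> r) / of_nat (Suc n)) ^ Suc n = exp (of_nat (Suc n) * (Ln (\<phi> r) / of_nat (Suc n)))"
        by (rule exp_of_nat_mult[symmetric])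
      also have "\<dots> = \<phi> r" using \<open>\<phi> r \<noteq> 0\<close> by (simp del: of_nat_Suc)
      also have "\<phi> r = \<phi>n n r ^ Suc n" unfolding \<phi>_def \<phi>n_def by (rule root)
      finally show ?thesis by simp
    qed
    have "mn n ^ Suc n = m"
    proof -
      have "complex_of_real (mn n ^ Suc n) = of_real m"
        using root[of 0 n] \<phi>0 unfolding \<phi>_def[symmetric] \<phi>n_def[symmetric] by simp
      then show ?thesis by (simp only: of_real_eq_iff)
    qed
    then have "ln m = real (Suc n) * ln (mn n)" using mn[of n] by (metis ln_realpow)
    then have "ln m / real (Suc n) = ln (mn n)" by simp
    then have "exp (ln m / real (Suc n)) = mn n" using mn[of n] by simp
    moreover have "exp (Ln (\<phi> 0) / of_nat (Suc n)) = of_real (exp (ln m / real (Suc n)))"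
      unfolding \<phi>0 using m by (simp add: Ln_of_real exp_of_real[symmetric] del: of_nat_Suc)
    ultimately show "\<phi>n n 0 = exp (Ln (\<phi> 0) / of_nat (Suc n))" by (simp add: \<phi>0)
  qed (use t s0 cont in auto)
  \<comment> \<open>The transforms at 0 and at s are each compared with 1, hence the factor 2. Each
    comparison costs \<open>exp K * K\<close>, because the exponent z satisfies (n + 1)|z| = |Ln
    (\<phi> t)| \<le> K.\<close>
  have bound: "real (Suc n) * (\<integral>x. exp (X x) * (1 - cos (s * X x)) \<partial>\<sigma> n) \<le> 2 * (exp K * K)"
    if "0 \<le> s" "s \<le> s0" for n s
  proof -
    note X[measurable]
    have int: "integrable (\<sigma> n) (\<lambda>x. exp (X x) *\<^sub>R iexp (t * X x))" for t
      by (intro integrable_scaleR_iexp intX) simp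
    have "(\<integral>x. exp (X x) * (1 - cos (s * X x)) \<partial>\<sigma> n) = (\<integral>x. Re (exp (X x) *\<^sub>R iexp (0 * X x) - exp (X x) *\<^sub>R iexp (s * X x)) \<partial>\<sigma> n)"
      unfolding cis_conv_exp[symmetric] by (intro Bochner_Integration.integral_cong) (simp_all add: algebra_simps)
    also have "\<dots> = Re (\<phi>n n 0 - \<phi>n n s)"
      unfolding \<phi>n_def Bochner_Integration.integral_diff[OF int int, symmetric]
      by (rule integral_Re) (intro Bochner_Integration.integrable_diff int)
    also have "\<dots> \<le> cmod (\<phi>n n 0 - \<phi>n n s)" by (rule complex_Re_le_cmod)
    also have "\<dots> \<le> cmod (\<phi>n n 0 - 1) + cmod (\<phi>n n s - 1)"
      using norm_triangle_ineq4[of "\<phi>n n 0 - 1" "\<phi>n n s - 1"] by simp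
    finally have "real (Suc n) * (\<integral>x. exp (X x) * (1 - cos (s * X x)) \<partial>\<sigma> n)
        \<le> real (Suc n) * (cmod (\<phi>n n 0 - 1) + cmod (\<phi>n n s - 1))"
      by (intro mult_left_mono) auto
    also have "\<dots> = real (Suc n) * cmod (\<phi>n n 0 - 1) + real (Suc n) * cmod (\<phi>n n s - 1)"
      by (rule distrib_left)
    also have "real (Suc n) * cmod (\<phi>n n t - 1) \<le> exp K * K" if t: "t \<in> {0..s0}" for t
    proof -
      define z where "z = Ln (\<phi> t) / of_nat (Suc n)"
      have z: "real (Suc n) * cmod z = cmod (Ln (\<phi> t))"
        unfolding z_def norm_divide norm_of_nat by (simp del: of_nat_Suc)
      have "cmod z \<le> real (Suc n) * cmod z" using mult_right_mono[of 1 "real (Suc n)" "cmod z"] by simp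
      then have zK: "cmod z \<le> K" using z K[OF t] by linarith
      have "real (Suc n) * cmod (\<phi>n n t - 1) \<le> real (Suc n) * (exp (cmod z) * cmod z)"
        unfolding \<phi>n_eq[OF t] z_def[symmetric] by (intro mult_left_mono norm_exp_minus_one_le) simp
      also have "\<dots> = exp (cmod z) * cmod (Ln (\<phi> t))" using z by (metis mult.left_commute)
      also have "\<dots> \<le> exp K * K" using zK K[OF t] by (intro mult_mono) auto
      finally show ?thesis .
    qed
    then have "real (Suc n) * cmod (\<phi>n n 0 - 1) + real (Suc n) * cmod (\<phi>n n s - 1) \<le> 2 * (exp K * K)"
      using that s0 by (smt (verit) atLeastAtMost_iff)
    finally show ?thesis .
  qed
  show ?thesis by (rule that[OF s0 bound])
qed

text \<open>Weak convergence controls only bounded continuous test functions, so \<open>exp\<close>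
  is cut off at a level m before the bound passes from the roots \<open>\<sigma> n\<close> to \<nu>;
  Fatou's lemma removes the cut-off.\<close>

lemma levy_exp_moment:
  fixes \<sigma> :: "nat \<Rightarrow> 'a measure" and X :: "'a \<Rightarrow> real" and Z :: "'b \<Rightarrow> real" and Y :: "'c \<Rightarrow> real"
  assumes \<sigma>: "\<And>n. prob_space (\<sigma> n)" and X: "\<And>n. X \<in> borel_measurable (\<sigma> n)" and intX: "\<And>n. integrable (\<sigma> n) (\<lambda>x. exp (X x))"
    and M: "prob_space M" and Z: "Z \<in> borel_measurable M" and intZ: "integrable M (\<lambda>x. exp (Z x))"
    and root: "\<And>n t. (CLINT x|M. iexp (t * Z x)) = (CLINT x|\<sigma> n. iexp (t * X x)) ^ Suc n"
    and root_exp: "\<And>n t. (CLINT x|M. exp (Z x) *\<^sub>R iexp (t * Z x)) = (CLINT x|\<sigma> n. exp (X x) *\<^sub>R iexp (t * X x)) ^ Suc n"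
    and \<psi>: "continuous_on UNIV \<psi>" "\<psi> 0 = 0" "\<And>t. (CLINT x|M. iexp (t * Z x)) = exp (\<psi> t)"
    and Y: "Y \<in> borel_measurable \<nu>" and int\<nu>: "\<And>s. integrable \<nu> (\<lambda>x. (1 - cos (s * Y x))\<^sup>2)"
    and \<nu>: "\<And>s t. second_diff s (second_diff s \<psi>) t = (CLINT x|\<nu>. (1 - cos (s * Y x))\<^sup>2 *\<^sub>R iexp (t * Y x))"
    and fin: "\<And>r. 0 < r \<Longrightarrow> emeasure \<nu> {x \<in> space \<nu>. r < Y x} < \<infinity>"
  obtains r where "0 < r" "(\<integral>\<^sup>+x. ennreal (exp (Y x)) * indicator {x \<in> space \<nu>. r < Y x} x \<partial>\<nu>) < \<infinity>"
proof -
  note X[measurable] Y[measurable]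
  obtain s0 C where s0: "0 < s0" and C: "\<And>n s. 0 \<le> s \<Longrightarrow> s \<le> s0 \<Longrightarrow> real (Suc n) * (\<integral>x. exp (X x) * (1 - cos (s * X x)) \<partial>\<sigma> n) \<le> C"
    using tilted_roots_bounded[of \<sigma> X M Z, OF \<sigma> X intX M Z intZ root_exp] by blast
  have int1: "integrable (\<sigma> n) (\<lambda>_. 1 :: real)" for n
    using prob_space.finite_measure[OF \<sigma>] finite_measure.integrable_const by blast
  have int1M: "integrable M (\<lambda>_. 1 :: real)"
    using prob_space.finite_measure[OF M] finite_measure.integrable_const by blast
  have char_root: "(CLINT x|\<sigma> n. iexp (t * X x)) = exp (\<psi> t / of_nat (Suc n))" for n t
  proof (rule continuous_root_unique[of UNIV _ _ n 0])
    show "continuous_on UNIV (\<lambda>t. CLINT x|\<sigma> n. iexp (t * X x))"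
      using continuous_on_iexp_integral[OF int1 X, of UNIV n] by simp
    show "continuous_on UNIV (\<lambda>t. exp (\<psi> t / of_nat (Suc n)))"
      by (intro continuous_intros \<psi>(1)) (simp del: of_nat_Suc)
    show "(CLINT x|\<sigma> n. iexp (t * X x)) ^ Suc n = exp (\<psi> t / of_nat (Suc n)) ^ Suc n" for t
    proof -
      have "exp (\<psi> t / of_nat (Suc n)) ^ Suc n = exp (of_nat (Suc n) * (\<psi> t / of_nat (Suc n)))"
        by (rule exp_of_nat_mult[symmetric])
      also have "\<dots> = exp (\<psi> t)" by (simp del: of_nat_Suc)
      finally show ?thesis using root[of t n] \<psi>(3)[of t] by simp
    qed
    show "(CLINT x|\<sigma> n. iexp (0 * X x)) = exp (\<psi> 0 / of_nat (Suc n))"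
      using prob_space.prob_space[OF \<sigma>] by (simp add: \<psi>(2))
  qed auto
  have bounded: "(\<integral>\<^sup>+x. ennreal (exp (Y x) * (1 - cos (s * Y x))\<^sup>2) \<partial>\<nu>) \<le> ennreal (2 * C)" if s: "0 \<le> s" "s \<le> s0" for s
  proof -
    define h where "h n x = real (Suc n) * (1 - cos (s * X x))\<^sup>2" for n x
    \<comment> \<open>The tilted roots control the single weight 1 - cos; passing to it from the
      square costs the factor 2 in the bound \<open>2 * C\<close>.\<close>
    have cos_sq: "(1 - cos u)\<^sup>2 \<le> 2 * (1 - cos u)" "\<bar>(1 - cos u)\<^sup>2\<bar> \<le> 4" for u :: real
    proof -
      have "\<bar>1 - cos u\<bar> \<le> 2" using cos_ge_minus_one[of u] cos_le_one[of u] by linarith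
      then show "\<bar>(1 - cos u)\<^sup>2\<bar> \<le> 4" using power_mono[of "\<bar>1 - cos u\<bar>" 2 2] by simp
      show "(1 - cos u)\<^sup>2 \<le> 2 * (1 - cos u)"
        unfolding power2_eq_square using cos_ge_minus_one[of u] cos_le_one[of u] by (intro mult_right_mono) auto
    qed
    have inth: "integrable (\<sigma> n) (h n)" for n
      using integrable_mult_right[OF integrable_bounded_mult[OF int1, of "\<lambda>x. (1 - cos (s * X x))\<^sup>2" n 4], of "real (Suc n)"] cos_sq(2)
      by (simp add: h_def[abs_def] del: of_nat_Suc)
    \<comment> \<open>Second differences ignore the subtracted constant 1, so
      \<open>root_limit\<close> can be applied at each of the finitely many arguments
      involved.\<close>
    have conv: "(\<lambda>n. CLINT x|\<sigma> n. h n x *\<^sub>R iexp (t * X x)) \<longlonglongrightarrow> (CLINT x|\<nu>. (1 - cos (s * Y x))\<^sup>2 *\<^sub>R iexp (t * Y x))" for t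
    proof -
      have "(CLINT x|\<sigma> n. h n x *\<^sub>R iexp (t * X x))
          = second_diff s (second_diff s (\<lambda>t. of_nat (Suc n) * (exp (\<psi> t / of_nat (Suc n)) - 1))) t" for n
      proof -
        have "(CLINT x|\<sigma> n. h n x *\<^sub>R iexp (t * X x)) = of_nat (Suc n) * (CLINT x|\<sigma> n. (1 * (1 - cos (s * X x))\<^sup>2) *\<^sub>R iexp (t * X x))"
          by (simp add: h_def scaleR_conv_of_real mult.assoc del: of_nat_Suc)
        also have "(CLINT x|\<sigma> n. (1 * (1 - cos (s * X x))\<^sup>2) *\<^sub>R iexp (t * X x))
            = second_diff s (second_diff s (\<lambda>t. CLINT x|\<sigma> n. 1 *\<^sub>R iexp (t * X x))) t"
          by (rule second_diff2_iexp_integral[OF int1 X, symmetric])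
        also have "(\<lambda>t. CLINT x|\<sigma> n. 1 *\<^sub>R iexp (t * X x)) = (\<lambda>t. exp (\<psi> t / of_nat (Suc n)))"
          using char_root by simp
        finally show ?thesis by (simp only: second_diff_mult second_diff_minus_const)
      qed
      moreover have "(\<lambda>n. second_diff s (second_diff s (\<lambda>t. of_nat (Suc n) * (exp (\<psi> t / of_nat (Suc n)) - 1))) t)
          \<longlonglongrightarrow> second_diff s (second_diff s \<psi>) t"
        unfolding second_diff_def by (intro tendsto_intros root_limit) auto
      ultimately show ?thesis by (simp only: \<nu>)
    qed
    have trunc: "(\<integral>\<^sup>+x. ennreal ((1 - cos (s * Y x))\<^sup>2 * min (exp (Y x)) (real m)) \<partial>\<nu>) \<le> ennreal (2 * C)" for m :: nat
    proof -
      have "(\<lambda>n. \<integral>x. h n x * min (exp (X x)) (real m) \<partial>\<sigma> n) \<longlonglongrightarrow> (\<integral>x. (1 - cos (s * Y x))\<^sup>2 * min (exp (Y x)) (real m) \<partial>\<nu>)"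
        by (rule weighted_levy_continuity[OF inth _ X int\<nu> _ Y conv, where B="real m"])
           (auto simp: h_def intro!: continuous_intros)
      moreover have "(\<integral>x. h n x * min (exp (X x)) (real m) \<partial>\<sigma> n) \<le> 2 * C" for n
      proof -
        have "(\<integral>x. h n x * min (exp (X x)) (real m) \<partial>\<sigma> n) \<le> (\<integral>x. 2 * (real (Suc n) * (exp (X x) * (1 - cos (s * X x)))) \<partial>\<sigma> n)"
        proof (rule integral_mono)
          show "integrable (\<sigma> n) (\<lambda>x. h n x * min (exp (X x)) (real m))"
            by (rule integrable_bounded_mult[OF inth, where B="real m"]) auto
          show "integrable (\<sigma> n) (\<lambda>x. 2 * (real (Suc n) * (exp (X x) * (1 - cos (s * X x)))))"
            by (intro integrable_mult_right integrable_one_minus_cos intX) auto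
          fix x
          have "(1 - cos (s * X x))\<^sup>2 * min (exp (X x)) (real m) \<le> (2 * (1 - cos (s * X x))) * exp (X x)"
            by (intro mult_mono cos_sq) auto
          then have "real (Suc n) * ((1 - cos (s * X x))\<^sup>2 * min (exp (X x)) (real m)) \<le> real (Suc n) * ((2 * (1 - cos (s * X x))) * exp (X x))"
            by (intro mult_left_mono) auto
          then show "h n x * min (exp (X x)) (real m) \<le> 2 * (real (Suc n) * (exp (X x) * (1 - cos (s * X x))))"
            by (simp only: h_def mult_ac)
        qed
        also have "\<dots> \<le> 2 * C" using C[OF s, of n] by (simp del: of_nat_Suc)
        finally show ?thesis .
      qed
      ultimately have "(\<integral>x. (1 - cos (s * Y x))\<^sup>2 * min (exp (Y x)) (real m) \<partial>\<nu>) \<le> 2 * C"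
        by (auto intro: LIMSEQ_le_const2)
      moreover have "integrable \<nu> (\<lambda>x. (1 - cos (s * Y x))\<^sup>2 * min (exp (Y x)) (real m))"
        by (rule integrable_bounded_mult[OF int\<nu>, where B="real m"]) auto
      ultimately show ?thesis
        by (subst nn_integral_eq_integral) (auto intro: ennreal_leI)
    qed
    have "(\<integral>\<^sup>+x. ennreal (exp (Y x) * (1 - cos (s * Y x))\<^sup>2) \<partial>\<nu>)
        = (\<integral>\<^sup>+x. liminf (\<lambda>m. ennreal ((1 - cos (s * Y x))\<^sup>2 * min (exp (Y x)) (real m))) \<partial>\<nu>)"
    proof (rule nn_integral_cong)
      fix x
      have "\<forall>\<^sub>F m in sequentially. ennreal ((1 - cos (s * Y x))\<^sup>2 * min (exp (Y x)) (real m)) = ennreal (exp (Y x) * (1 - cos (s * Y x))\<^sup>2)"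
        using eventually_ge_at_top[of "nat \<lceil>exp (Y x)\<rceil>"]
      proof eventually_elim
        case (elim m)
        then have "exp (Y x) \<le> real m" by linarith
        then show ?case by (simp add: min_def mult.commute)
      qed
      then have "(\<lambda>m. ennreal ((1 - cos (s * Y x))\<^sup>2 * min (exp (Y x)) (real m))) \<longlonglongrightarrow> ennreal (exp (Y x) * (1 - cos (s * Y x))\<^sup>2)"
        by (rule tendsto_eventually)
      then show "ennreal (exp (Y x) * (1 - cos (s * Y x))\<^sup>2) = liminf (\<lambda>m. ennreal ((1 - cos (s * Y x))\<^sup>2 * min (exp (Y x)) (real m)))"
        by (intro lim_imp_Liminf[symmetric]) auto
    qed
    also have "\<dots> \<le> liminf (\<lambda>m. \<integral>\<^sup>+x. ennreal ((1 - cos (s * Y x))\<^sup>2 * min (exp (Y x)) (real m)) \<partial>\<nu>)"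
      by (intro nn_integral_liminf) simp
    also have "\<dots> \<le> liminf (\<lambda>m. ennreal (2 * C))"
      by (intro Liminf_mono always_eventually allI trunc)
    finally show ?thesis by (simp add: Liminf_const)
  qed
  show ?thesis
    by (rule that[OF _ exp_moment_if_cos_moments_bounded[OF Y s0 _ bounded]]) (use s0 fin in auto)
qed

section \<open>The Levy-Khintchine formula under exponential tilting\<close>

text \<open>Only the compensated integrand is integrable, so its three values are combined before
  anything is split off: the compensator is affine in t and cancels pointwise. The Gaussian term
  leaves a constant, since t^2 - ((t + s)^2 + (t - s)^2) / 2 = - s^2.\<close>

lemma second_diff_affine_integral:
  fixes h k l :: "'a \<Rightarrow> complex" and Y :: "'a \<Rightarrow> real"
  assumes int: "\<And>t. integrable N (\<lambda>x. h x * iexp (t * Y x) - k x - of_real t * l x)"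
    and G: "\<And>t. G t = p + q * of_real t + r * of_real (t\<^sup>2) + (CLINT x|N. h x * iexp (t * Y x) - k x - of_real t * l x)"
  shows "integrable N (\<lambda>x. h x * of_real (1 - cos (s * Y x)) * iexp (t * Y x))"
    and "second_diff s G t = - r * of_real (s\<^sup>2) + (CLINT x|N. h x * of_real (1 - cos (s * Y x)) * iexp (t * Y x))"
proof -
  define F where "F t x = h x * iexp (t * Y x) - k x - of_real t * l x" for t x
  have "h x * of_real (1 - cos (s * Y x)) * iexp (t * Y x) = F t x - (F (t + s) x + F (t - s) x) / 2" for x
  proof -
    have "of_real (1 - cos (s * Y x)) * iexp (t * Y x) = iexp (t * Y x) - (iexp ((t + s) * Y x) + iexp ((t - s) * Y x)) / 2"
      unfolding cis_conv_exp[symmetric]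
      by (simp add: complex_eq_iff cos_add cos_diff sin_add sin_diff distrib_right left_diff_distrib)
    then have "h x * (of_real (1 - cos (s * Y x)) * iexp (t * Y x)) = h x * (iexp (t * Y x) - (iexp ((t + s) * Y x) + iexp ((t - s) * Y x)) / 2)"
      by (simp only:)
    then show ?thesis by (simp only: F_def mult.assoc of_real_add of_real_diff) (simp add: field_simps)
  qed
  note eq = this
  have intF: "integrable N (F t)" for t using int[of t] by (simp add: F_def[abs_def])
  show "integrable N (\<lambda>x. h x * of_real (1 - cos (s * Y x)) * iexp (t * Y x))"
    unfolding eq by (intro Bochner_Integration.integrable_diff integrable_divide_zero Bochner_Integration.integrable_add intF)
  have "(CLINT x|N. h x * of_real (1 - cos (s * Y x)) * iexp (t * Y x))
      = (CLINT x|N. F t x) - ((CLINT x|N. F (t + s) x) + (CLINT x|N. F (t - s) x)) / 2"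
    unfolding eq by (simp add: intF)
  then show "second_diff s G t = - r * of_real (s\<^sup>2) + (CLINT x|N. h x * of_real (1 - cos (s * Y x)) * iexp (t * Y x))"
    unfolding second_diff_def G F_def[symmetric] by (simp add: power2_eq_square field_simps)
qed

text \<open>After one difference the function has the same form, with the Gaussian contribution
  reduced to a constant; the second difference removes it.\<close>

lemma second_diff2_affine_integral:
  fixes h k l :: "'a \<Rightarrow> complex" and Y :: "'a \<Rightarrow> real"
  assumes int: "\<And>t. integrable N (\<lambda>x. h x * iexp (t * Y x) - k x - of_real t * l x)"
    and G: "\<And>t. G t = p + q * of_real t + r * of_real (t\<^sup>2) + (CLINT x|N. h x * iexp (t * Y x) - k x - of_real t * l x)"
  shows "integrable N (\<lambda>x. h x * of_real ((1 - cos (s * Y x))\<^sup>2) * iexp (t * Y x))"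
    and "second_diff s (second_diff s G) t = (CLINT x|N. h x * of_real ((1 - cos (s * Y x))\<^sup>2) * iexp (t * Y x))"
proof -
  define h' where "h' x = h x * of_real (1 - cos (s * Y x))" for x
  note first = second_diff_affine_integral[OF int G, where s=s]
  have int': "integrable N (\<lambda>x. h' x * iexp (t * Y x) - 0 - of_real t * 0)" for t
    using first(1)[of t] by (simp add: h'_def)
  have G': "second_diff s G t = - r * of_real (s\<^sup>2) + 0 * of_real t + 0 * of_real (t\<^sup>2) + (CLINT x|N. h' x * iexp (t * Y x) - 0 - of_real t * 0)" for t
    using first(2)[of t] by (simp add: h'_def)
  have sq: "h' x * of_real (1 - cos (s * Y x)) = h x * of_real ((1 - cos (s * Y x))\<^sup>2)" for x
    by (simp add: h'_def power2_eq_square)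
  show "integrable N (\<lambda>x. h x * of_real ((1 - cos (s * Y x))\<^sup>2) * iexp (t * Y x))"
    using second_diff_affine_integral(1)[OF int' G', of s t] by (simp only: sq)
  show "second_diff s (second_diff s G) t = (CLINT x|N. h x * of_real ((1 - cos (s * Y x))\<^sup>2) * iexp (t * Y x))"
    using second_diff_affine_integral(2)[OF int' G', of s t] unfolding sq by simp
qed

lemma borel_measurable_vec_nth [measurable (raw)]:
  fixes f :: "'a \<Rightarrow> real ^ 'n::finite"
  assumes "f \<in> borel_measurable M"
  shows "(\<lambda>x. f x $ i) \<in> borel_measurable M"
  by (rule measurable_compose[OF assms]) measurable

section \<open>The Levy integrand at complex arguments\<close>

text \<open>For z = i t the exponential of this is the ordinary character at t e_j + w; for z = 1 it
  is the character at w with the tilt exp x_j. The strip between them connects the given formula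
  with the wanted one.\<close>

definition clin :: "complex \<Rightarrow> 'n::finite \<Rightarrow> real ^ 'n \<Rightarrow> real ^ 'n \<Rightarrow> complex" where
  "clin z j w x = z * of_real (x $ j) + \<i> * of_real (w \<bullet> x)"

definition levy_integrand :: "complex \<Rightarrow> 'n::finite \<Rightarrow> real ^ 'n \<Rightarrow> real ^ 'n \<Rightarrow> complex" where
  "levy_integrand z j w x = exp (clin z j w x) - 1 - clin z j w x * of_real (indicat_real {x. norm x \<le> 1} x)"

lemma clin_measurable [measurable]: "clin z j w \<in> borel_measurable borel"
  unfolding clin_def[abs_def] by measurable

lemma levy_integrand_measurable [measurable]: "levy_integrand z j w \<in> borel_measurable borel"
proof -
  have [measurable]: "{x :: real ^ 'a. norm x \<le> 1} \<in> sets borel" by measurable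
  show ?thesis unfolding levy_integrand_def[abs_def] by measurable
qed

lemma norm_clin_le: "cmod (clin z j w x) \<le> (cmod z + norm w) * norm x"
proof -
  have "cmod (clin z j w x) \<le> cmod z * \<bar>x $ j\<bar> + \<bar>w \<bullet> x\<bar>"
    unfolding clin_def by (rule order_trans[OF norm_triangle_ineq]) (simp add: norm_mult)
  also have "\<dots> \<le> cmod z * norm x + norm w * norm x"
    by (intro add_mono mult_left_mono component_le_norm_cart Cauchy_Schwarz_ineq2) auto
  finally show ?thesis by (simp add: algebra_simps)
qed

lemma norm_exp_clin_le:
  assumes "0 \<le> Re z" "Re z \<le> 1"
  shows "cmod (exp (clin z j w x)) \<le> 1 + exp (x $ j)"
proof (cases "0 \<le> x $ j")
  case True
  then have "Re z * x $ j \<le> x $ j" using assms mult_right_mono[of "Re z" 1 "x $ j"] by simp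
  then have "exp (Re z * x $ j) \<le> exp (x $ j)" by simp
  then show ?thesis by (simp add: clin_def add_increasing)
next
  case False
  then have "Re z * x $ j \<le> 0" using assms by (intro mult_nonneg_nonpos) auto
  then have "exp (Re z * x $ j) \<le> 1" by simp
  then show ?thesis by (simp add: clin_def add_increasing2)
qed

text \<open>Inside the unit ball the compensated exponential is of second order; outside, the linear
  term is absent. Keeping the norm of the exponential explicit lets one estimate serve both the
  strip, where an exponential moment is required, and the imaginary axis, where it is 1.\<close>

lemma norm_levy_integrand_le_norm_exp:
  assumes R: "cmod z + norm w \<le> R"
  shows "cmod (levy_integrand z j w x)
    \<le> (exp R * R\<^sup>2 + 1) * min ((norm x)\<^sup>2) 1 + indicat_real {x. 1 < norm x} x * cmod (exp (clin z j w x))"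
proof (cases "norm x \<le> 1")
  case True
  have R0: "0 \<le> R" using R norm_ge_zero[of z] norm_ge_zero[of w] by linarith
  have le: "cmod (clin z j w x) \<le> R * norm x"
    using norm_clin_le[of z j w x] mult_right_mono[OF R, of "norm x"] by simp
  also have "\<dots> \<le> R" using True R0 by (simp add: mult_left_le)
  finally have leR: "cmod (clin z j w x) \<le> R" .
  have "cmod (levy_integrand z j w x) \<le> exp (cmod (clin z j w x)) * (cmod (clin z j w x))\<^sup>2"
    using True norm_exp_minus_one_minus_le by (simp add: levy_integrand_def)
  also have "\<dots> \<le> exp R * (R * norm x)\<^sup>2"
    using le leR by (intro mult_mono power_mono) auto
  also have "\<dots> \<le> (exp R * R\<^sup>2 + 1) * (norm x)\<^sup>2"
    by (simp add: power_mult_distrib distrib_right)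
  also have "(norm x)\<^sup>2 = min ((norm x)\<^sup>2) 1"
    using True by (simp add: power_le_one)
  finally show ?thesis using True by simp
next
  case False
  then have "1 \<le> (norm x)\<^sup>2" by simp
  then have min1: "min ((norm x)\<^sup>2) 1 = 1" by (rule min_absorb2)
  have ind1: "indicat_real {x. 1 < norm x} x = 1" using False by simp
  have "cmod (levy_integrand z j w x) \<le> cmod (exp (clin z j w x)) + 1"
    using False norm_triangle_ineq4[of "exp (clin z j w x)" 1] by (simp add: levy_integrand_def)
  moreover have "0 \<le> exp R * R\<^sup>2" by simp
  moreover have "p \<le> (e + 1) * 1 + 1 * q" if "p \<le> q + 1" "0 \<le> e" for p q e :: real
    using that by simp
  ultimately show ?thesis
    unfolding min1 ind1 by blast
qed

lemma indicator_le_min: "indicat_real {x. 1 < norm x} x \<le> min ((norm x)\<^sup>2) 1"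
  by (auto simp: indicator_def)

lemma norm_levy_integrand_le:
  assumes "0 \<le> Re z" "Re z \<le> 1" "cmod z + norm w \<le> R"
  shows "cmod (levy_integrand z j w x)
    \<le> (exp R * R\<^sup>2 + 2) * min ((norm x)\<^sup>2) 1 + indicat_real {x. 1 < norm x} x * exp (x $ j)"
proof -
  have "indicat_real {x. 1 < norm x} x * cmod (exp (clin z j w x)) \<le> indicat_real {x. 1 < norm x} x * (1 + exp (x $ j))"
    by (intro mult_left_mono norm_exp_clin_le assms) simp
  then show ?thesis
    using norm_levy_integrand_le_norm_exp[OF assms(3), of j x] indicator_le_min[of x]
    unfolding distrib_left distrib_right mult_1_right by linarith
qed

lemma norm_levy_integrand_imaginary_le:
  assumes "Re z = 0" "cmod z + norm w \<le> R"
  shows "cmod (levy_integrand z j w x) \<le> (exp R * R\<^sup>2 + 2) * min ((norm x)\<^sup>2) 1"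
proof -
  have norm1: "cmod (exp (clin z j w x)) = 1" using assms(1) by (simp add: clin_def)
  show ?thesis
    using norm_levy_integrand_le_norm_exp[OF assms(2), of j x] indicator_le_min[of x]
    unfolding norm1 distrib_right mult_1_right by linarith
qed

section \<open>Levy measures and convolution roots\<close>

lemma levy_measure_integrable_min:
  assumes "levy_measure \<nu>"
  shows "integrable \<nu> (\<lambda>x. min ((norm x)\<^sup>2) 1)"
  using assms unfolding levy_measure_def
  by (intro integrableI_nonneg) (auto cong: measurable_cong_sets)

lemma levy_measure_finite_outside:
  assumes \<nu>: "levy_measure \<nu>" and A: "A \<in> sets borel" "\<And>x. x \<in> A \<Longrightarrow> r < norm x" and r: "0 < r"
  shows "emeasure \<nu> A < \<infinity>"
proof -
  define c where "c = min (r\<^sup>2) 1"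
  have c: "0 < c" using r by (simp add: c_def)
  have sets: "sets \<nu> = sets borel" using \<nu> by (simp add: levy_measure_def)
  have "ennreal c * emeasure \<nu> A = (\<integral>\<^sup>+x. ennreal c * indicator A x \<partial>\<nu>)"
    using A sets by (simp add: nn_integral_cmult_indicator)
  also have "\<dots> \<le> (\<integral>\<^sup>+x. ennreal (min ((norm x)\<^sup>2) 1) \<partial>\<nu>)"
  proof (rule nn_integral_mono)
    fix x
    show "ennreal c * indicator A x \<le> ennreal (min ((norm x)\<^sup>2) 1)"
    proof (cases "x \<in> A")
      case True
      then have "r\<^sup>2 \<le> (norm x)\<^sup>2" using A(2)[OF True] r by (intro power_mono) auto
      then show ?thesis using True by (auto simp: c_def intro!: ennreal_leI min.mono)
    qed simp
  qed
  also have "\<dots> < \<infinity>" using \<nu> by (simp add: levy_measure_def)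
  finally show ?thesis using c by (auto simp: ennreal_mult_less_top)
qed

text \<open>The exponential of a linear functional turns a sum of independent terms into a product.
  This is first used with nonnegative integrals, where a finite power of order n + 1 forces a finite
  base, and then with complex ones.\<close>

lemma convolution_root_integrals:
  fixes X :: "'a \<Rightarrow> real ^ 'n::finite" and \<rho> :: "(real ^ 'n) measure"
  assumes X [measurable]: "X \<in> borel_measurable M"
    and \<rho>: "prob_space \<rho>" and sets: "sets \<rho> = sets borel"
    and eq: "distr M borel X = distr (\<Pi>\<^sub>M j\<in>{..<Suc n}. \<rho>) borel (\<lambda>y. \<Sum>j<Suc n. y j)"
  shows "integrable M (\<lambda>x. exp (X x $ j)) \<Longrightarrow> integrable \<rho> (\<lambda>x. exp (x $ j))"
    and "integrable \<rho> (\<lambda>x. exp (clin z j w x)) \<Longrightarrow>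
      (CLINT x|M. exp (clin z j w (X x))) = (CLINT x|\<rho>. exp (clin z j w x)) ^ Suc n"
proof -
  interpret prob_space \<rho> by fact
  interpret product_sigma_finite "\<lambda>_::nat. \<rho>" ..
  note sets[measurable_cong]
  have comp: "(\<lambda>y. y i) \<in> borel_measurable (\<Pi>\<^sub>M j\<in>{..<Suc n}. \<rho>)" if "i \<in> {..<Suc n}" for i
  proof -
    have "(\<lambda>y. y i) \<in> (\<Pi>\<^sub>M j\<in>{..<Suc n}. \<rho>) \<rightarrow>\<^sub>M \<rho>" by (rule measurable_component_singleton[OF that])
    then show ?thesis using measurable_cong_sets[OF refl sets] by blast
  qed
  have [measurable]: "(\<lambda>y. \<Sum>j<Suc n. y j) \<in> borel_measurable (\<Pi>\<^sub>M j\<in>{..<Suc n}. \<rho>)"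
    by (intro borel_measurable_sum comp)
  show "integrable \<rho> (\<lambda>x. exp (x $ j))" if int: "integrable M (\<lambda>x. exp (X x $ j))"
  proof (rule integrableI_nonneg)
    have "(\<integral>\<^sup>+x. ennreal (exp (x $ j)) \<partial>\<rho>) ^ Suc n = (\<Prod>i<Suc n. \<integral>\<^sup>+x. ennreal (exp (x $ j)) \<partial>\<rho>)"
      by simp
    also have "\<dots> = (\<integral>\<^sup>+y. (\<Prod>i<Suc n. ennreal (exp (y i $ j))) \<partial>(\<Pi>\<^sub>M j\<in>{..<Suc n}. \<rho>))"
      by (rule product_nn_integral_prod[symmetric]) auto
    also have "\<dots> = (\<integral>\<^sup>+y. ennreal (exp ((\<Sum>i<Suc n. y i) $ j)) \<partial>(\<Pi>\<^sub>M j\<in>{..<Suc n}. \<rho>))"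
      by (intro nn_integral_cong, subst prod_ennreal) (simp_all add: sum_component exp_sum del: sum.lessThan_Suc prod.lessThan_Suc)
    also have "\<dots> = (\<integral>\<^sup>+x. ennreal (exp (x $ j)) \<partial>distr (\<Pi>\<^sub>M j\<in>{..<Suc n}. \<rho>) borel (\<lambda>y. \<Sum>j<Suc n. y j))"
      by (subst nn_integral_distr) auto
    also have "\<dots> = (\<integral>\<^sup>+x. ennreal (exp (X x $ j)) \<partial>M)"
      unfolding eq[symmetric] by (subst nn_integral_distr) auto
    also have "\<dots> < \<infinity>" using int by (simp add: integrable_iff_bounded)
    finally show "(\<integral>\<^sup>+x. ennreal (exp (x $ j)) \<partial>\<rho>) < \<infinity>"
      using ennreal_mult_less_top power_less_top_ennreal[of _ "Suc n"] by simp
  qed auto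
  show "(CLINT x|M. exp (clin z j w (X x))) = (CLINT x|\<rho>. exp (clin z j w x)) ^ Suc n"
    if int: "integrable \<rho> (\<lambda>x. exp (clin z j w x))"
  proof -
    have clin_sum: "clin z j w (\<Sum>i\<in>I. y i) = (\<Sum>i\<in>I. clin z j w (y i))" for I :: "nat set" and y
      by (simp add: clin_def sum_component inner_sum_right sum.distrib sum_distrib_left)
    have "(CLINT x|M. exp (clin z j w (X x))) = (CLINT x|distr M borel X. exp (clin z j w x))"
      by (subst integral_distr) auto
    also have "\<dots> = (CLINT y|(\<Pi>\<^sub>M j\<in>{..<Suc n}. \<rho>). exp (clin z j w (\<Sum>i<Suc n. y i)))"
      unfolding eq by (subst integral_distr) auto
    also have "\<dots> = (CLINT y|(\<Pi>\<^sub>M j\<in>{..<Suc n}. \<rho>). (\<Prod>i<Suc n. exp (clin z j w (y i))))"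
      unfolding clin_sum by (simp only: exp_sum[OF finite_lessThan])
    also have "\<dots> = (\<Prod>i<Suc n. CLINT x|\<rho>. exp (clin z j w x))"
      by (rule product_integral_prod) (use int in auto)
    finally show ?thesis by simp
  qed
qed

section \<open>From the imaginary axis to the tilted transform\<close>

locale exp_integrable_levy_vector =
  fixes M :: "'a measure" and \<xi> :: "'a \<Rightarrow> real ^ 'n::finite"
    and A :: "real ^ 'n ^ 'n" and \<nu> :: "(real ^ 'n) measure" and b :: "real ^ 'n"
  assumes prob_M: "prob_space M" and \<xi>_measurable [measurable]: "\<xi> \<in> borel_measurable M"
    and exp_vec_integrable: "integrable M (\<lambda>\<omega>. exp_vec (\<xi> \<omega>))"
    and inf_div: "infinitely_divisible M \<xi>" and triplet: "has_levy_triplet M \<xi> A \<nu> b"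
begin

lemma levy_\<nu>: "levy_measure \<nu>" and A_symmetric: "transpose A = A"
  using triplet unfolding has_levy_triplet_def by auto

lemma sets_\<nu> [measurable_cong]: "sets \<nu> = sets borel"
  using levy_\<nu> unfolding levy_measure_def by simp

lemma space_\<nu> [simp]: "space \<nu> = UNIV"
  using sets_eq_imp_space_eq[OF sets_\<nu>] by simp

lemma exp_integrable: "integrable M (\<lambda>\<omega>. exp (\<xi> \<omega> $ i))"
proof -
  have "integrable M (\<lambda>\<omega>. exp_vec (\<xi> \<omega>) \<bullet> axis i 1)"
    using exp_vec_integrable by (rule integrable_inner_left[rotated])
  then show ?thesis by (simp add: inner_axis exp_vec_def)
qed

lemma char_eq:
  "(CLINT \<omega>|M. iexp (u \<bullet> \<xi> \<omega>)) =
    exp (\<i> * complex_of_real (b \<bullet> u) - complex_of_real (u \<bullet> (A *v u)) / 2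
             + (CLINT x|\<nu>. iexp (u \<bullet> x) - 1
                   - \<i> * complex_of_real ((u \<bullet> x) * indicat_real {x. norm x \<le> 1} x)))"
  using triplet unfolding has_levy_triplet_def by blast

lemma integrable_min: "integrable \<nu> (\<lambda>x. min ((norm x)\<^sup>2) 1)"
  by (rule levy_measure_integrable_min[OF levy_\<nu>])

text \<open>The Levy-Khintchine exponent with i u replaced by z e_j + i w. The quadratic form is
  expanded, using the symmetry of \<open>A\<close>, so that the part outside the integral is visibly
  a polynomial in z.\<close>

definition levy_log :: "complex \<Rightarrow> 'n \<Rightarrow> real ^ 'n \<Rightarrow> complex" where
  "levy_log z j w = z * of_real (b $ j) + \<i> * of_real (b \<bullet> w)
     + (z\<^sup>2 * of_real (A $ j $ j) + 2 * \<i> * z * of_real ((A *v w) $ j) - of_real (w \<bullet> (A *v w))) / 2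
     + (CLINT x|\<nu>. levy_integrand z j w x)"

lemma char_eq_levy_log: "(CLINT \<omega>|M. exp (clin (\<i> * of_real t) j w (\<xi> \<omega>))) = exp (levy_log (\<i> * of_real t) j w)"
proof -
  define u where "u = t *\<^sub>R axis j 1 + w"
  have u_inner: "u \<bullet> x = t * (x $ j) + (w \<bullet> x)" for x
    by (simp add: u_def inner_add_left inner_axis')
  have clin: "clin (\<i> * of_real t) j w x = \<i> * of_real (u \<bullet> x)" for x
    by (simp add: clin_def u_inner algebra_simps)
  have "w \<bullet> (A *v axis j 1) = (A *v w) $ j"
  proof -
    have "w \<bullet> (A *v axis j 1) = (transpose A *v w) \<bullet> axis j 1"
      by (simp add: dot_lmul_matrix[symmetric] transpose_matrix_vector)
    then show ?thesis by (simp add: A_symmetric inner_axis)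
  qed
  moreover have "(A *v axis j 1) $ j = A $ j $ j"
    by (simp add: matrix_vector_mul_component inner_axis)
  ultimately have quad: "u \<bullet> (A *v u) = t\<^sup>2 * A $ j $ j + 2 * t * (A *v w) $ j + w \<bullet> (A *v w)"
    unfolding u_inner
    by (simp add: u_def matrix_vector_right_distrib matrix_vector_mult_scaleR inner_add_right power2_eq_square algebra_simps)
  have integrand: "iexp (u \<bullet> x) - 1 - \<i> * complex_of_real ((u \<bullet> x) * indicat_real {x. norm x \<le> 1} x) = levy_integrand (\<i> * of_real t) j w x" for x
    by (simp add: levy_integrand_def clin)
  have "b \<bullet> u = t * b $ j + b \<bullet> w" using u_inner[of b] by (simp add: inner_commute)
  then have log: "\<i> * complex_of_real (b \<bullet> u) - complex_of_real (u \<bullet> (A *v u)) / 2 + (CLINT x|\<nu>. levy_integrand (\<i> * of_real t) j w x)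
      = levy_log (\<i> * of_real t) j w"
    unfolding levy_log_def quad by (simp add: power2_eq_square field_simps)
  show ?thesis
    using char_eq[of u] unfolding integrand log clin .
qed

end

context exp_integrable_levy_vector
begin

text \<open>The dominating function depends on a bound for |t|, so continuity is shown on bounded
  intervals. The estimate for the imaginary axis is used because no exponential moment of \<nu> is
  available yet.\<close>

lemma continuous_levy_log_imaginary:
  "continuous_on UNIV (\<lambda>t. levy_log (\<i> * of_real t) j w)"
proof -
  have "continuous_on {-R<..<R} (\<lambda>t. CLINT x|\<nu>. levy_integrand (\<i> * of_real t) j w x)" for R
  proof (rule continuous_on_parametric_integral)
    let ?R = "R + norm w"
    show "continuous_on {-R<..<R} (\<lambda>t. levy_integrand (\<i> * of_real t) j w x)" for x
      unfolding levy_integrand_def clin_def by (intro continuous_intros)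
    show "levy_integrand (\<i> * of_real t) j w \<in> borel_measurable \<nu>" for t by measurable
    show "integrable \<nu> (\<lambda>x. (exp ?R * ?R\<^sup>2 + 2) * min ((norm x)\<^sup>2) 1)"
      by (intro integrable_mult_right integrable_min)
    show "cmod (levy_integrand (\<i> * of_real t) j w x) \<le> (exp ?R * ?R\<^sup>2 + 2) * min ((norm x)\<^sup>2) 1"
      if "t \<in> {-R<..<R}" for t x
      using that by (intro norm_levy_integrand_imaginary_le) (auto simp: norm_mult)
  qed
  then have "continuous (at t) (\<lambda>t. CLINT x|\<nu>. levy_integrand (\<i> * of_real t) j w x)" for t
    by (rule continuous_on_interior[where S="{- (\<bar>t\<bar> + 1)<..<\<bar>t\<bar> + 1}"]) (auto simp: interior_open)
  then have "continuous_on UNIV (\<lambda>t. CLINT x|\<nu>. levy_integrand (\<i> * of_real t) j w x)"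
    by (simp add: continuous_on_eq_continuous_at)
  then show ?thesis
    unfolding levy_log_def by (intro continuous_intros) simp_all
qed

text \<open>Here infinite divisibility enters: the convolution roots of \<xi> are projected to
  coordinate j and fed into \<open>levy_exp_moment\<close>.\<close>

lemma exp_moment_\<nu>: "integrable \<nu> (\<lambda>x. indicat_real {x. 1 < norm x} x * exp (x $ j))"
proof -
  interpret prob_space M by (rule prob_M)
  have "\<exists>\<rho> :: (real ^ 'n) measure. prob_space \<rho> \<and> sets \<rho> = sets borel \<and>
           distr M borel \<xi> = distr (\<Pi>\<^sub>M j\<in>{..<Suc n}. \<rho>) borel (\<lambda>y. \<Sum>j<Suc n. y j)" for n
  proof -
    have "1 \<le> Suc n" by simp
    then show ?thesis using inf_div unfolding infinitely_divisible_def by blast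
  qed
  then obtain \<sigma> :: "nat \<Rightarrow> (real ^ 'n) measure" where
    \<sigma>: "\<And>n. prob_space (\<sigma> n)" and sets_\<sigma> [measurable_cong]: "\<And>n. sets (\<sigma> n) = sets borel" and
    conv: "\<And>n. distr M borel \<xi> = distr (\<Pi>\<^sub>M j\<in>{..<Suc n}. \<sigma> n) borel (\<lambda>y. \<Sum>j<Suc n. y j)"
    by metis
  note roots = convolution_root_integrals[OF \<xi>_measurable \<sigma> sets_\<sigma> conv]
  have exp_\<sigma>: "integrable (\<sigma> n) (\<lambda>x. exp (x $ j))" for n
    by (rule roots(1)[OF exp_integrable])
  have clin_0: "exp (clin (\<i> * of_real t) j 0 x) = iexp (t * x $ j)" for t x
    by (simp add: clin_def algebra_simps)
  have clin_1: "exp (clin (1 + \<i> * of_real t) j 0 x) = exp (x $ j) *\<^sub>R iexp (t * x $ j)" for t x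
    by (simp add: clin_def exp_add scaleR_conv_of_real exp_of_real algebra_simps)
  define \<psi> where "\<psi> t = levy_log (\<i> * of_real t) j 0" for t
  define l where "l x = \<i> * of_real (x $ j * indicat_real {x. norm x \<le> 1} x)" for x :: "real ^ 'n"
  have integrand: "levy_integrand (\<i> * of_real t) j 0 x = 1 * iexp (t * x $ j) - 1 - of_real t * l x" for t x
    by (simp add: levy_integrand_def clin_def l_def algebra_simps)
  have int: "integrable \<nu> (\<lambda>x. 1 * iexp (t * x $ j) - 1 - of_real t * l x)" for t
    unfolding integrand[symmetric]
  proof (rule Bochner_Integration.integrable_bound[OF integrable_mult_right[OF integrable_min, of "exp \<bar>t\<bar> * \<bar>t\<bar>\<^sup>2 + 2"]])
    show "levy_integrand (\<i> * of_real t) j 0 \<in> borel_measurable \<nu>" by measurable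
    show "AE x in \<nu>. cmod (levy_integrand (\<i> * of_real t) j 0 x) \<le> norm ((exp \<bar>t\<bar> * \<bar>t\<bar>\<^sup>2 + 2) * min ((norm x)\<^sup>2) 1)"
    proof (rule AE_I2)
      fix x :: "real ^ 'n"
      show "cmod (levy_integrand (\<i> * of_real t) j 0 x) \<le> norm ((exp \<bar>t\<bar> * \<bar>t\<bar>\<^sup>2 + 2) * min ((norm x)\<^sup>2) 1)"
        using norm_levy_integrand_imaginary_le[of "\<i> * of_real t" 0 "\<bar>t\<bar>" j x] order_trans[OF _ abs_ge_self]
        by (auto simp: norm_mult)
    qed
  qed
  have \<psi>_eq: "\<psi> t = 0 + (\<i> * of_real (b $ j)) * of_real t + (- of_real (A $ j $ j) / 2) * of_real (t\<^sup>2)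
      + (CLINT x|\<nu>. 1 * iexp (t * x $ j) - 1 - of_real t * l x)" for t
    unfolding \<psi>_def levy_log_def integrand by (simp add: power2_eq_square algebra_simps)
  note diff2 = second_diff2_affine_integral[of \<nu> "\<lambda>_. 1" "\<lambda>x. x $ j" "\<lambda>_. 1" l, OF int \<psi>_eq]
  obtain r where r: "0 < r" and fin: "(\<integral>\<^sup>+x. ennreal (exp (x $ j)) * indicator {x \<in> space \<nu>. r < x $ j} x \<partial>\<nu>) < \<infinity>"
  proof (rule levy_exp_moment[of \<sigma> "\<lambda>x. x $ j" M "\<lambda>\<omega>. \<xi> \<omega> $ j" \<psi> "\<lambda>x. x $ j" \<nu>])
    show "(\<lambda>x. x $ j) \<in> borel_measurable (\<sigma> n)" for n by measurable
    show "(CLINT x|M. iexp (t * \<xi> x $ j)) = (CLINT x|\<sigma> n. iexp (t * x $ j)) ^ Suc n" for n t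
    proof -
      have "integrable (\<sigma> n) (\<lambda>x. iexp (t * x $ j))"
        by (intro finite_measure.integrable_const_bound[where B=1] prob_space.finite_measure \<sigma> AE_I2) simp_all
      then show ?thesis
        using roots(2)[of n "\<i> * of_real t" j 0] unfolding clin_0 by simp
    qed
    show "(CLINT x|M. exp (\<xi> x $ j) *\<^sub>R iexp (t * \<xi> x $ j)) = (CLINT x|\<sigma> n. exp (x $ j) *\<^sub>R iexp (t * x $ j)) ^ Suc n" for n t
    proof -
      have "integrable (\<sigma> n) (\<lambda>x. exp (x $ j) *\<^sub>R iexp (t * x $ j))"
        by (rule integrable_scaleR_iexp[OF exp_\<sigma>]) measurable
      then show ?thesis
        using roots(2)[of n "1 + \<i> * of_real t" j 0] unfolding clin_1 by simp
    qed
    show "continuous_on UNIV \<psi>" unfolding \<psi>_def[abs_def] by (rule continuous_levy_log_imaginary)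
    have "levy_integrand 0 j 0 = (\<lambda>_. 0)" by (simp add: fun_eq_iff levy_integrand_def clin_def)
    then show "\<psi> 0 = 0" unfolding \<psi>_def levy_log_def by simp
    show "(CLINT x|M. iexp (t * \<xi> x $ j)) = exp (\<psi> t)" for t
      using char_eq_levy_log[of t j 0] unfolding clin_0 \<psi>_def .
    show "integrable \<nu> (\<lambda>x. (1 - cos (s * x $ j))\<^sup>2)" for s
      using diff2(1)[of s 0] by (simp only: mult_1_left mult_zero_left mult_zero_right of_real_0 exp_zero mult_1_right complex_of_real_integrable_eq)
    show "second_diff s (second_diff s \<psi>) t = (CLINT x|\<nu>. (1 - cos (s * x $ j))\<^sup>2 *\<^sub>R iexp (t * x $ j))" for s t
      using diff2(2)[of s t] by (simp only: mult_1_left scaleR_conv_of_real)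
    show "emeasure \<nu> {x \<in> space \<nu>. r < x $ j} < \<infinity>" if "0 < r" for r
    proof (rule levy_measure_finite_outside[OF levy_\<nu> _ _ that])
      show "r < norm x" if "x \<in> {x \<in> space \<nu>. r < x $ j}" for x
        using that component_le_norm_cart[of x j] by auto
    qed simp
    show "(\<lambda>\<omega>. \<xi> \<omega> $ j) \<in> borel_measurable M" by measurable
  qed (use \<sigma> exp_\<sigma> prob_M exp_integrable in auto)
  show ?thesis
  proof (rule integrableI_bounded)
    \<comment> \<open>The moment obtained covers only x_j > r. Elsewhere exp x_j \<le> exp r, and
      the complement of the unit ball has finite measure.\<close>
    have out: "emeasure \<nu> {x. 1 < norm x} < \<infinity>"
      by (rule levy_measure_finite_outside[OF levy_\<nu>, of _ 1]) auto
    have "(\<integral>\<^sup>+x. ennreal (norm (indicat_real {x. 1 < norm x} x * exp (x $ j))) \<partial>\<nu>)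
      \<le> (\<integral>\<^sup>+x. ennreal (exp (x $ j)) * indicator {x \<in> space \<nu>. r < x $ j} x + ennreal (exp r) * indicator {x. 1 < norm x} x \<partial>\<nu>)"
    proof (rule nn_integral_mono)
      fix x
      show "ennreal (norm (indicat_real {x. 1 < norm x} x * exp (x $ j)))
        \<le> ennreal (exp (x $ j)) * indicator {x \<in> space \<nu>. r < x $ j} x + ennreal (exp r) * indicator {x. 1 < norm x} x"
        by (cases "1 < norm x"; cases "r < x $ j") (simp_all add: ennreal_leI)
    qed
    also have "\<dots> = (\<integral>\<^sup>+x. ennreal (exp (x $ j)) * indicator {x \<in> space \<nu>. r < x $ j} x \<partial>\<nu>) + ennreal (exp r) * emeasure \<nu> {x. 1 < norm x}"
      by (subst nn_integral_add) (auto simp: nn_integral_cmult_indicator)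
    also have "\<dots> < \<infinity>" using fin out by (simp add: ennreal_mult_less_top)
    finally show "(\<integral>\<^sup>+x. ennreal (norm (indicat_real {x. 1 < norm x} x * exp (x $ j))) \<partial>\<nu>) < \<infinity>" .
  qed measurable
qed

lemma integrable_levy_bound: "integrable \<nu> (\<lambda>x. c * min ((norm x)\<^sup>2) 1 + indicat_real {x. 1 < norm x} x * exp (x $ j))"
  by (intro Bochner_Integration.integrable_add integrable_mult_right integrable_min exp_moment_\<nu>)

lemma integrable_levy_integrand:
  assumes "0 \<le> Re z" "Re z \<le> 1"
  shows "integrable \<nu> (levy_integrand z j w)"
proof (rule Bochner_Integration.integrable_bound[OF integrable_levy_bound])
  show "levy_integrand z j w \<in> borel_measurable \<nu>" by measurable
  let ?R = "cmod z + norm w"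
  show "AE x in \<nu>. cmod (levy_integrand z j w x) \<le> norm ((exp ?R * ?R\<^sup>2 + 2) * min ((norm x)\<^sup>2) 1 + indicat_real {x. 1 < norm x} x * exp (x $ j))"
    by (intro AE_I2 order_trans[OF norm_levy_integrand_le[OF assms order_refl]]) simp
qed

text \<open>Analytic continuation in z with w fixed, started from \<open>char_eq_levy_log\<close>.
  Comparing exponentials avoids the choice of a logarithm of the expectation inside the
  strip.\<close>

lemma tilted_char_eq: "(CLINT \<omega>|M. exp (clin 1 j w (\<xi> \<omega>))) = exp (levy_log 1 j w)"
proof (rule half_box_eq_at_1[where f="\<lambda>z. CLINT \<omega>|M. exp (clin z j w (\<xi> \<omega>))" and g="\<lambda>z. exp (levy_log z j w)"])
  interpret prob_space M by (rule prob_M)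
  \<comment> \<open>On \<open>half_box\<close>, |z| is at most |Re z| + |Im z| and hence at most
    2.\<close>
  let ?R = "2 + norm w"
  let ?B = "\<lambda>x. (exp ?R * ?R\<^sup>2 + 2) * min ((norm x)\<^sup>2) 1 + indicat_real {x. 1 < norm x} x * exp (x $ j)"
  have int1: "integrable M (\<lambda>\<omega>. 1 + exp (\<xi> \<omega> $ j))" using exp_integrable by simp
  have box: "0 \<le> Re z" "Re z \<le> 1" "cmod z + norm w \<le> ?R" if "z \<in> half_box" for z
    using that cmod_le[of z] by (auto simp: half_box_def)
  have bound1: "cmod (exp (clin z j w (\<xi> \<omega>))) \<le> 1 + exp (\<xi> \<omega> $ j)" if "z \<in> half_box" for z \<omega>
    by (rule norm_exp_clin_le) (use box[OF that] in auto)
  have bound2: "cmod (levy_integrand z j w x) \<le> ?B x" if "z \<in> half_box" for z x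
    by (rule norm_levy_integrand_le) (use box[OF that] in auto)
  have int: "interior half_box \<subseteq> half_box" by (rule interior_subset)
  have cont1: "continuous_on S (\<lambda>z. exp (clin z j w x))" and hol1: "(\<lambda>z. exp (clin z j w x)) holomorphic_on S" for S x
    unfolding clin_def by (intro continuous_intros holomorphic_intros)+
  have cont2: "continuous_on S (\<lambda>z. levy_integrand z j w x)" and hol2: "(\<lambda>z. levy_integrand z j w x) holomorphic_on S" for S x
    unfolding levy_integrand_def clin_def by (intro continuous_intros holomorphic_intros)+
  have meas1: "(\<lambda>\<omega>. exp (clin z j w (\<xi> \<omega>))) \<in> borel_measurable M" for z by measurable
  have meas2: "levy_integrand z j w \<in> borel_measurable \<nu>" for z by measurable
  show "continuous_on half_box (\<lambda>z. CLINT \<omega>|M. exp (clin z j w (\<xi> \<omega>)))"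
    by (rule continuous_on_parametric_integral[OF cont1 meas1 bound1 int1])
  show "(\<lambda>z. CLINT \<omega>|M. exp (clin z j w (\<xi> \<omega>))) holomorphic_on interior half_box"
    by (rule holomorphic_on_parametric_integral[OF open_interior hol1 meas1 bound1[OF subsetD[OF int]] int1])
  have "continuous_on half_box (\<lambda>z. CLINT x|\<nu>. levy_integrand z j w x)"
    by (rule continuous_on_parametric_integral[OF cont2 meas2 bound2 integrable_levy_bound])
  then show "continuous_on half_box (\<lambda>z. exp (levy_log z j w))"
    unfolding levy_log_def by (intro continuous_intros) simp_all
  have "(\<lambda>z. CLINT x|\<nu>. levy_integrand z j w x) holomorphic_on interior half_box"
    by (rule holomorphic_on_parametric_integral[OF open_interior hol2 meas2 bound2[OF subsetD[OF int]] integrable_levy_bound])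
  then show "(\<lambda>z. exp (levy_log z j w)) holomorphic_on interior half_box"
    unfolding levy_log_def by (intro holomorphic_intros) simp_all
  show "(CLINT \<omega>|M. exp (clin (\<i> * of_real y) j w (\<xi> \<omega>))) = exp (levy_log (\<i> * of_real y) j w)" for y
    by (rule char_eq_levy_log)
qed

lemma levy_log_0: "levy_log 1 j 0 = of_real (levy_exponent A \<nu> b j)"
proof -
  have "levy_integrand 1 j 0 x = of_real (exp (x $ j) - 1 - x $ j * indicat_real {x. norm x \<le> 1} x)" for x
    by (simp add: levy_integrand_def clin_def exp_of_real)
  then have "(CLINT x|\<nu>. levy_integrand 1 j 0 x)
      = of_real (\<integral>x. exp (x $ j) - 1 - x $ j * indicat_real {x. norm x \<le> 1} x \<partial>\<nu>)"
    by (simp only: integral_complex_of_real)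
  then show ?thesis
    by (simp add: levy_log_def levy_exponent_def)
qed

lemma expectation_exp: "(\<integral>\<omega>. exp (\<xi> \<omega> $ j) \<partial>M) = exp (levy_exponent A \<nu> b j)"
proof -
  have "complex_of_real (\<integral>\<omega>. exp (\<xi> \<omega> $ j) \<partial>M) = (CLINT \<omega>|M. exp (clin 1 j 0 (\<xi> \<omega>)))"
    by (simp add: clin_def exp_of_real)
  also have "\<dots> = of_real (exp (levy_exponent A \<nu> b j))"
    unfolding tilted_char_eq levy_log_0 by (simp add: exp_of_real)
  finally show ?thesis by (simp only: of_real_eq_iff)
qed

end

section \<open>Zonoid equivalence and tilted laws of differences\<close>

abbreviation reduced_indices :: "'n::{finite,linorder} set" where
  "reduced_indices \<equiv> UNIV - {last_index}"

lemma sum_UNIV_last_index: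
  fixes f :: "'n::{finite,linorder} \<Rightarrow> 'b::comm_monoid_add"
  shows "sum f UNIV = f last_index + sum f reduced_indices"
  by (rule sum.remove) auto

text \<open>Subtracting x_d from every coordinate changes the inner product by x_d times the sum of
  the entries of W, which is 0.\<close>

lemma inner_eq_inner_diff_last:
  fixes W x :: "real ^ 'n::{finite,linorder}"
  assumes "(\<Sum>i\<in>UNIV. W $ i) = 0"
  shows "W \<bullet> x = (\<Sum>i\<in>reduced_indices. W $ i * diff_last x i)"
proof -
  have last: "W $ last_index = - (\<Sum>i\<in>reduced_indices. W $ i)"
    using assms unfolding sum_UNIV_last_index by simp
  have "(\<Sum>i\<in>reduced_indices. W $ i * diff_last x i) = (\<Sum>i\<in>reduced_indices. W $ i * x $ i - W $ i * x $ last_index)"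
    by (intro sum.cong) (auto simp: diff_last_def right_diff_distrib)
  also have "\<dots> = (\<Sum>i\<in>reduced_indices. W $ i * x $ i) + W $ last_index * x $ last_index"
    by (simp add: sum_subtractf last sum_distrib_right)
  also have "\<dots> = W \<bullet> x"
    by (simp add: inner_vec_def sum_UNIV_last_index)
  finally show ?thesis by simp
qed

text \<open>The transpose of \<open>U\<close>: it identifies linear functionals of the differences
  with the zero-sum vectors of the full space.\<close>

definition lift :: "('n::{finite,linorder} \<Rightarrow> real) \<Rightarrow> real ^ 'n::{finite,linorder}" where
  "lift v = (\<chi> i. if i = last_index then - (\<Sum>k\<in>reduced_indices. v k) else v i)"

lemma sum_lift: "(\<Sum>i\<in>UNIV. lift v $ i) = 0"
  unfolding sum_UNIV_last_index by (simp add: lift_def)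

lemma inner_lift: "lift v \<bullet> x = (\<Sum>i\<in>reduced_indices. v i * diff_last x i)"
  unfolding inner_eq_inner_diff_last[OF sum_lift] by (intro sum.cong) (auto simp: lift_def)

lemma lift_components:
  fixes W :: "real ^ 'n::{finite,linorder}"
  assumes "(\<Sum>i\<in>UNIV. W $ i) = 0"
  shows "lift (\<lambda>i. W $ i) = W"
  using assms unfolding sum_UNIV_last_index by (auto simp: lift_def vec_eq_iff)

section \<open>The tilted law of differences\<close>

text \<open>The measure \<open>Q\<close> of the overview. It is not normalised, so equality of two
  such measures includes equality of the expectations of exp X_d.\<close>

definition tilted_law :: "'a measure \<Rightarrow> ('a \<Rightarrow> real ^ 'n::{finite,linorder}) \<Rightarrow> ('n \<Rightarrow> real) measure" where
  "tilted_law M X = distr (density M (\<lambda>\<omega>. ennreal (exp (X \<omega> $ last_index)))) reduced_borel (\<lambda>\<omega>. diff_last (X \<omega>))"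

lemma sets_tilted_law [simp, measurable_cong]: "sets (tilted_law M X) = sets reduced_borel"
  by (simp add: tilted_law_def)

lemma space_tilted_law [simp]: "space (tilted_law M X) = space reduced_borel"
  by (simp add: tilted_law_def)

lemma diff_last_measurable_compose [measurable (raw)]:
  assumes "X \<in> borel_measurable M"
  shows "(\<lambda>\<omega>. diff_last (X \<omega>)) \<in> M \<rightarrow>\<^sub>M reduced_borel"
  by (rule measurable_compose[OF assms measurable_diff_last])

lemma reduced_component_measurable [measurable]:
  "(\<lambda>y. y i) \<in> borel_measurable (reduced_borel :: ('n::{finite,linorder} \<Rightarrow> real) measure)"
  if "i \<in> reduced_indices" for i :: "'n::{finite,linorder}"
  unfolding reduced_borel_def using that by measurable

lemma reduced_sum_measurable:
  assumes "\<And>i. i \<in> reduced_indices \<Longrightarrow> f i \<in> borel_measurable borel"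
  shows "(\<lambda>y. \<Sum>i\<in>reduced_indices. f i (y i) :: real) \<in> borel_measurable (reduced_borel :: ('n::{finite,linorder} \<Rightarrow> real) measure)"
  using assms by (intro borel_measurable_sum measurable_compose[OF reduced_component_measurable]) auto

lemma integral_tilted_law:
  fixes f :: "('n::{finite,linorder} \<Rightarrow> real) \<Rightarrow> 'b::{banach, second_countable_topology}"
  assumes [measurable]: "X \<in> borel_measurable M" "f \<in> borel_measurable reduced_borel"
  shows "integral\<^sup>L (tilted_law M X) f = (\<integral>\<omega>. exp (X \<omega> $ last_index) *\<^sub>R f (diff_last (X \<omega>)) \<partial>M)"
    and "integrable (tilted_law M X) f \<longleftrightarrow> integrable M (\<lambda>\<omega>. exp (X \<omega> $ last_index) *\<^sub>R f (diff_last (X \<omega>)))"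
  unfolding tilted_law_def by (simp_all add: integral_distr integral_density integrable_distr_eq integrable_density)

lemma finite_measure_tilted_law:
  assumes [measurable]: "X \<in> borel_measurable M" and int: "integrable M (\<lambda>\<omega>. exp (X \<omega> $ last_index))"
  shows "finite_measure (tilted_law M X)"
proof
  have "emeasure (tilted_law M X) (space (tilted_law M X)) = (\<integral>\<^sup>+y. 1 \<partial>tilted_law M X)"
    by simp
  also have "\<dots> = (\<integral>\<^sup>+\<omega>. ennreal (exp (X \<omega> $ last_index)) \<partial>M)"
    unfolding tilted_law_def by (subst nn_integral_distr) (auto simp: emeasure_density nn_set_integral_space)
  also have "\<dots> < \<infinity>" using int by (simp add: integrable_iff_bounded)
  finally show "emeasure (tilted_law M X) (space (tilted_law M X)) \<noteq> \<infinity>" by simp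
qed

lemma char_tilted_law:
  assumes X [measurable]: "X \<in> borel_measurable M"
  shows "(CLINT y|tilted_law M X. iexp (\<Sum>i\<in>reduced_indices. v i * y i))
    = (CLINT \<omega>|M. exp (clin 1 last_index (lift v) (X \<omega>)))"
proof -
  have "(\<lambda>y. \<Sum>i\<in>reduced_indices. v i * y i) \<in> borel_measurable reduced_borel"
    by (rule reduced_sum_measurable) simp
  from measurable_compose[OF this, of iexp borel]
  have "(\<lambda>y. iexp (\<Sum>i\<in>reduced_indices. v i * y i)) \<in> borel_measurable reduced_borel" by simp
  then show ?thesis
    unfolding integral_tilted_law(1)[OF X]
    by (subst integral_tilted_law(1)[OF X])
       (simp_all add: clin_def inner_lift exp_add scaleR_conv_of_real exp_of_real)
qed

lemma tilted_law_eq_if_char_eq: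
  assumes "X \<in> borel_measurable M" "integrable M (\<lambda>\<omega>. exp (X \<omega> $ last_index))"
    and fin: "finite_measure Q" and sets: "sets Q = sets reduced_borel"
    and eq: "\<And>v. (CLINT \<omega>|M. exp (clin 1 last_index (lift v) (X \<omega>))) = (CLINT y|Q. iexp (\<Sum>i\<in>reduced_indices. v i * y i))"
  shows "tilted_law M X = Q"
proof (rule measure_PiM_eq_if_char_eq[of reduced_indices])
  show "sets (tilted_law M X) = sets (Pi\<^sub>M reduced_indices (\<lambda>i. borel))" "sets Q = sets (Pi\<^sub>M reduced_indices (\<lambda>i. borel))"
    using sets by (simp_all add: reduced_borel_def)
  show "(CLINT y|tilted_law M X. iexp (\<Sum>i\<in>reduced_indices. v i * y i)) = (CLINT y|Q. iexp (\<Sum>i\<in>reduced_indices. v i * y i))" for v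
    using eq char_tilted_law[OF assms(1)] by simp
qed (use assms finite_measure_tilted_law in auto)

text \<open>The factorisation behind the choice of \<open>tilted_law\<close>: after taking absolute
  values, the positive factor is exactly its density.\<close>

lemma exp_vec_inner:
  fixes u x :: "real ^ 'n::{finite,linorder}"
  shows "u \<bullet> exp_vec x = exp (x $ last_index) * ((\<Sum>i\<in>reduced_indices. u $ i * exp (diff_last x i)) + u $ last_index)"
proof -
  have "exp (x $ last_index) * (u $ i * exp (diff_last x i)) = u $ i * exp (x $ i)" if "i \<in> reduced_indices" for i
    using that by (simp add: diff_last_def exp_diff)
  then have "exp (x $ last_index) * (\<Sum>i\<in>reduced_indices. u $ i * exp (diff_last x i)) = (\<Sum>i\<in>reduced_indices. u $ i * exp (x $ i))"
    unfolding sum_distrib_left by (rule sum.cong[OF refl])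
  then show ?thesis
    by (simp add: inner_vec_def exp_vec_def sum_UNIV_last_index distrib_left)
qed

lemma abs_moment_eq_integral_tilted_law:
  fixes u :: "real ^ 'n::{finite,linorder}"
  assumes X: "X \<in> borel_measurable M"
  shows "(\<integral>\<omega>. \<bar>u \<bullet> exp_vec (X \<omega>)\<bar> \<partial>M)
    = (\<integral>y. \<bar>(\<Sum>i\<in>reduced_indices. u $ i * exp (y i)) + u $ last_index\<bar> \<partial>tilted_law M X)"
proof -
  have "(\<lambda>y. \<Sum>i\<in>reduced_indices. u $ i * exp (y i)) \<in> borel_measurable reduced_borel"
    by (rule reduced_sum_measurable) simp
  then show ?thesis
    by (subst integral_tilted_law(1)[OF X]) (simp_all add: exp_vec_inner abs_mult)
qed

text \<open>The absolute moments are integrals of |S v - t| over \<open>Q\<close>, so they fix the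
  law of every linear combination \<open>S v\<close> of the exponentials exp y_i. These laws give
  all characteristic functions of the vector of exponentials.\<close>

lemma zonoid_equivalent_exp_iff:
  fixes X :: "'a \<Rightarrow> real ^ 'n::{finite,linorder}" and X' :: "'b \<Rightarrow> real ^ 'n::{finite,linorder}"
  assumes X [measurable]: "X \<in> borel_measurable M" and X' [measurable]: "X' \<in> borel_measurable M'"
    and int: "integrable M (\<lambda>\<omega>. exp_vec (X \<omega>))" and int': "integrable M' (\<lambda>\<omega>. exp_vec (X' \<omega>))"
  shows "zonoid_equivalent M (\<lambda>\<omega>. exp_vec (X \<omega>)) M' (\<lambda>\<omega>. exp_vec (X' \<omega>)) \<longleftrightarrow> tilted_law M X = tilted_law M' X'"
proof
  assume "tilted_law M X = tilted_law M' X'"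
  then show "zonoid_equivalent M (\<lambda>\<omega>. exp_vec (X \<omega>)) M' (\<lambda>\<omega>. exp_vec (X' \<omega>))"
    unfolding zonoid_equivalent_def using int int' by (simp add: abs_moment_eq_integral_tilted_law[OF X] abs_moment_eq_integral_tilted_law[OF X'])
next
  assume "zonoid_equivalent M (\<lambda>\<omega>. exp_vec (X \<omega>)) M' (\<lambda>\<omega>. exp_vec (X' \<omega>))"
  then have zonoid: "(\<integral>\<omega>. \<bar>u \<bullet> exp_vec (X \<omega>)\<bar> \<partial>M) = (\<integral>\<omega>. \<bar>u \<bullet> exp_vec (X' \<omega>)\<bar> \<partial>M')" for u
    by (simp add: zonoid_equivalent_def)
  define Q Q' where "Q = tilted_law M X" and "Q' = tilted_law M' X'"
  have int_i: "integrable N (\<lambda>\<omega>. exp (Z \<omega> $ i))" if "integrable N (\<lambda>\<omega>. exp_vec (Z \<omega>))" for N :: "'c measure" and Z :: "'c \<Rightarrow> real ^ 'n::{finite,linorder}" and i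
  proof -
    have "integrable N (\<lambda>\<omega>. exp_vec (Z \<omega>) \<bullet> axis i 1)"
      using that by (rule integrable_inner_left[rotated])
    then show ?thesis by (simp add: inner_axis exp_vec_def)
  qed
  have fin: "finite_measure Q" "finite_measure Q'"
    unfolding Q_def Q'_def by (intro finite_measure_tilted_law X X' int_i int int')+
  interpret Q: finite_measure Q by (rule fin)
  interpret Q': finite_measure Q' by (rule fin)
  have sets_Q [measurable_cong]: "sets Q = sets reduced_borel" "sets Q' = sets reduced_borel"
    by (simp_all add: Q_def Q'_def)
  define S where "S v y = (\<Sum>i\<in>reduced_indices. v i * exp (y i))" for v and y :: "'n \<Rightarrow> real"
  have S_meas [measurable]: "S v \<in> borel_measurable reduced_borel" for v
    unfolding S_def[abs_def] by (rule reduced_sum_measurable) simp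
  have S_int: "integrable (tilted_law N Z) (S v)" if [measurable]: "Z \<in> borel_measurable N" and "integrable N (\<lambda>\<omega>. exp_vec (Z \<omega>))"
    for N :: "'c measure" and Z :: "'c \<Rightarrow> real ^ 'n::{finite,linorder}" and v
  proof -
    have "exp (x $ last_index) *\<^sub>R S v (diff_last x) = (\<Sum>i\<in>reduced_indices. v i * exp (x $ i))" for x
      unfolding S_def real_scaleR_def sum_distrib_left by (intro sum.cong) (auto simp: diff_last_def exp_diff)
    then show ?thesis
      using int_i[OF that(2)] by (simp add: integral_tilted_law(2)[OF that(1) S_meas])
  qed
  have abs_eq: "(\<integral>y. \<bar>S v y - t\<bar> \<partial>Q) = (\<integral>y. \<bar>S v y - t\<bar> \<partial>Q')" for v t
  proof -
    \<comment> \<open>The last coordinate of u is the constant term of the affine function, so it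
      carries the level as - t.\<close>
    define u where "u = (\<chi> i. if i = last_index then - t else v i)"
    have "(\<Sum>i\<in>reduced_indices. u $ i * exp (y i)) = S v y" for y
      unfolding S_def u_def by (intro sum.cong) auto
    moreover have "u $ last_index = - t" by (simp add: u_def)
    ultimately show ?thesis
      using zonoid[of u]
      by (simp only: abs_moment_eq_integral_tilted_law[OF X] abs_moment_eq_integral_tilted_law[OF X'] Q_def Q'_def
          add_uminus_conv_diff)
  qed
  \<comment> \<open>With v = 0 and t = 1 the integrand is the constant 1.\<close>
  have "measure Q (space Q) = measure Q' (space Q')"
    using abs_eq[of "\<lambda>_. 0" 1] by (simp add: S_def)
  then have S_law: "distr Q borel (S v) = distr Q' borel (S v)" for v
    using fin abs_eq unfolding Q_def Q'_def
    by (intro finite_measure_eq_if_abs_moments_eq S_int X X' int int')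
  \<comment> \<open>The combinations \<open>S v\<close> are linear in exp y_i and not in y_i, so the
    laws are compared after \<open>ex\<close> and brought back by its inverse
    \<open>lg\<close>.\<close>
  define ex where "ex y = (\<lambda>i\<in>reduced_indices. exp (y i))" for y :: "'n \<Rightarrow> real"
  define lg where "lg y = (\<lambda>i\<in>reduced_indices. ln (y i))" for y :: "'n \<Rightarrow> real"
  have [measurable]: "ex \<in> reduced_borel \<rightarrow>\<^sub>M reduced_borel" "lg \<in> reduced_borel \<rightarrow>\<^sub>M reduced_borel"
    unfolding ex_def[abs_def] lg_def[abs_def] reduced_borel_def
    by (auto intro!: measurable_restrict measurable_compose[OF measurable_component_singleton])
  have "distr Q reduced_borel ex = distr Q' reduced_borel ex"
  proof (rule measure_PiM_eq_if_char_eq[of reduced_indices])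
    show "finite_measure (distr Q reduced_borel ex)" "finite_measure (distr Q' reduced_borel ex)"
      by (auto intro!: Q.finite_measure_distr Q'.finite_measure_distr)
    have "(CLINT y|distr N reduced_borel ex. iexp (\<Sum>i\<in>reduced_indices. v i * y i)) = (CLINT s|distr N borel (S v). iexp s)"
      if [measurable_cong]: "sets N = sets reduced_borel" for N v
    proof -
      have "(\<lambda>y. \<Sum>i\<in>reduced_indices. v i * y i) \<in> borel_measurable reduced_borel"
        by (rule reduced_sum_measurable) simp
      from measurable_compose[OF this, of iexp borel]
      have "(\<lambda>y. iexp (\<Sum>i\<in>reduced_indices. v i * y i)) \<in> borel_measurable reduced_borel" by simp
      then have "(CLINT y|distr N reduced_borel ex. iexp (\<Sum>i\<in>reduced_indices. v i * y i)) = (CLINT y|N. iexp (\<Sum>i\<in>reduced_indices. v i * ex y i))"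
        by (intro integral_distr) measurable
      also have "(\<lambda>y. \<Sum>i\<in>reduced_indices. v i * ex y i) = S v"
        unfolding S_def ex_def by (intro ext sum.cong) auto
      then have "(CLINT y|N. iexp (\<Sum>i\<in>reduced_indices. v i * ex y i)) = (CLINT y|N. iexp (S v y))"
        by (simp only: fun_eq_iff)
      also have "\<dots> = (CLINT s|distr N borel (S v). iexp s)"
        by (subst integral_distr) auto
      finally show ?thesis .
    qed
    then show "(CLINT y|distr Q reduced_borel ex. iexp (\<Sum>i\<in>reduced_indices. v i * y i)) = (CLINT y|distr Q' reduced_borel ex. iexp (\<Sum>i\<in>reduced_indices. v i * y i))" for v
      using sets_Q S_law by simp
  qed (auto simp: reduced_borel_def)
  then have "distr (distr Q reduced_borel ex) reduced_borel lg = distr (distr Q' reduced_borel ex) reduced_borel lg"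
    by simp
  moreover have "distr (distr N reduced_borel ex) reduced_borel lg = N" if [measurable_cong]: "sets N = sets reduced_borel" for N
  proof -
    have "lg (ex y) = y" if "y \<in> space N" for y
      using that sets_eq_imp_space_eq[OF \<open>sets N = _\<close>]
      by (auto simp: lg_def ex_def reduced_borel_def space_PiM PiE_iff extensional_def fun_eq_iff)
    then have "distr N reduced_borel (lg \<circ> ex) = distr N N id"
      by (intro distr_cong) (auto simp: that)
    then show ?thesis by (simp add: distr_distr id_def)
  qed
  ultimately show "tilted_law M X = tilted_law M' X'"
    using sets_Q unfolding Q_def Q'_def by simp
qed

section \<open>Levy triplets of tilted differences\<close>

text \<open>Infinite descent: m is even, and m = 2 k gives the same equation for n and k with k <
  n.\<close>

lemma square_eq_twice_square_nat:
  fixes m n :: nat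
  assumes "m\<^sup>2 = 2 * n\<^sup>2"
  shows "n = 0"
  using assms
proof (induction n arbitrary: m rule: less_induct)
  case (less n)
  show ?case
  proof (rule ccontr)
    assume n: "n \<noteq> 0"
    have "even (m\<^sup>2)" using less.prems by simp
    then obtain k where m: "m = 2 * k" by auto
    then have eq: "n\<^sup>2 = 2 * k\<^sup>2" using less.prems by (simp add: power_mult_distrib)
    have "k < n"
    proof (rule ccontr)
      assume "\<not> k < n"
      then have "n\<^sup>2 \<le> k\<^sup>2" by (intro power_mono) auto
      moreover have "0 < n\<^sup>2" using n by simp
      ultimately show False using eq by linarith
    qed
    then have "k = 0" using less.IH eq by blast
    then show False using eq n by simp
  qed
qed

text \<open>The periods of \<open>cos y\<close> and \<open>cos (sqrt 2 * y)\<close> are incommensurable.\<close>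
lemma cos_incommensurable:
  assumes "cos y = 1" "cos (sqrt 2 * y) = 1"
  shows "y = 0"
proof -
  obtain k m :: int where k: "y = of_int k * 2 * pi" and m: "sqrt 2 * y = of_int m * 2 * pi"
    using assms unfolding cos_one_2pi_int by blast
  have "of_int m = sqrt 2 * of_int k"
    using m unfolding k by (simp add: field_simps)
  then have "(of_int m :: real)\<^sup>2 = 2 * (of_int k)\<^sup>2" by (simp add: power_mult_distrib)
  then have "m\<^sup>2 = 2 * k\<^sup>2" by (metis (mono_tags) of_int_eq_iff of_int_mult of_int_numeral of_int_power)
  then have "(nat \<bar>m\<bar>)\<^sup>2 = 2 * (nat \<bar>k\<bar>)\<^sup>2"
    by (metis abs_ge_zero nat_mult_distrib nat_numeral nat_power_eq power2_abs zero_le_numeral)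
  then have "nat \<bar>k\<bar> = 0" by (rule square_eq_twice_square_nat)
  then show ?thesis using k by simp
qed

section \<open>The exponent of the law of differences\<close>

locale reduced_levy_vector = exp_integrable_levy_vector M \<xi> A \<nu> b
  for M :: "'a measure" and \<xi> :: "'a \<Rightarrow> real ^ 'n::{finite,linorder}"
    and A :: "real ^ 'n::{finite,linorder} ^ 'n::{finite,linorder}" and \<nu> b
begin

lemma finite_measure_law: "finite_measure (tilted_law M \<xi>)"
  by (rule finite_measure_tilted_law[OF \<xi>_measurable exp_integrable])

lemma char_law: "(CLINT y|tilted_law M \<xi>. iexp (\<Sum>i\<in>reduced_indices. v i * y i)) = exp (levy_log 1 last_index (lift v))"
  unfolding char_tilted_law[OF \<xi>_measurable] by (rule tilted_char_eq)

lemma continuous_levy_log: "continuous_on UNIV (\<lambda>w. levy_log 1 j w)"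
proof -
  have "continuous_on (ball 0 R) (\<lambda>w. CLINT x|\<nu>. levy_integrand 1 j w x)" for R
  proof (rule continuous_on_parametric_integral)
    let ?R = "1 + R"
    show "continuous_on (ball 0 R) (\<lambda>w. levy_integrand 1 j w x)" for x
      unfolding levy_integrand_def clin_def by (intro continuous_intros)
    show "levy_integrand 1 j w \<in> borel_measurable \<nu>" for w by measurable
    show "integrable \<nu> (\<lambda>x. (exp ?R * ?R\<^sup>2 + 2) * min ((norm x)\<^sup>2) 1 + indicat_real {x. 1 < norm x} x * exp (x $ j))"
      by (rule integrable_levy_bound)
    show "cmod (levy_integrand 1 j w x) \<le> (exp ?R * ?R\<^sup>2 + 2) * min ((norm x)\<^sup>2) 1 + indicat_real {x. 1 < norm x} x * exp (x $ j)"
      if "w \<in> ball 0 R" for w x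
      using that by (intro norm_levy_integrand_le) auto
  qed
  then have "continuous (at w) (\<lambda>w. CLINT x|\<nu>. levy_integrand 1 j w x)" for w
    by (rule continuous_on_interior[where S="ball 0 (norm w + 1)"]) (auto simp: interior_open)
  then have cont: "continuous_on UNIV (\<lambda>w. CLINT x|\<nu>. levy_integrand 1 j w x)"
    by (simp add: continuous_on_eq_continuous_at)
  have "continuous_on UNIV (\<lambda>w. A *v w)"
    by (intro linear_continuous_on matrix_vector_mul_bounded_linear)
  then show ?thesis
    unfolding levy_log_def using cont by (intro continuous_intros) simp_all
qed

text \<open>Step 1 at t = 0 is enough: scaling W changes the step and V moves the base point. The
  mixed terms of the Gaussian part with the tilt and with V are affine in t and vanish.\<close>

lemma second_differences:
  fixes V W :: "real ^ 'n::{finite,linorder}"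
  shows "integrable \<nu> (\<lambda>x. exp (clin 1 j V x) * of_real (1 - cos (W \<bullet> x)))"
    and "second_diff 1 (\<lambda>t. levy_log 1 j (V + t *\<^sub>R W)) 0 = of_real (W \<bullet> (A *v W)) / 2 + (CLINT x|\<nu>. exp (clin 1 j V x) * of_real (1 - cos (W \<bullet> x)))"
    and "integrable \<nu> (\<lambda>x. exp (clin 1 j V x) * of_real ((1 - cos (W \<bullet> x))\<^sup>2))"
    and "second_diff 1 (second_diff 1 (\<lambda>t. levy_log 1 j (V + t *\<^sub>R W))) 0 = (CLINT x|\<nu>. exp (clin 1 j V x) * of_real ((1 - cos (W \<bullet> x))\<^sup>2))"
proof -
  define ind where "ind x = complex_of_real (indicat_real {x. norm x \<le> 1} x)" for x :: "real ^ 'n::{finite,linorder}"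
  define k where "k x = 1 + clin 1 j V x * ind x" for x
  define l where "l x = \<i> * of_real (W \<bullet> x) * ind x" for x
  have integrand: "levy_integrand 1 j (V + t *\<^sub>R W) x = exp (clin 1 j V x) * iexp (t * (W \<bullet> x)) - k x - of_real t * l x" for t x
  proof -
    have "clin 1 j (V + t *\<^sub>R W) x = clin 1 j V x + \<i> * of_real (t * (W \<bullet> x))"
      by (simp add: clin_def inner_add_left algebra_simps)
    then show ?thesis
      by (simp add: levy_integrand_def k_def l_def ind_def exp_add algebra_simps)
  qed
  have int: "integrable \<nu> (\<lambda>x. exp (clin 1 j V x) * iexp (t * (W \<bullet> x)) - k x - of_real t * l x)" for t
    unfolding integrand[symmetric] by (rule integrable_levy_integrand) auto
  define p where "p = of_real (b $ j) + \<i> * of_real (b \<bullet> V) + (of_real (A $ j $ j) + 2 * \<i> * of_real ((A *v V) $ j) - of_real (V \<bullet> (A *v V))) / 2"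
  define q where "q = \<i> * of_real (b \<bullet> W) + (2 * \<i> * of_real ((A *v W) $ j) - of_real (V \<bullet> (A *v W) + W \<bullet> (A *v V))) / 2"
  define r where "r = - complex_of_real (W \<bullet> (A *v W)) / 2"
  have G: "levy_log 1 j (V + t *\<^sub>R W) = p + q * of_real t + r * of_real (t\<^sup>2) + (CLINT x|\<nu>. exp (clin 1 j V x) * iexp (t * (W \<bullet> x)) - k x - of_real t * l x)" for t
    unfolding levy_log_def integrand p_def q_def r_def
    by (simp add: inner_add_left inner_add_right matrix_vector_right_distrib matrix_vector_mult_scaleR power2_eq_square)
       (simp add: field_simps)
  note d1 = second_diff_affine_integral[OF int G] and d2 = second_diff2_affine_integral[OF int G]
  show "integrable \<nu> (\<lambda>x. exp (clin 1 j V x) * of_real (1 - cos (W \<bullet> x)))" using d1(1)[of 1 0] by simp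
  show "second_diff 1 (\<lambda>t. levy_log 1 j (V + t *\<^sub>R W)) 0 = of_real (W \<bullet> (A *v W)) / 2 + (CLINT x|\<nu>. exp (clin 1 j V x) * of_real (1 - cos (W \<bullet> x)))"
    using d1(2)[of 1 0] by (simp add: r_def)
  show "integrable \<nu> (\<lambda>x. exp (clin 1 j V x) * of_real ((1 - cos (W \<bullet> x))\<^sup>2))" using d2(1)[of 1 0] by simp
  show "second_diff 1 (second_diff 1 (\<lambda>t. levy_log 1 j (V + t *\<^sub>R W))) 0 = (CLINT x|\<nu>. exp (clin 1 j V x) * of_real ((1 - cos (W \<bullet> x))\<^sup>2))"
    using d2(2)[of 1 0] by simp
qed

text \<open>The image may have infinite mass at the origin, coming from points of \<nu> with equal
  coordinates. Integrands that vanish there are unaffected by its removal.\<close>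

lemma integral_reduced_levy_measure:
  fixes f :: "('n \<Rightarrow> real) \<Rightarrow> 'b::{banach, second_countable_topology}"
  assumes [measurable]: "f \<in> borel_measurable reduced_borel" and zero: "f reduced_zero = 0"
  shows "(\<integral>x. exp (x $ last_index) *\<^sub>R f (diff_last x) \<partial>\<nu>) = integral\<^sup>L (reduced_levy_measure \<nu>) f"
proof -
  let ?N = "distr (tilted \<nu>) reduced_borel diff_last"
  have [measurable]: "diff_last \<in> \<nu> \<rightarrow>\<^sub>M reduced_borel"
    using measurable_diff_last measurable_cong_sets[OF sets_\<nu> refl] by blast
  have [measurable]: "diff_last \<in> tilted \<nu> \<rightarrow>\<^sub>M reduced_borel"
    by (simp add: tilted_def)
  have "integral\<^sup>L (reduced_levy_measure \<nu>) f = (\<integral>y. indicator (space reduced_borel - {reduced_zero}) y *\<^sub>R f y \<partial>?N)"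
    unfolding reduced_levy_measure_def
    by (rule integral_restrict_space) (use sets_reduced_zero in auto)
  also have "\<dots> = (\<integral>y. f y \<partial>?N)"
    by (intro Bochner_Integration.integral_cong) (auto simp: indicator_def zero)
  also have "\<dots> = (\<integral>x. exp (x $ last_index) *\<^sub>R f (diff_last x) \<partial>\<nu>)"
    unfolding tilted_def by (simp add: integral_distr integral_density)
  finally show ?thesis by simp
qed

end

definition reduced_image :: "(real ^ 'n::{finite,linorder}) measure \<Rightarrow> ('n \<Rightarrow> real) measure" where
  "reduced_image \<nu> = distr (tilted \<nu>) reduced_borel diff_last"

lemma sets_reduced_image [simp, measurable_cong]: "sets (reduced_image \<nu>) = sets reduced_borel"
  by (simp add: reduced_image_def)

text \<open>Points of the reduced space have no last coordinate; the value 1 stands for the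
  exponential of x_d - x_d.\<close>

lemma expectation_tilted_law:
  fixes X :: "'a \<Rightarrow> real ^ 'n::{finite,linorder}"
  assumes X: "X \<in> borel_measurable M"
  shows "(\<integral>y. (if i = last_index then 1 else exp (y i)) \<partial>tilted_law M X) = (\<integral>\<omega>. exp (X \<omega> $ i) \<partial>M)"
proof -
  have "(\<lambda>y. if i = last_index then 1 else exp (y i) :: real) \<in> borel_measurable reduced_borel"
    using measurable_compose[OF reduced_component_measurable[of i], of exp borel] by (cases "i = last_index") auto
  then have "(\<integral>y. (if i = last_index then 1 else exp (y i)) \<partial>tilted_law M X)
      = (\<integral>\<omega>. exp (X \<omega> $ last_index) *\<^sub>R (if i = last_index then 1 else exp (diff_last (X \<omega>) i)) \<partial>M)"
    by (rule integral_tilted_law(1)[OF X])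
  also have "\<dots> = (\<integral>\<omega>. exp (X \<omega> $ i) \<partial>M)"
    by (intro Bochner_Integration.integral_cong) (auto simp: diff_last_def exp_diff)
  finally show ?thesis .
qed

text \<open>With a single frequency the weight would also vanish at nonzero multiples of 2 pi; by
  \<open>cos_incommensurable\<close> the two frequencies have only the origin as common
  zero.\<close>

lemma cos_weight_pos:
  fixes y :: "'n::{finite,linorder} \<Rightarrow> real"
  assumes y: "y \<in> space reduced_borel" "y \<noteq> reduced_zero"
  shows "0 < (\<Sum>i\<in>reduced_indices. (1 - cos (1 * y i))\<^sup>2 + (1 - cos (sqrt 2 * y i))\<^sup>2)"
proof -
  have "\<exists>i\<in>reduced_indices. y i \<noteq> 0"
  proof (rule ccontr)
    assume "\<not> ?thesis"
    then have "y = reduced_zero"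
      using y(1) by (auto simp: reduced_zero_def reduced_borel_def space_PiM PiE_iff extensional_def fun_eq_iff)
    then show False using y(2) by simp
  qed
  then obtain i where i: "i \<in> reduced_indices" "y i \<noteq> 0" by blast
  then have "1 - cos (y i) \<noteq> 0 \<or> 1 - cos (sqrt 2 * y i) \<noteq> 0"
    using cos_incommensurable[of "y i"] by auto
  then have "0 < (1 - cos (1 * y i))\<^sup>2 + (1 - cos (sqrt 2 * y i))\<^sup>2"
    by (simp add: sum_power2_gt_zero_iff)
  then show ?thesis
    by (intro sum_pos2[OF _ i(1)]) auto
qed

context reduced_levy_vector
begin

lemma diff_last_measurable_\<nu> [measurable]: "diff_last \<in> \<nu> \<rightarrow>\<^sub>M reduced_borel"
  using measurable_diff_last measurable_cong_sets[OF sets_\<nu> refl] by blast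

lemma diff_last_measurable_tilted [measurable]: "diff_last \<in> tilted \<nu> \<rightarrow>\<^sub>M reduced_borel"
  by (simp add: tilted_def)

text \<open>The image of the tilted Levy measure can be infinite near the origin; the cosine weight
  makes it accessible to uniqueness of characteristic functions.\<close>

lemma finite_cos_weighted_image:
  fixes W :: "real ^ 'n::{finite,linorder}"
  assumes W: "(\<Sum>i\<in>UNIV. W $ i) = 0"
  shows "finite_measure (density (reduced_image \<nu>) (\<lambda>y. ennreal ((1 - cos (\<Sum>i\<in>reduced_indices. W $ i * y i))\<^sup>2)))"
proof
  have [measurable]: "(\<lambda>y. \<Sum>i\<in>reduced_indices. W $ i * y i) \<in> borel_measurable reduced_borel"
    by (rule reduced_sum_measurable) simp
  have "integrable \<nu> (\<lambda>x. complex_of_real (exp (x $ last_index) * (1 - cos (W \<bullet> x))\<^sup>2))"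
    using second_differences(3)[of last_index 0 W] by (simp add: clin_def exp_of_real)
  then have int: "integrable \<nu> (\<lambda>x. exp (x $ last_index) * (1 - cos (W \<bullet> x))\<^sup>2)"
    by (simp only: complex_of_real_integrable_eq)
  have "emeasure (density (reduced_image \<nu>) (\<lambda>y. ennreal ((1 - cos (\<Sum>i\<in>reduced_indices. W $ i * y i))\<^sup>2)))
      (space (density (reduced_image \<nu>) (\<lambda>y. ennreal ((1 - cos (\<Sum>i\<in>reduced_indices. W $ i * y i))\<^sup>2))))
    = (\<integral>\<^sup>+y. ennreal ((1 - cos (\<Sum>i\<in>reduced_indices. W $ i * y i))\<^sup>2) \<partial>reduced_image \<nu>)"
  proof -
    have "(\<lambda>y. ennreal ((1 - cos (\<Sum>i\<in>reduced_indices. W $ i * y i))\<^sup>2)) \<in> borel_measurable (reduced_image \<nu>)"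
      by measurable
    then show ?thesis by (simp only: emeasure_density sets.top space_density nn_set_integral_space)
  qed
  also have "\<dots> = (\<integral>\<^sup>+x. ennreal (exp (x $ last_index) * (1 - cos (W \<bullet> x))\<^sup>2) \<partial>\<nu>)"
    unfolding reduced_image_def
    by (subst nn_integral_distr)
       (simp_all add: tilted_def nn_integral_density inner_eq_inner_diff_last[OF W] ennreal_mult)
  also have "\<dots> < \<infinity>" using int by (simp add: integrable_iff_bounded)
  finally show "emeasure (density (reduced_image \<nu>) (\<lambda>y. ennreal ((1 - cos (\<Sum>i\<in>reduced_indices. W $ i * y i))\<^sup>2)))
      (space (density (reduced_image \<nu>) (\<lambda>y. ennreal ((1 - cos (\<Sum>i\<in>reduced_indices. W $ i * y i))\<^sup>2)))) \<noteq> \<infinity>"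
    by simp
qed

lemma char_cos_weighted_image:
  fixes W :: "real ^ 'n::{finite,linorder}"
  assumes W: "(\<Sum>i\<in>UNIV. W $ i) = 0"
  shows "(CLINT y|density (reduced_image \<nu>) (\<lambda>y. ennreal ((1 - cos (\<Sum>i\<in>reduced_indices. W $ i * y i))\<^sup>2)). iexp (\<Sum>i\<in>reduced_indices. v i * y i))
    = (CLINT x|\<nu>. exp (clin 1 last_index (lift v) x) * of_real ((1 - cos (W \<bullet> x))\<^sup>2))"
proof -
  have sum_meas: "(\<lambda>y. \<Sum>i\<in>reduced_indices. w i * y i) \<in> borel_measurable reduced_borel" for w :: "'n \<Rightarrow> real"
    by (rule reduced_sum_measurable) simp
  note [measurable] = sum_meas[of "\<lambda>i. W $ i"]
  from measurable_compose[OF sum_meas, of iexp borel]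
  have [measurable]: "(\<lambda>y. iexp (\<Sum>i\<in>reduced_indices. v i * y i)) \<in> borel_measurable reduced_borel" by simp
  have "(CLINT y|density (reduced_image \<nu>) (\<lambda>y. ennreal ((1 - cos (\<Sum>i\<in>reduced_indices. W $ i * y i))\<^sup>2)). iexp (\<Sum>i\<in>reduced_indices. v i * y i))
    = (CLINT y|reduced_image \<nu>. (1 - cos (\<Sum>i\<in>reduced_indices. W $ i * y i))\<^sup>2 *\<^sub>R iexp (\<Sum>i\<in>reduced_indices. v i * y i))"
    by (rule integral_density) simp_all
  also have "\<dots> = (CLINT x|tilted \<nu>. (1 - cos (\<Sum>i\<in>reduced_indices. W $ i * diff_last x i))\<^sup>2 *\<^sub>R iexp (\<Sum>i\<in>reduced_indices. v i * diff_last x i))"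
    unfolding reduced_image_def by (rule integral_distr) measurable
  also have "\<dots> = (CLINT x|tilted \<nu>. (1 - cos (W \<bullet> x))\<^sup>2 *\<^sub>R iexp (lift v \<bullet> x))"
    unfolding inner_eq_inner_diff_last[OF W] inner_lift ..
  also have "\<dots> = (CLINT x|\<nu>. exp (x $ last_index) *\<^sub>R ((1 - cos (W \<bullet> x))\<^sup>2 *\<^sub>R iexp (lift v \<bullet> x)))"
    unfolding tilted_def by (rule integral_density) simp_all
  also have "\<dots> = (CLINT x|\<nu>. exp (clin 1 last_index (lift v) x) * of_real ((1 - cos (W \<bullet> x))\<^sup>2))"
    by (intro Bochner_Integration.integral_cong) (simp_all add: clin_def exp_add exp_of_real scaleR_conv_of_real)
  finally show ?thesis .
qed

text \<open>A single second difference retains the Gaussian part, which can thus be read off once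
  the jump part is determined.\<close>

lemma second_diff_eq_reduced:
  fixes W :: "real ^ 'n::{finite,linorder}"
  assumes W: "(\<Sum>i\<in>UNIV. W $ i) = 0"
  shows "second_diff 1 (\<lambda>t. levy_log 1 last_index (t *\<^sub>R W)) 0
    = of_real (W \<bullet> (A *v W)) / 2 + (CLINT y|reduced_levy_measure \<nu>. of_real (1 - cos (\<Sum>i\<in>reduced_indices. W $ i * y i)))"
proof -
  have [measurable]: "(\<lambda>y. \<Sum>i\<in>reduced_indices. W $ i * y i) \<in> borel_measurable reduced_borel"
    by (rule reduced_sum_measurable) simp
  have "(CLINT x|\<nu>. exp (x $ last_index) *\<^sub>R complex_of_real (1 - cos (\<Sum>i\<in>reduced_indices. W $ i * diff_last x i)))
      = (CLINT y|reduced_levy_measure \<nu>. of_real (1 - cos (\<Sum>i\<in>reduced_indices. W $ i * y i)))"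
    by (rule integral_reduced_levy_measure) (simp_all add: reduced_zero_def)
  then show ?thesis
    using second_differences(2)[of last_index 0 W]
    by (simp only: add_0_left clin_def inner_zero_left of_real_0 mult_zero_right mult_1_left add_0_right exp_of_real
        scaleR_conv_of_real inner_eq_inner_diff_last[OF W])
qed

text \<open>The cut-off at norm 1 is not a function of the differences, so the compensator is
  changed to \<open>sin (diff_last x i)\<close>, which is. The integral collects the cost of this
  change, and the entries of \<open>A\<close> come from the tilt of the Gaussian part.\<close>

definition drift :: "'n \<Rightarrow> real" where
  "drift i = diff_last b i + diff_last (A $ last_index) i
     + (\<integral>x. exp (x $ last_index) * sin (diff_last x i) - diff_last x i * indicat_real {x. norm x \<le> 1} x \<partial>\<nu>)"

text \<open>A Levy-Khintchine formula for the differences: apart from the log-mass and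
  \<open>drift\<close>, only the quadratic form on zero-sum vectors and the reduced Levy measure
  enter.\<close>

lemma levy_log_reduced:
  fixes W :: "real ^ 'n::{finite,linorder}"
  assumes W: "(\<Sum>i\<in>UNIV. W $ i) = 0"
  shows "levy_log 1 last_index W = of_real (levy_exponent A \<nu> b last_index)
      + \<i> * of_real (\<Sum>i\<in>reduced_indices. W $ i * drift i) - of_real (W \<bullet> (A *v W)) / 2
      + (CLINT y|reduced_levy_measure \<nu>. iexp (\<Sum>i\<in>reduced_indices. W $ i * y i) - 1
            - \<i> * of_real (\<Sum>i\<in>reduced_indices. W $ i * sin (y i)))"
proof -
  define F where "F y = iexp (\<Sum>i\<in>reduced_indices. W $ i * y i) - 1 - \<i> * of_real (\<Sum>i\<in>reduced_indices. W $ i * sin (y i))" for y :: "'n \<Rightarrow> real"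
  define ind where "ind x = indicat_real {x. norm x \<le> 1} x" for x :: "real ^ 'n::{finite,linorder}"
  define \<kappa> where "\<kappa> i x = exp (x $ last_index) * sin (diff_last x i) - diff_last x i * ind x" for i and x :: "real ^ 'n::{finite,linorder}"
  have [measurable]: "(\<lambda>y. \<Sum>i\<in>reduced_indices. W $ i * y i) \<in> borel_measurable reduced_borel"
    "(\<lambda>y. \<Sum>i\<in>reduced_indices. W $ i * sin (y i)) \<in> borel_measurable reduced_borel"
    by (rule reduced_sum_measurable, simp)+
  have F_meas: "F \<in> borel_measurable reduced_borel"
    unfolding F_def[abs_def] by measurable
  have int: "integrable \<nu> (levy_integrand 1 j w)" for j w
    by (rule integrable_levy_integrand) auto
  \<comment> \<open>Each \<kappa> i is the imaginary part of a Levy integrand with z = 1 and w the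
    lift of a unit vector, so its integrability is already available.\<close>
  have int_\<kappa>: "integrable \<nu> (\<kappa> i)" if i: "i \<in> reduced_indices" for i
  proof -
    let ?w = "lift (\<lambda>k. if k = i then 1 else 0)"
    have "?w \<bullet> x = diff_last x i" for x
      unfolding inner_lift using i by (simp add: if_distrib[of "\<lambda>r. r * _"] cong: if_cong)
    then have "\<kappa> i x = Im (levy_integrand 1 last_index ?w x)" for x
      by (simp add: \<kappa>_def ind_def levy_integrand_def clin_def Im_exp)
    then have "\<kappa> i = (\<lambda>x. Im (levy_integrand 1 last_index ?w x))" by (rule ext)
    then show ?thesis using integrable_Im[OF int] by simp
  qed
  have split: "levy_integrand 1 last_index W x
      = levy_integrand 1 last_index 0 x + exp (x $ last_index) *\<^sub>R F (diff_last x) + \<i> * of_real (\<Sum>i\<in>reduced_indices. W $ i * \<kappa> i x)" for x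
  proof -
    define S T where "S = (\<Sum>i\<in>reduced_indices. W $ i * \<kappa> i x)" and "T = (\<Sum>i\<in>reduced_indices. W $ i * sin (diff_last x i))"
    have S_eq: "S = exp (x $ last_index) * T - (W \<bullet> x) * ind x"
      unfolding S_def T_def inner_eq_inner_diff_last[OF W] \<kappa>_def sum_distrib_left sum_distrib_right sum_subtractf[symmetric]
      by (intro sum.cong) (auto simp: algebra_simps)
    have F_eq: "F (diff_last x) = iexp (W \<bullet> x) - 1 - \<i> * of_real T"
      by (simp only: F_def T_def inner_eq_inner_diff_last[OF W])
    show ?thesis
      unfolding S_def[symmetric] S_eq F_eq
      by (simp add: levy_integrand_def clin_def ind_def exp_add exp_of_real scaleR_conv_of_real algebra_simps)
  qed
  have int_sum: "integrable \<nu> (\<lambda>x. \<Sum>i\<in>reduced_indices. W $ i * \<kappa> i x)"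
    by (intro Bochner_Integration.integrable_sum integrable_mult_right int_\<kappa>)
  then have int_sum': "integrable \<nu> (\<lambda>x. \<i> * complex_of_real (\<Sum>i\<in>reduced_indices. W $ i * \<kappa> i x))"
    by (intro integrable_mult_right integrable_of_real)
  have "integrable \<nu> (\<lambda>x. levy_integrand 1 last_index W x - levy_integrand 1 last_index 0 x - \<i> * of_real (\<Sum>i\<in>reduced_indices. W $ i * \<kappa> i x))"
    by (intro Bochner_Integration.integrable_diff int int_sum')
  \<comment> \<open>Obtained as a difference of integrable functions, which avoids a separate
    estimate of \<open>F\<close> near the origin.\<close>
  then have int_F: "integrable \<nu> (\<lambda>x. exp (x $ last_index) *\<^sub>R F (diff_last x))"
    by (simp add: split)
  have F_int: "(CLINT x|\<nu>. exp (x $ last_index) *\<^sub>R F (diff_last x)) = integral\<^sup>L (reduced_levy_measure \<nu>) F"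
    by (rule integral_reduced_levy_measure[OF F_meas]) (simp add: F_def reduced_zero_def)
  have "(CLINT x|\<nu>. levy_integrand 1 last_index W x) = (CLINT x|\<nu>. levy_integrand 1 last_index 0 x)
      + (CLINT x|\<nu>. exp (x $ last_index) *\<^sub>R F (diff_last x)) + (CLINT x|\<nu>. \<i> * of_real (\<Sum>i\<in>reduced_indices. W $ i * \<kappa> i x))"
    unfolding split using int[of last_index 0] int_F int_sum'
    by (simp only: Bochner_Integration.integral_add Bochner_Integration.integrable_add)
  also have "(CLINT x|\<nu>. \<i> * of_real (\<Sum>i\<in>reduced_indices. W $ i * \<kappa> i x)) = \<i> * of_real (\<Sum>i\<in>reduced_indices. W $ i * (\<integral>x. \<kappa> i x \<partial>\<nu>))"
  proof -
    have "(\<integral>x. (\<Sum>i\<in>reduced_indices. W $ i * \<kappa> i x) \<partial>\<nu>) = (\<Sum>i\<in>reduced_indices. W $ i * (\<integral>x. \<kappa> i x \<partial>\<nu>))"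
      using int_\<kappa> by simp
    then show ?thesis
      by (simp only: integral_mult_right_zero integral_complex_of_real)
  qed
  finally have integral_eq: "(CLINT x|\<nu>. levy_integrand 1 last_index W x) = (CLINT x|\<nu>. levy_integrand 1 last_index 0 x)
      + integral\<^sup>L (reduced_levy_measure \<nu>) F + \<i> * of_real (\<Sum>i\<in>reduced_indices. W $ i * (\<integral>x. \<kappa> i x \<partial>\<nu>))"
    unfolding F_int .
  have sum_drift: "b \<bullet> W + (A *v W) $ last_index + (\<Sum>i\<in>reduced_indices. W $ i * (\<integral>x. \<kappa> i x \<partial>\<nu>)) = (\<Sum>i\<in>reduced_indices. W $ i * drift i)"
  proof -
    have "(A *v W) $ last_index = W \<bullet> A $ last_index"
      by (simp add: matrix_vector_mul_component inner_commute)
    then show ?thesis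
      unfolding inner_commute[of b] inner_eq_inner_diff_last[OF W] drift_def \<kappa>_def ind_def
      by (simp add: inner_eq_inner_diff_last[OF W] sum.distrib[symmetric] distrib_left)
  qed
  have lin: "\<i> * complex_of_real (\<Sum>i\<in>reduced_indices. W $ i * drift i) = \<i> * of_real (b \<bullet> W) + \<i> * of_real ((A *v W) $ last_index)
      + \<i> * of_real (\<Sum>i\<in>reduced_indices. W $ i * (\<integral>x. \<kappa> i x \<partial>\<nu>))"
    unfolding sum_drift[symmetric] of_real_add distrib_left ..
  have "levy_log 1 last_index W = levy_log 1 last_index 0 + \<i> * of_real (b \<bullet> W) + \<i> * of_real ((A *v W) $ last_index)
      - of_real (W \<bullet> (A *v W)) / 2 + integral\<^sup>L (reduced_levy_measure \<nu>) F + \<i> * of_real (\<Sum>i\<in>reduced_indices. W $ i * (\<integral>x. \<kappa> i x \<partial>\<nu>))"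
    unfolding levy_log_def integral_eq by (simp add: field_simps)
  then show ?thesis
    unfolding lin levy_log_0 F_def[abs_def, symmetric] by (simp add: algebra_simps)
qed

end

section \<open>Quadratic forms and image measures\<close>

lemma levy_gamma_eq_quadratic_form:
  assumes "transpose A = A"
  shows "levy_gamma A i j = (axis i 1 - axis j 1) \<bullet> (A *v (axis i 1 - axis j 1))"
proof -
  have comp: "axis k 1 \<bullet> (A *v axis l 1) = A $ k $ l" for k l
    by (simp add: inner_axis' matrix_vector_mul_component inner_axis)
  have "transpose A $ j $ i = A $ i $ j" by (simp add: transpose_def)
  then have "A $ i $ j = A $ j $ i" using assms by simp
  then show ?thesis
    by (simp add: levy_gamma_def matrix_vector_mult_diff_distrib inner_diff_left inner_diff_right comp)
qed

text \<open>In the double sum the terms with a_ii or a_jj contain the factor \<Sum> W_i = 0, so only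
  -2 a_ij survives. Thus the numbers \<gamma>_ij carry exactly the Gaussian information seen by
  differences.\<close>

lemma quadratic_form_eq_levy_gamma:
  fixes W :: "real ^ 'n::finite"
  assumes "(\<Sum>i\<in>UNIV. W $ i) = 0"
  shows "W \<bullet> (A *v W) = - (\<Sum>i\<in>UNIV. \<Sum>j\<in>UNIV. levy_gamma A i j * W $ i * W $ j) / 2"
proof -
  define w a where "w i = W $ i" and "a i j = A $ i $ j" for i j
  have form: "W \<bullet> (A *v W) = (\<Sum>i\<in>UNIV. \<Sum>j\<in>UNIV. a i j * w i * w j)"
    by (simp add: inner_vec_def matrix_vector_mult_def sum_distrib_left mult_ac w_def a_def)
  have gamma: "levy_gamma A i j = a i i + a j j - 2 * a i j" for i j
    by (simp add: levy_gamma_def a_def)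
  have "levy_gamma A i j * w i * w j = (a i i * w i) * w j + w i * (a j j * w j) - 2 * (a i j * w i * w j)" for i j
    by (simp add: gamma algebra_simps)
  then have "(\<Sum>i\<in>UNIV. \<Sum>j\<in>UNIV. levy_gamma A i j * w i * w j)
      = (\<Sum>i\<in>UNIV. a i i * w i) * (\<Sum>j\<in>UNIV. w j) + (\<Sum>i\<in>UNIV. w i) * (\<Sum>j\<in>UNIV. a j j * w j) - 2 * (W \<bullet> (A *v W))"
    unfolding form by (simp add: sum.distrib sum_subtractf sum_distrib_left[symmetric] sum_distrib_right[symmetric])
  moreover have "(\<Sum>j\<in>UNIV. w j) = 0" using assms by (simp add: w_def)
  ultimately show ?thesis by (simp add: w_def)
qed

lemma reduced_levy_measure_eq_if_image_eq:
  assumes eq: "\<And>B. B \<in> sets reduced_borel \<Longrightarrow> reduced_zero \<notin> B \<Longrightarrow> emeasure (reduced_image \<nu>) B = emeasure (reduced_image \<nu>') B"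
  shows "reduced_levy_measure \<nu> = reduced_levy_measure \<nu>'"
proof -
  let ?\<Omega> = "space reduced_borel - {reduced_zero}"
  have \<Omega>: "?\<Omega> \<inter> space (reduced_image N) \<in> sets (reduced_image N)" for N
    using sets_reduced_zero by (auto simp: reduced_image_def)
  show ?thesis
    unfolding reduced_levy_measure_def reduced_image_def[symmetric]
  proof (rule measure_eqI)
    show "sets (restrict_space (reduced_image \<nu>) ?\<Omega>) = sets (restrict_space (reduced_image \<nu>') ?\<Omega>)"
      by (simp add: sets_restrict_space)
    fix B assume "B \<in> sets (restrict_space (reduced_image \<nu>) ?\<Omega>)"
    then have B: "B \<in> sets reduced_borel" "B \<subseteq> ?\<Omega>"
      using sets_reduced_zero by (auto simp: sets_restrict_space)
    then have "reduced_zero \<notin> B" by blast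
    then show "emeasure (restrict_space (reduced_image \<nu>) ?\<Omega>) B = emeasure (restrict_space (reduced_image \<nu>') ?\<Omega>) B"
      using B by (simp add: emeasure_restrict_space[OF \<Omega>] eq)
  qed
qed

text \<open>Weights for single coordinates and the frequencies 1 and sqrt 2 are summed to a function
  \<open>g\<close> that is positive and finite off the origin, and then divided out.\<close>

lemma emeasure_eq_if_cos_weighted_eq:
  fixes N N' :: "('n::{finite,linorder} \<Rightarrow> real) measure"
  assumes sets: "sets N = sets reduced_borel" "sets N' = sets reduced_borel"
    and eq: "\<And>w. density N (\<lambda>y. ennreal ((1 - cos (\<Sum>i\<in>reduced_indices. w i * y i))\<^sup>2))
        = density N' (\<lambda>y. ennreal ((1 - cos (\<Sum>i\<in>reduced_indices. w i * y i))\<^sup>2))"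
    and B: "B \<in> sets reduced_borel" "reduced_zero \<notin> B"
  shows "emeasure N B = emeasure N' B"
proof -
  have coordinate [measurable]: "(\<lambda>y. ennreal ((1 - cos (s * y i))\<^sup>2)) \<in> borel_measurable reduced_borel"
    if "i \<in> reduced_indices" for s and i :: 'n
    using measurable_compose[OF reduced_component_measurable[OF that], of "\<lambda>r. ennreal ((1 - cos (s * r))\<^sup>2)" borel] by simp
  define g where "g y = (\<Sum>i\<in>reduced_indices. ennreal ((1 - cos (1 * y i))\<^sup>2) + ennreal ((1 - cos (sqrt 2 * y i))\<^sup>2))" for y :: "'n \<Rightarrow> real"
  have g_meas: "g \<in> borel_measurable reduced_borel"
    unfolding g_def[abs_def] by (intro borel_measurable_sum borel_measurable_add coordinate) auto
  have g: "0 < g y" "g y < \<infinity>" if "y \<in> B" for y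
  proof -
    have "g y = ennreal (\<Sum>i\<in>reduced_indices. (1 - cos (1 * y i))\<^sup>2 + (1 - cos (sqrt 2 * y i))\<^sup>2)"
      unfolding g_def by (subst sum_ennreal[symmetric]) auto
    moreover have "y \<in> space reduced_borel" "y \<noteq> reduced_zero"
      using that B sets.sets_into_space by blast+
    ultimately show "0 < g y" "g y < \<infinity>" using cos_weight_pos[of y] by simp_all
  qed
  have coordinate_eq: "(\<integral>\<^sup>+y. ennreal ((1 - cos (s * y i))\<^sup>2) * f y \<partial>N) = (\<integral>\<^sup>+y. ennreal ((1 - cos (s * y i))\<^sup>2) * f y \<partial>N')"
    if i: "i \<in> reduced_indices" and f: "f \<in> borel_measurable reduced_borel" for s i f
  proof -
    have weight: "(\<Sum>k\<in>reduced_indices. (if k = i then s else 0) * y k) = s * y i" for y :: "'n \<Rightarrow> real"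
      using i by (simp add: if_distrib[of "\<lambda>r. r * _"] cong: if_cong)
    have "(\<integral>\<^sup>+y. ennreal ((1 - cos (s * y i))\<^sup>2) * f y \<partial>P) = (\<integral>\<^sup>+y. f y \<partial>density P (\<lambda>y. ennreal ((1 - cos (s * y i))\<^sup>2)))"
      if [measurable_cong]: "sets P = sets reduced_borel" for P
      using f coordinate[OF i] by (intro nn_integral_density[symmetric]) (simp_all cong: measurable_cong_sets)
    then show ?thesis using eq[of "\<lambda>k. if k = i then s else 0"] sets unfolding weight by simp
  qed
  \<comment> \<open>On \<open>B\<close> the product of \<open>g\<close> and \<open>f\<close> is 1,
    so expanding \<open>g\<close> writes the measure of \<open>B\<close> as a sum of integrals
    against weighted measures.\<close>
  define f where "f y = indicator B y * inverse (g y)" for y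
  have f_meas: "f \<in> borel_measurable reduced_borel"
    unfolding f_def[abs_def] using g_meas B by measurable
  have decomposition: "emeasure P B = (\<Sum>i\<in>reduced_indices. (\<integral>\<^sup>+y. ennreal ((1 - cos (1 * y i))\<^sup>2) * f y \<partial>P) + (\<integral>\<^sup>+y. ennreal ((1 - cos (sqrt 2 * y i))\<^sup>2) * f y \<partial>P))"
    if P [measurable_cong]: "sets P = sets reduced_borel" for P
  proof -
    have meas: "(\<lambda>y. ennreal ((1 - cos (s * y i))\<^sup>2) * f y) \<in> borel_measurable P" if "i \<in> reduced_indices" for s i
      using coordinate[OF that] f_meas by (simp cong: measurable_cong_sets)
    have "emeasure P B = (\<integral>\<^sup>+y. indicator B y \<partial>P)"
      using B P by simp
    also have "\<dots> = (\<integral>\<^sup>+y. g y * f y \<partial>P)"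
    proof (rule nn_integral_cong)
      fix y
      show "indicator B y = g y * f y"
      proof (cases "y \<in> B")
        case True
        then show ?thesis using g[of y] by (simp add: f_def ennreal_divide_self[unfolded divide_ennreal_def])
      qed (simp add: f_def)
    qed
    also have "\<dots> = (\<integral>\<^sup>+y. (\<Sum>i\<in>reduced_indices. ennreal ((1 - cos (1 * y i))\<^sup>2) * f y + ennreal ((1 - cos (sqrt 2 * y i))\<^sup>2) * f y) \<partial>P)"
      unfolding g_def sum_distrib_right distrib_right ..
    also have "\<dots> = (\<Sum>i\<in>reduced_indices. \<integral>\<^sup>+y. ennreal ((1 - cos (1 * y i))\<^sup>2) * f y + ennreal ((1 - cos (sqrt 2 * y i))\<^sup>2) * f y \<partial>P)"
      by (rule nn_integral_sum) (intro borel_measurable_add meas)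
    also have "\<dots> = (\<Sum>i\<in>reduced_indices. (\<integral>\<^sup>+y. ennreal ((1 - cos (1 * y i))\<^sup>2) * f y \<partial>P) + (\<integral>\<^sup>+y. ennreal ((1 - cos (sqrt 2 * y i))\<^sup>2) * f y \<partial>P))"
      by (intro sum.cong refl nn_integral_add meas)
    finally show ?thesis .
  qed
  show ?thesis
    unfolding decomposition[OF sets(1)] decomposition[OF sets(2)]
    by (intro sum.cong refl arg_cong2[where f="(+)"] coordinate_eq f_meas)
qed

section \<open>Comparison of two vectors\<close>

locale levy_vector_pair =
  L: reduced_levy_vector M \<xi> A \<nu> b + L': reduced_levy_vector M' \<xi>' A' \<nu>' b'
  for M :: "'a measure" and \<xi> :: "'a \<Rightarrow> real ^ 'n::{finite,linorder}"
    and A :: "real ^ 'n::{finite,linorder} ^ 'n::{finite,linorder}" and \<nu> b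
    and M' :: "'b measure" and \<xi>' :: "'b \<Rightarrow> real ^ 'n::{finite,linorder}"
    and A' :: "real ^ 'n::{finite,linorder} ^ 'n::{finite,linorder}" and \<nu>' b'
begin

lemma expectation_exp_eq_iff:
  "(\<integral>\<omega>. exp (\<xi> \<omega> $ i) \<partial>M) = (\<integral>\<omega>. exp (\<xi>' \<omega> $ i) \<partial>M') \<longleftrightarrow> levy_exponent A \<nu> b i = levy_exponent A' \<nu>' b' i"
  by (simp add: L.expectation_exp L'.expectation_exp)

lemma expectation_exp_eq_if_law_eq:
  assumes "tilted_law M \<xi> = tilted_law M' \<xi>'"
  shows "(\<integral>\<omega>. exp (\<xi> \<omega> $ i) \<partial>M) = (\<integral>\<omega>. exp (\<xi>' \<omega> $ i) \<partial>M')"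
  using expectation_tilted_law[OF L.\<xi>_measurable, of i] expectation_tilted_law[OF L'.\<xi>_measurable, of i] assms by simp

text \<open>Equality of characteristic functions gives only equal exponentials. Along the ray t W
  both exponents are continuous, and at t = 0 they are real and agree by the expectations of the
  last coordinate.\<close>

lemma levy_log_eq_if_law_eq:
  fixes W :: "real ^ 'n::{finite,linorder}"
  assumes law: "tilted_law M \<xi> = tilted_law M' \<xi>'" and W: "(\<Sum>i\<in>UNIV. W $ i) = 0"
  shows "L.levy_log 1 last_index W = L'.levy_log 1 last_index W"
proof -
  have "L.levy_log 1 last_index (1 *\<^sub>R W) = L'.levy_log 1 last_index (1 *\<^sub>R W)"
  proof (rule continuous_log_unique[where t=1 and ?t0.0=0])
    show "continuous_on UNIV (\<lambda>t. L.levy_log 1 last_index (t *\<^sub>R W))"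
      by (rule continuous_on_compose2[OF L.continuous_levy_log]) (auto intro!: continuous_intros)
    show "continuous_on UNIV (\<lambda>t. L'.levy_log 1 last_index (t *\<^sub>R W))"
      by (rule continuous_on_compose2[OF L'.continuous_levy_log]) (auto intro!: continuous_intros)
    show "exp (L.levy_log 1 last_index (t *\<^sub>R W)) = exp (L'.levy_log 1 last_index (t *\<^sub>R W))" for t
    proof -
      have "lift (\<lambda>i. (t *\<^sub>R W) $ i) = t *\<^sub>R W"
        by (rule lift_components) (simp add: sum_distrib_left[symmetric] W)
      then show ?thesis
        using L.char_law[of "\<lambda>i. (t *\<^sub>R W) $ i"] L'.char_law[of "\<lambda>i. (t *\<^sub>R W) $ i"] law by simp
    qed
    show "L.levy_log 1 last_index (0 *\<^sub>R W) = L'.levy_log 1 last_index (0 *\<^sub>R W)"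
      using expectation_exp_eq_if_law_eq[OF law] expectation_exp_eq_iff
      by (simp add: L.levy_log_0 L'.levy_log_0)
  qed
  then show ?thesis by simp
qed

text \<open>The transform at v of the image with cosine weight w is the repeated second difference
  of the exponent at \<open>lift v\<close> in direction \<open>lift w\<close>, and the exponents
  coincide on zero-sum vectors.\<close>

lemma reduced_levy_measure_eq_if_law_eq:
  assumes law: "tilted_law M \<xi> = tilted_law M' \<xi>'"
  shows "reduced_levy_measure \<nu> = reduced_levy_measure \<nu>'"
proof (rule reduced_levy_measure_eq_if_image_eq, rule emeasure_eq_if_cos_weighted_eq)
  fix w :: "'n \<Rightarrow> real"
  have W: "(\<Sum>i\<in>UNIV. lift w $ i) = 0" by (rule sum_lift)
  have lift_w: "(\<Sum>i\<in>reduced_indices. lift w $ i * y i) = (\<Sum>i\<in>reduced_indices. w i * y i)" for y :: "'n \<Rightarrow> real"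
    by (intro sum.cong) (auto simp: lift_def)
  show "density (reduced_image \<nu>) (\<lambda>y. ennreal ((1 - cos (\<Sum>i\<in>reduced_indices. w i * y i))\<^sup>2))
      = density (reduced_image \<nu>') (\<lambda>y. ennreal ((1 - cos (\<Sum>i\<in>reduced_indices. w i * y i))\<^sup>2))"
  proof (rule measure_PiM_eq_if_char_eq[of reduced_indices])
    show "finite_measure (density (reduced_image \<nu>) (\<lambda>y. ennreal ((1 - cos (\<Sum>i\<in>reduced_indices. w i * y i))\<^sup>2)))"
      "finite_measure (density (reduced_image \<nu>') (\<lambda>y. ennreal ((1 - cos (\<Sum>i\<in>reduced_indices. w i * y i))\<^sup>2)))"
      using L.finite_cos_weighted_image[OF W] L'.finite_cos_weighted_image[OF W] unfolding lift_w .
    fix v :: "'n \<Rightarrow> real"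
    have "(\<lambda>t. L.levy_log 1 last_index (lift v + t *\<^sub>R lift w)) = (\<lambda>t. L'.levy_log 1 last_index (lift v + t *\<^sub>R lift w))"
      by (intro ext levy_log_eq_if_law_eq[OF law]) (simp add: sum.distrib sum_distrib_left[symmetric] sum_lift)
    then show "(CLINT y|density (reduced_image \<nu>) (\<lambda>y. ennreal ((1 - cos (\<Sum>i\<in>reduced_indices. w i * y i))\<^sup>2)). iexp (\<Sum>i\<in>reduced_indices. v i * y i))
      = (CLINT y|density (reduced_image \<nu>') (\<lambda>y. ennreal ((1 - cos (\<Sum>i\<in>reduced_indices. w i * y i))\<^sup>2)). iexp (\<Sum>i\<in>reduced_indices. v i * y i))"
      using L.char_cos_weighted_image[OF W, of v] L'.char_cos_weighted_image[OF W, of v]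
        L.second_differences(4)[of last_index "lift v" "lift w"] L'.second_differences(4)[of last_index "lift v" "lift w"]
      unfolding lift_w by simp
  qed (simp_all add: reduced_borel_def)
qed simp_all

text \<open>With the jump parts already equal, a single second difference in direction e_i - e_j
  leaves the quadratic form there, which is \<gamma>_ij.\<close>

lemma levy_gamma_eq_if_law_eq:
  assumes law: "tilted_law M \<xi> = tilted_law M' \<xi>'"
  shows "levy_gamma A i j = levy_gamma A' i j"
proof -
  define W :: "real ^ 'n::{finite,linorder}" where "W = axis i 1 - axis j 1"
  have W: "(\<Sum>i\<in>UNIV. W $ i) = 0"
    by (simp add: W_def sum_subtractf axis_def)
  have "(\<lambda>t. L.levy_log 1 last_index (t *\<^sub>R W)) = (\<lambda>t. L'.levy_log 1 last_index (t *\<^sub>R W))"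
    by (intro ext levy_log_eq_if_law_eq[OF law]) (simp add: sum_distrib_left[symmetric] W)
  then have "complex_of_real (W \<bullet> (A *v W)) / 2 = of_real (W \<bullet> (A' *v W)) / 2"
    using L.second_diff_eq_reduced[OF W] L'.second_diff_eq_reduced[OF W] reduced_levy_measure_eq_if_law_eq[OF law] by simp
  then have "W \<bullet> (A *v W) = W \<bullet> (A' *v W)" by simp
  then show ?thesis
    unfolding levy_gamma_eq_quadratic_form[OF L.A_symmetric] levy_gamma_eq_quadratic_form[OF L'.A_symmetric] W_def .
qed

text \<open>By the first two conditions the two laws agree up to a shift; the expectations exclude a shift.\<close>
lemma law_eq_if:
  assumes gamma: "\<And>i j. levy_gamma A i j = levy_gamma A' i j"
    and reduced: "reduced_levy_measure \<nu> = reduced_levy_measure \<nu>'"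
    and expectation: "\<And>i. (\<integral>\<omega>. exp (\<xi> \<omega> $ i) \<partial>M) = (\<integral>\<omega>. exp (\<xi>' \<omega> $ i) \<partial>M')"
  shows "tilted_law M \<xi> = tilted_law M' \<xi>'"
proof -
  \<comment> \<open>The drifts are the only ingredients of \<open>levy_log_reduced\<close> that the
    assumptions do not equate directly.\<close>
  define c where "c i = L.drift i - L'.drift i" for i
  have log: "L.levy_log 1 last_index (lift v) = \<i> * of_real (\<Sum>i\<in>reduced_indices. v i * c i) + L'.levy_log 1 last_index (lift v)" for v
  proof -
    have "lift v \<bullet> (A *v lift v) = lift v \<bullet> (A' *v lift v)"
      unfolding quadratic_form_eq_levy_gamma[OF sum_lift] gamma ..
    moreover have "levy_exponent A \<nu> b last_index = levy_exponent A' \<nu>' b' last_index"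
      using expectation expectation_exp_eq_iff by blast
    moreover have "(\<Sum>i\<in>reduced_indices. lift v $ i * d i) = (\<Sum>i\<in>reduced_indices. v i * d i)" for d :: "'n \<Rightarrow> real"
      by (intro sum.cong) (auto simp: lift_def)
    moreover have "(\<Sum>i\<in>reduced_indices. v i * c i) = (\<Sum>i\<in>reduced_indices. v i * L.drift i) - (\<Sum>i\<in>reduced_indices. v i * L'.drift i)"
      by (simp add: c_def right_diff_distrib sum_subtractf)
    ultimately show ?thesis
      unfolding L.levy_log_reduced[OF sum_lift] L'.levy_log_reduced[OF sum_lift] reduced
      by (simp only: of_real_diff right_diff_distrib) simp
  qed
  note [measurable] = reduced_component_measurable
  define shift where "shift y = (\<lambda>i\<in>reduced_indices. y i + c i)" for y :: "'n \<Rightarrow> real"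
  have shift_meas [measurable]: "shift \<in> reduced_borel \<rightarrow>\<^sub>M reduced_borel"
    unfolding shift_def[abs_def] reduced_borel_def
    by (auto intro!: measurable_restrict borel_measurable_add measurable_component_singleton)
  have law: "tilted_law M \<xi> = distr (tilted_law M' \<xi>') reduced_borel shift"
  proof (rule tilted_law_eq_if_char_eq[OF L.\<xi>_measurable L.exp_integrable])
    show "finite_measure (distr (tilted_law M' \<xi>') reduced_borel shift)"
      by (rule finite_measure.finite_measure_distr[OF L'.finite_measure_law]) simp
    fix v :: "'n \<Rightarrow> real"
    have "(\<lambda>y. \<Sum>i\<in>reduced_indices. v i * y i) \<in> borel_measurable reduced_borel"
      by (rule reduced_sum_measurable) simp
    from measurable_compose[OF this, of iexp borel]
    have [measurable]: "(\<lambda>y. iexp (\<Sum>i\<in>reduced_indices. v i * y i)) \<in> borel_measurable reduced_borel" by simp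
    have "(CLINT y|distr (tilted_law M' \<xi>') reduced_borel shift. iexp (\<Sum>i\<in>reduced_indices. v i * y i))
      = (CLINT y|tilted_law M' \<xi>'. iexp (\<Sum>i\<in>reduced_indices. v i * shift y i))"
      by (rule integral_distr) simp_all
    also have "\<dots> = (CLINT y|tilted_law M' \<xi>'. iexp (\<Sum>i\<in>reduced_indices. v i * c i) * iexp (\<Sum>i\<in>reduced_indices. v i * y i))"
    proof (rule Bochner_Integration.integral_cong[OF refl])
      fix y
      have "(\<Sum>i\<in>reduced_indices. v i * shift y i) = (\<Sum>i\<in>reduced_indices. v i * c i) + (\<Sum>i\<in>reduced_indices. v i * y i)"
        unfolding sum.distrib[symmetric] by (intro sum.cong) (auto simp: shift_def algebra_simps)
      then show "iexp (\<Sum>i\<in>reduced_indices. v i * shift y i) = iexp (\<Sum>i\<in>reduced_indices. v i * c i) * iexp (\<Sum>i\<in>reduced_indices. v i * y i)"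
        by (simp only: of_real_add distrib_left exp_add)
    qed
    also have "\<dots> = iexp (\<Sum>i\<in>reduced_indices. v i * c i) * exp (L'.levy_log 1 last_index (lift v))"
      unfolding L'.char_law[symmetric] by (rule integral_mult_right_zero)
    also have "\<dots> = exp (L.levy_log 1 last_index (lift v))"
      unfolding log exp_add ..
    finally show "(CLINT \<omega>|M. exp (clin 1 last_index (lift v) (\<xi> \<omega>)))
        = (CLINT y|distr (tilted_law M' \<xi>') reduced_borel shift. iexp (\<Sum>i\<in>reduced_indices. v i * y i))"
      by (simp only: L.tilted_char_eq)
  qed simp
  \<comment> \<open>A shift by c multiplies the integral of exp y_i by exp (c i); as the two
    expectations are equal and positive, exp (c i) = 1.\<close>
  have c_zero: "c i = 0" if i: "i \<in> reduced_indices" for i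
  proof -
    have exp_meas: "(\<lambda>y. exp (y i)) \<in> borel_measurable reduced_borel"
      using i by measurable
    have "(\<integral>y. exp (y i) \<partial>tilted_law M \<xi>) = (\<integral>y. exp (y i) * exp (c i) \<partial>tilted_law M' \<xi>')"
      unfolding law using i exp_meas by (subst integral_distr) (auto simp: shift_def exp_add)
    then have "(\<integral>\<omega>. exp (\<xi> \<omega> $ i) \<partial>M) = (\<integral>\<omega>. exp (\<xi>' \<omega> $ i) \<partial>M') * exp (c i)"
      using i expectation_tilted_law[OF L.\<xi>_measurable, of i] expectation_tilted_law[OF L'.\<xi>_measurable, of i] by simp
    then show ?thesis unfolding expectation L'.expectation_exp by simp
  qed
  then have "L.levy_log 1 last_index (lift v) = L'.levy_log 1 last_index (lift v)" for v
    using log[of v] by simp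
  then show ?thesis
    using L.tilted_char_eq L'.char_law L'.finite_measure_law
    by (intro tilted_law_eq_if_char_eq[OF L.\<xi>_measurable L.exp_integrable]) simp_all
qed

lemma zonoid_equivalent_iff:
  "zonoid_equivalent M (\<lambda>\<omega>. exp_vec (\<xi> \<omega>)) M' (\<lambda>\<omega>. exp_vec (\<xi>' \<omega>)) \<longleftrightarrow>
    (\<forall>i j. levy_gamma A i j = levy_gamma A' i j) \<and>
    reduced_levy_measure \<nu> = reduced_levy_measure \<nu>' \<and>
    (\<forall>i. (\<integral>\<omega>. exp (\<xi> \<omega> $ i) \<partial>M) = (\<integral>\<omega>. exp (\<xi>' \<omega> $ i) \<partial>M'))"
  unfolding zonoid_equivalent_exp_iff[OF L.\<xi>_measurable L'.\<xi>_measurable L.exp_vec_integrable L'.exp_vec_integrable]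
  using expectation_exp_eq_if_law_eq reduced_levy_measure_eq_if_law_eq levy_gamma_eq_if_law_eq law_eq_if by blast

end

section \<open>Dimension one\<close>

text \<open>Without differences the reduced space is the single point \<open>reduced_zero\<close>,
  so the first two conditions hold automatically and the general equivalence leaves only the
  expectations.\<close>

lemma levy_data_eq_if_CARD_eq_1:
  assumes card: "CARD('n::{finite,linorder}) = 1"
  shows "levy_gamma (A :: real ^ 'n::{finite,linorder} ^ 'n::{finite,linorder}) i j = levy_gamma A' i j"
    and "reduced_levy_measure (\<nu> :: (real ^ 'n::{finite,linorder}) measure) = reduced_levy_measure \<nu>'"
proof -
  have single: "k = l" for k l :: 'n
    using card by (metis UNIV_I card_1_singletonE singletonD)
  show "levy_gamma A i j = levy_gamma A' i j"
    using single[of i j] by (simp add: levy_gamma_def)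
  show "reduced_levy_measure \<nu> = reduced_levy_measure \<nu>'"
  proof (rule reduced_levy_measure_eq_if_image_eq)
    fix B :: "('n \<Rightarrow> real) set" assume B: "B \<in> sets reduced_borel" "reduced_zero \<notin> B"
    have "y = reduced_zero" if "y \<in> space reduced_borel" for y :: "'n \<Rightarrow> real"
      using that single by (auto simp: reduced_zero_def reduced_borel_def space_PiM PiE_iff extensional_def fun_eq_iff)
    then have "B = {}" using B sets.sets_into_space[OF B(1)] by blast
    then show "emeasure (reduced_image \<nu>) B = emeasure (reduced_image \<nu>') B" by simp
  qed
qed

theorem theorem37:
  fixes M :: "'a measure" and \<xi> :: "'a \<Rightarrow> real ^ 'n::{finite,linorder}"
    and M' :: "'b measure" and \<xi>' :: "'b \<Rightarrow> real ^ 'n::{finite,linorder}"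
    and A A' :: "real ^ 'n::{finite,linorder} ^ 'n::{finite,linorder}" and \<nu> \<nu>' :: "(real ^ 'n::{finite,linorder}) measure" and b b' :: "real ^ 'n::{finite,linorder}"
  assumes "prob_space M" and "\<xi> \<in> borel_measurable M"
    and "prob_space M'" and "\<xi>' \<in> borel_measurable M'"
    and "integrable M (\<lambda>\<omega>. exp_vec (\<xi> \<omega>))"
    and "integrable M' (\<lambda>\<omega>. exp_vec (\<xi>' \<omega>))"
    and "infinitely_divisible M \<xi>" and "has_levy_triplet M \<xi> A \<nu> b"
    and "infinitely_divisible M' \<xi>'" and "has_levy_triplet M' \<xi>' A' \<nu>' b'"
  shows "(CARD('n) \<ge> 2 \<longrightarrow>
            (zonoid_equivalent M (\<lambda>\<omega>. exp_vec (\<xi> \<omega>)) M' (\<lambda>\<omega>. exp_vec (\<xi>' \<omega>)) \<longleftrightarrow>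
               (\<forall>i j. levy_gamma A i j = levy_gamma A' i j) \<and>
               reduced_levy_measure \<nu> = reduced_levy_measure \<nu>' \<and>
               (\<forall>i. (\<integral>\<omega>. exp (\<xi> \<omega> $ i) \<partial>M) = (\<integral>\<omega>. exp (\<xi>' \<omega> $ i) \<partial>M'))))
       \<and> (CARD('n) = 1 \<longrightarrow>
            (zonoid_equivalent M (\<lambda>\<omega>. exp_vec (\<xi> \<omega>)) M' (\<lambda>\<omega>. exp_vec (\<xi>' \<omega>)) \<longleftrightarrow>
               (\<forall>i. (\<integral>\<omega>. exp (\<xi> \<omega> $ i) \<partial>M) = (\<integral>\<omega>. exp (\<xi>' \<omega> $ i) \<partial>M'))))
       \<and> (\<forall>i. (\<integral>\<omega>. exp (\<xi> \<omega> $ i) \<partial>M) = (\<integral>\<omega>. exp (\<xi>' \<omega> $ i) \<partial>M') \<longleftrightarrow>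
               levy_exponent A \<nu> b i = levy_exponent A' \<nu>' b' i)"
proof -
  interpret levy_vector_pair M \<xi> A \<nu> b M' \<xi>' A' \<nu>' b'
    by (intro levy_vector_pair.intro reduced_levy_vector.intro exp_integrable_levy_vector.intro assms)
  have "(\<forall>i j. levy_gamma A i j = levy_gamma A' i j) \<and> reduced_levy_measure \<nu> = reduced_levy_measure \<nu>'"
    if "CARD('n) = 1"
    using levy_data_eq_if_CARD_eq_1[OF that] by blast
  then show ?thesis
    using zonoid_equivalent_iff expectation_exp_eq_iff by blast
qed

end
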